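(* Let $M$ be a connected smooth manifold of dimension $n\ge 2$ and let $F$ be an essentially Berwald Finsler metric on $M$. Suppose that $F$ is projectively flat, that is, there exists a flat Riemannian metric on $M$ which is geodesically equivalent to $F$. Then $F$ is isometric to a Minkowski metric.
   Context: A Finsler metric on $M$ is a function $F:TM\to\mathbb{R}_{\ge 0}$ that is smooth on the complement of the zero section of $TM$ and such that for every $x\in M$, all $\xi,\eta\in T_xM$ and all real $\lambda\ge 0$: $F(\lambda\xi)=\lambda F(\xi)$; $F(\xi+\eta)\le F(\xi)+F(\eta)$; and $F(\xi)=0$ implies $\xi=0$. Neither strict convexity of $F$ nor $F(-\xi)=F(\xi)$ is required. A Finsler metric $F$ is Berwald if there exists a symmetric (torsion-free) affine connection $\Gamma$ on $M$ whose parallel transport preserves the function $F$. $F$ is essentially Berwald if it is Berwald but not Riemannian, i.e. not of the form $F(x,\xi)=\sqrt{g_{(x)}(\xi,\xi)}$ for a Riemannian metric $g$. A Minkowski metric is the Finsler metric $F(x,\xi)=p(\xi)$ on $\mathbb{R}^n$, for $(x,\xi)\in T\mathbb{R}^n=\mathbb{R}^n\times\mathbb{R}^n$, where $p:\mathbb{R}^n\to\mathbb{R}_{\ge0}$ is a smooth norm (smooth away from $0$), meaning $p(\lambda\xi)=\lambda p(\xi)$ for $\lambda\ge 0$, $p(\xi+\eta)\le p(\xi)+p(\eta)$, and $p(\xi)=0\Rightarrow\xi=0$ (symmetry $p(-\xi)=p(\xi)$ is not required). An $F$-geodesic is a geodesic of the Finsler metric $F$ in the usual sense: parametrized $F$-geodesics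 are the smooth curves with nonvanishing velocity satisfying the Euler–Lagrange equations of the Lagrangian $\frac12F^2$, and unparametrized $F$-geodesics are such curves up to orientation-preserving reparametrization. A Riemannian metric $\bar g$ is geodesically equivalent to $F$ if every $\bar g$-geodesic, considered as an unparametrized curve, is also an $F$-geodesic.
   Formalization: "Isometric to a Minkowski metric" is proved as local isometry: every point of M has a neighbourhood isometric to an open subset of R^n with one common smooth norm p; a global isometry fails, e.g. for the torus R^n/Z^n with a non-Euclidean norm. *)

theory Defs
  imports "HOL-Analysis.Analysis"
begin

section \<open>Smooth functions on open sets\<close>

text \<open>Only meant for open sets \<open>S\<close>, since the derivatives are taken in the ambient space. The clause
  for \<open>Suc k\<close> asks that all directional derivatives be \<open>k\<close> times continuously differentiable, which in
  finite dimension is the usual class \<open>C\<^sup>k\<^sup>+\<^sup>1\<close>.\<close>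

primrec Ck_on :: "nat \<Rightarrow> 'a::real_normed_vector set \<Rightarrow> ('a \<Rightarrow> 'b::real_normed_vector) \<Rightarrow> bool" where
  "Ck_on 0 S f \<longleftrightarrow> continuous_on S f"
| "Ck_on (Suc k) S f \<longleftrightarrow>
     (\<forall>x\<in>S. f differentiable (at x)) \<and> (\<forall>v. Ck_on k S (\<lambda>x. frechet_derivative f (at x) v))"

definition smooth_on :: "'a::real_normed_vector set \<Rightarrow> ('a \<Rightarrow> 'b::real_normed_vector) \<Rightarrow> bool" where
  "smooth_on S f \<longleftrightarrow> (\<forall>k. Ck_on k S f)"

section \<open>Smooth manifolds\<close>

text \<open>A chart is a pair of its domain and its coordinate map. A smooth manifold is given by an atlas
  (not necessarily maximal); its points form the union of the chart domains, an open subset of a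
  Hausdorff second countable space, and its dimension is \<open>CARD('n)\<close>.\<close>

type_synonym ('m, 'n) chart = "'m set \<times> ('m \<Rightarrow> real ^ 'n)"

abbreviation cdom :: "('m, 'n::finite) chart \<Rightarrow> 'm set" where "cdom \<equiv> fst"

abbreviation cmap :: "('m, 'n::finite) chart \<Rightarrow> 'm \<Rightarrow> real ^ 'n" where "cmap \<equiv> snd"

definition cimg :: "('m, 'n::finite) chart \<Rightarrow> (real ^ 'n) set" where
  "cimg c = cmap c ` cdom c"

definition cinv :: "('m, 'n::finite) chart \<Rightarrow> real ^ 'n \<Rightarrow> 'm" where
  "cinv c = inv_into (cdom c) (cmap c)"

definition is_chart :: "('m::topological_space, 'n::finite) chart \<Rightarrow> bool" where
  "is_chart c \<longleftrightarrow> open (cdom c) \<and> open (cimg c) \<and> homeomorphism (cdom c) (cimg c) (cmap c) (cinv c)"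

definition transition :: "('m, 'n::finite) chart \<Rightarrow> ('m, 'n) chart \<Rightarrow> real ^ 'n \<Rightarrow> real ^ 'n" where
  "transition c d = cmap d \<circ> cinv c"

definition smooth_atlas :: "('m::{t2_space, second_countable_topology}, 'n::finite) chart set \<Rightarrow> bool" where
  "smooth_atlas A \<longleftrightarrow>
     (\<forall>c\<in>A. is_chart c) \<and>
     (\<forall>c\<in>A. \<forall>d\<in>A. smooth_on (cmap c ` (cdom c \<inter> cdom d)) (transition c d))"

definition points :: "('m, 'n::finite) chart set \<Rightarrow> 'm set" where
  "points A = (\<Union>c\<in>A. cdom c)"

definition charts_at :: "('m, 'n::finite) chart set \<Rightarrow> 'm \<Rightarrow> ('m, 'n) chart set" where
  "charts_at A x = {c \<in> A. x \<in> cdom c}"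

text \<open>A tangent vector at \<open>x\<close> is the family of its components in all charts around \<open>x\<close>, transforming by
  the differentials of the coordinate changes. (It is \<open>0\<close> at all other charts, so that vectors are
  determined by their components.) The vector space operations are those of families, taken chart by
  chart.\<close>

type_synonym ('m, 'n) tvec = "('m, 'n) chart \<Rightarrow> real ^ 'n"

definition tangent_space :: "('m, 'n::finite) chart set \<Rightarrow> 'm \<Rightarrow> ('m, 'n) tvec set" where
  "tangent_space A x = {\<xi>.
     (\<forall>c. c \<notin> charts_at A x \<longrightarrow> \<xi> c = 0) \<and>
     (\<forall>c\<in>charts_at A x. \<forall>d\<in>charts_at A x.
        \<xi> d = frechet_derivative (transition c d) (at (cmap c x)) (\<xi> c))}"

text \<open>The tangent vector at \<open>x\<close> with components \<open>u\<close> in the chart \<open>c\<close>.\<close>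

definition tvec_of :: "('m, 'n::finite) chart set \<Rightarrow> ('m, 'n) chart \<Rightarrow> 'm \<Rightarrow> real ^ 'n \<Rightarrow> ('m, 'n) tvec" where
  "tvec_of A c x u =
     (\<lambda>d. if d \<in> charts_at A x then frechet_derivative (transition c d) (at (cmap c x)) u else 0)"

section \<open>Finsler and Riemannian metrics\<close>

text \<open>Functions on the tangent bundle are curried; their values at pairs \<open>(x, \<xi>)\<close> with
  \<open>\<xi> \<notin> tangent_space A x\<close> are irrelevant.\<close>

definition local_rep ::
  "('m, 'n::finite) chart set \<Rightarrow> ('m \<Rightarrow> ('m, 'n) tvec \<Rightarrow> real) \<Rightarrow> ('m, 'n) chart
     \<Rightarrow> (real ^ 'n) \<times> (real ^ 'n) \<Rightarrow> real" where
  "local_rep A F c = (\<lambda>(y, u). F (cinv c y) (tvec_of A c (cinv c y) u))"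

definition finsler_metric :: "('m, 'n::finite) chart set \<Rightarrow> ('m \<Rightarrow> ('m, 'n) tvec \<Rightarrow> real) \<Rightarrow> bool" where
  "finsler_metric A F \<longleftrightarrow>
     (\<forall>c\<in>A. smooth_on (cimg c \<times> (UNIV - {0})) (local_rep A F c)) \<and>
     (\<forall>x\<in>points A. \<forall>\<xi>\<in>tangent_space A x.
        0 \<le> F x \<xi> \<and>
        (\<forall>l\<ge>0. F x (\<lambda>c. l *\<^sub>R \<xi> c) = l * F x \<xi>) \<and>
        (\<forall>\<eta>\<in>tangent_space A x. F x (\<lambda>c. \<xi> c + \<eta> c) \<le> F x \<xi> + F x \<eta>) \<and>
        (F x \<xi> = 0 \<longrightarrow> \<xi> = (\<lambda>c. 0)))"

definition metric_rep ::
  "('m, 'n::finite) chart set \<Rightarrow> ('m \<Rightarrow> ('m, 'n) tvec \<Rightarrow> ('m, 'n) tvec \<Rightarrow> real) \<Rightarrow> ('m, 'n) chart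
     \<Rightarrow> real ^ 'n \<Rightarrow> real ^ 'n \<Rightarrow> real ^ 'n \<Rightarrow> real" where
  "metric_rep A g c y u v = g (cinv c y) (tvec_of A c (cinv c y) u) (tvec_of A c (cinv c y) v)"

definition riemannian_metric ::
  "('m, 'n::finite) chart set \<Rightarrow> ('m \<Rightarrow> ('m, 'n) tvec \<Rightarrow> ('m, 'n) tvec \<Rightarrow> real) \<Rightarrow> bool" where
  "riemannian_metric A g \<longleftrightarrow>
     (\<forall>c\<in>A. \<forall>u v. smooth_on (cimg c) (\<lambda>y. metric_rep A g c y u v)) \<and>
     (\<forall>x\<in>points A. \<forall>\<xi>\<in>tangent_space A x.
        (\<forall>\<eta>\<in>tangent_space A x.
           g x \<xi> \<eta> = g x \<eta> \<xi> \<and>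
           (\<forall>l. g x (\<lambda>c. l *\<^sub>R \<xi> c) \<eta> = l * g x \<xi> \<eta>) \<and>
           (\<forall>\<zeta>\<in>tangent_space A x. g x (\<lambda>c. \<xi> c + \<zeta> c) \<eta> = g x \<xi> \<eta> + g x \<zeta> \<eta>)) \<and>
        (\<xi> \<noteq> (\<lambda>c. 0) \<longrightarrow> 0 < g x \<xi> \<xi>))"

definition riem_norm ::
  "('m \<Rightarrow> ('m, 'n::finite) tvec \<Rightarrow> ('m, 'n) tvec \<Rightarrow> real) \<Rightarrow> 'm \<Rightarrow> ('m, 'n) tvec \<Rightarrow> real" where
  "riem_norm g x \<xi> = sqrt (g x \<xi> \<xi>)"

definition is_riemannian :: "('m, 'n::finite) chart set \<Rightarrow> ('m \<Rightarrow> ('m, 'n) tvec \<Rightarrow> real) \<Rightarrow> bool" where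
  "is_riemannian A F \<longleftrightarrow>
     (\<exists>g. riemannian_metric A g \<and> (\<forall>x\<in>points A. \<forall>\<xi>\<in>tangent_space A x. F x \<xi> = riem_norm g x \<xi>))"

section \<open>Affine connections\<close>

text \<open>A connection is given by its Christoffel symbols in every chart, written as a bilinear map:
  the \<open>k\<close>-th component of \<open>\<Gamma> c y u v\<close> is the sum over \<open>i, j\<close> of \<open>\<Gamma>\<^sup>k\<^sub>i\<^sub>j(y) u\<^sup>i v\<^sup>j\<close>. The last clause is the
  transformation law of Christoffel symbols under the coordinate change from \<open>c\<close> to \<open>d\<close>.\<close>

type_synonym ('m, 'n) christoffel = "('m, 'n) chart \<Rightarrow> real ^ 'n \<Rightarrow> real ^ 'n \<Rightarrow> real ^ 'n \<Rightarrow> real ^ 'n"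

definition symmetric_connection :: "('m, 'n::finite) chart set \<Rightarrow> ('m, 'n) christoffel \<Rightarrow> bool" where
  "symmetric_connection A \<Gamma> \<longleftrightarrow>
     (\<forall>c\<in>A. \<forall>y\<in>cimg c. bilinear (\<Gamma> c y) \<and> (\<forall>u v. \<Gamma> c y u v = \<Gamma> c y v u)) \<and>
     (\<forall>c\<in>A. \<forall>u v. smooth_on (cimg c) (\<lambda>y. \<Gamma> c y u v)) \<and>
     (\<forall>c\<in>A. \<forall>d\<in>A. \<forall>x\<in>cdom c \<inter> cdom d. \<forall>u v.
        let y = cmap c x; D = (\<lambda>z. frechet_derivative (transition c d) (at z)) in
        D y (\<Gamma> c y u v) =
          \<Gamma> d (cmap d x) (D y u) (D y v) + frechet_derivative (\<lambda>z. D z u) (at y) v)"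

text \<open>The curvature \<open>R(u,v)w\<close> in a chart, for constant coordinate fields \<open>u, v, w\<close>.\<close>

definition curvature ::
  "('m, 'n::finite) christoffel \<Rightarrow> ('m, 'n) chart \<Rightarrow> real ^ 'n \<Rightarrow> real ^ 'n \<Rightarrow> real ^ 'n \<Rightarrow> real ^ 'n
     \<Rightarrow> real ^ 'n" where
  "curvature \<Gamma> c y u v w =
     frechet_derivative (\<lambda>z. \<Gamma> c z v w) (at y) u - frechet_derivative (\<lambda>z. \<Gamma> c z u w) (at y) v
     + \<Gamma> c y u (\<Gamma> c y v w) - \<Gamma> c y v (\<Gamma> c y u w)"

definition levi_civita ::
  "('m, 'n::finite) chart set \<Rightarrow> ('m \<Rightarrow> ('m, 'n) tvec \<Rightarrow> ('m, 'n) tvec \<Rightarrow> real) \<Rightarrow> ('m, 'n) christoffel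
     \<Rightarrow> bool" where
  "levi_civita A g \<Gamma> \<longleftrightarrow>
     symmetric_connection A \<Gamma> \<and>
     (\<forall>c\<in>A. \<forall>y\<in>cimg c. \<forall>u v.
        ((\<lambda>z. metric_rep A g c z u v) has_derivative
         (\<lambda>w. metric_rep A g c y (\<Gamma> c y w u) v + metric_rep A g c y u (\<Gamma> c y w v))) (at y))"

definition flat_metric ::
  "('m, 'n::finite) chart set \<Rightarrow> ('m \<Rightarrow> ('m, 'n) tvec \<Rightarrow> ('m, 'n) tvec \<Rightarrow> real) \<Rightarrow> bool" where
  "flat_metric A g \<longleftrightarrow>
     (\<exists>\<Gamma>. levi_civita A g \<Gamma> \<and> (\<forall>c\<in>A. \<forall>y\<in>cimg c. \<forall>u v w. curvature \<Gamma> c y u v w = 0))"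

section \<open>Curves, parallel transport and Berwald metrics\<close>

text \<open>Parameter intervals are open, possibly unbounded.\<close>

definition open_interval :: "real set \<Rightarrow> bool" where
  "open_interval I \<longleftrightarrow> open I \<and> is_interval I \<and> I \<noteq> {}"

definition smooth_curve ::
  "('m::topological_space, 'n::finite) chart set \<Rightarrow> real set \<Rightarrow> (real \<Rightarrow> 'm) \<Rightarrow> bool" where
  "smooth_curve A I \<gamma> \<longleftrightarrow>
     open_interval I \<and> \<gamma> ` I \<subseteq> points A \<and> continuous_on I \<gamma> \<and>
     (\<forall>c\<in>A. smooth_on {t \<in> I. \<gamma> t \<in> cdom c} (cmap c \<circ> \<gamma>))"

definition velocity :: "('m, 'n::finite) chart set \<Rightarrow> (real \<Rightarrow> 'm) \<Rightarrow> real \<Rightarrow> ('m, 'n) tvec" where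
  "velocity A \<gamma> t =
     (\<lambda>c. if c \<in> charts_at A (\<gamma> t) then vector_derivative (cmap c \<circ> \<gamma>) (at t) else 0)"

definition parallel_along ::
  "('m, 'n::finite) chart set \<Rightarrow> ('m, 'n) christoffel \<Rightarrow> real set \<Rightarrow> (real \<Rightarrow> 'm)
     \<Rightarrow> (real \<Rightarrow> ('m, 'n) tvec) \<Rightarrow> bool" where
  "parallel_along A \<Gamma> I \<gamma> V \<longleftrightarrow>
     (\<forall>t\<in>I. V t \<in> tangent_space A (\<gamma> t) \<and>
        (\<forall>c\<in>charts_at A (\<gamma> t).
           ((\<lambda>s. V s c) has_vector_derivative
            - \<Gamma> c (cmap c (\<gamma> t)) (velocity A \<gamma> t c) (V t c)) (at t)))"

definition parallel_transport_preserves ::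
  "('m::topological_space, 'n::finite) chart set \<Rightarrow> ('m, 'n) christoffel
     \<Rightarrow> ('m \<Rightarrow> ('m, 'n) tvec \<Rightarrow> real) \<Rightarrow> bool" where
  "parallel_transport_preserves A \<Gamma> F \<longleftrightarrow>
     (\<forall>I \<gamma> V. smooth_curve A I \<gamma> \<longrightarrow> parallel_along A \<Gamma> I \<gamma> V \<longrightarrow>
        (\<forall>s\<in>I. \<forall>t\<in>I. F (\<gamma> s) (V s) = F (\<gamma> t) (V t)))"

definition berwald ::
  "('m::topological_space, 'n::finite) chart set \<Rightarrow> ('m \<Rightarrow> ('m, 'n) tvec \<Rightarrow> real) \<Rightarrow> bool" where
  "berwald A F \<longleftrightarrow>
     finsler_metric A F \<and> (\<exists>\<Gamma>. symmetric_connection A \<Gamma> \<and> parallel_transport_preserves A \<Gamma> F)"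

definition essentially_berwald ::
  "('m::topological_space, 'n::finite) chart set \<Rightarrow> ('m \<Rightarrow> ('m, 'n) tvec \<Rightarrow> real) \<Rightarrow> bool" where
  "essentially_berwald A F \<longleftrightarrow> berwald A F \<and> \<not> is_riemannian A F"

section \<open>Geodesics and geodesic equivalence\<close>

definition lagrangian ::
  "('m, 'n::finite) chart set \<Rightarrow> ('m \<Rightarrow> ('m, 'n) tvec \<Rightarrow> real) \<Rightarrow> ('m, 'n) chart
     \<Rightarrow> (real ^ 'n) \<times> (real ^ 'n) \<Rightarrow> real" where
  "lagrangian A F c p = (local_rep A F c p)\<^sup>2 / 2"

text \<open>The last clause is the system of Euler--Lagrange equations of the Lagrangian, contracted with an
  arbitrary constant vector \<open>w\<close>; \<open>L\<close> is differentiated in position along \<open>(w, 0)\<close> and in velocity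
  along \<open>(0, w)\<close>.\<close>

definition geodesic ::
  "('m::topological_space, 'n::finite) chart set \<Rightarrow> ('m \<Rightarrow> ('m, 'n) tvec \<Rightarrow> real) \<Rightarrow> real set
     \<Rightarrow> (real \<Rightarrow> 'm) \<Rightarrow> bool" where
  "geodesic A F I \<gamma> \<longleftrightarrow>
     smooth_curve A I \<gamma> \<and>
     (\<forall>t\<in>I. velocity A \<gamma> t \<noteq> (\<lambda>c. 0)) \<and>
     (\<forall>t\<in>I. \<forall>c\<in>charts_at A (\<gamma> t). \<forall>w.
        let L' = (\<lambda>s. frechet_derivative (lagrangian A F c) (at (cmap c (\<gamma> s), velocity A \<gamma> s c))) in
        ((\<lambda>s. L' s (0, w)) has_real_derivative L' t (w, 0)) (at t))"

definition unparametrized_geodesic ::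
  "('m::topological_space, 'n::finite) chart set \<Rightarrow> ('m \<Rightarrow> ('m, 'n) tvec \<Rightarrow> real) \<Rightarrow> real set
     \<Rightarrow> (real \<Rightarrow> 'm) \<Rightarrow> bool" where
  "unparametrized_geodesic A F I \<gamma> \<longleftrightarrow>
     (\<exists>J \<theta>. open_interval J \<and> smooth_on J \<theta> \<and> \<theta> ` J = I \<and> (\<forall>t\<in>J. 0 < deriv \<theta> t) \<and>
        geodesic A F J (\<gamma> \<circ> \<theta>))"

text \<open>The geodesics of a Riemannian metric are those of the Finsler metric that it defines.\<close>

definition geodesically_equivalent ::
  "('m::topological_space, 'n::finite) chart set \<Rightarrow> ('m \<Rightarrow> ('m, 'n) tvec \<Rightarrow> ('m, 'n) tvec \<Rightarrow> real)
     \<Rightarrow> ('m \<Rightarrow> ('m, 'n) tvec \<Rightarrow> real) \<Rightarrow> bool" where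
  "geodesically_equivalent A g F \<longleftrightarrow>
     (\<forall>I \<gamma>. geodesic A (riem_norm g) I \<gamma> \<longrightarrow> unparametrized_geodesic A F I \<gamma>)"

definition projectively_flat ::
  "('m::topological_space, 'n::finite) chart set \<Rightarrow> ('m \<Rightarrow> ('m, 'n) tvec \<Rightarrow> real) \<Rightarrow> bool" where
  "projectively_flat A F \<longleftrightarrow>
     (\<exists>g. riemannian_metric A g \<and> flat_metric A g \<and> geodesically_equivalent A g F)"

section \<open>Isometries and Minkowski metrics\<close>

definition smooth_map ::
  "('m::topological_space, 'n::finite) chart set \<Rightarrow> ('k::topological_space, 'd::finite) chart set
     \<Rightarrow> 'm set \<Rightarrow> ('m \<Rightarrow> 'k) \<Rightarrow> bool" where
  "smooth_map A B U f \<longleftrightarrow>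
     open U \<and> U \<subseteq> points A \<and> f ` U \<subseteq> points B \<and> continuous_on U f \<and>
     (\<forall>c\<in>A. \<forall>d\<in>B. smooth_on (cmap c ` {x \<in> U \<inter> cdom c. f x \<in> cdom d}) (cmap d \<circ> f \<circ> cinv c))"

text \<open>The differential of \<open>f\<close> at \<open>x\<close>, computed in any chart \<open>c\<close> around \<open>x\<close>.\<close>

definition differential ::
  "('m, 'n::finite) chart set \<Rightarrow> ('k, 'd::finite) chart set \<Rightarrow> ('m \<Rightarrow> 'k) \<Rightarrow> 'm
     \<Rightarrow> ('m, 'n) tvec \<Rightarrow> ('k, 'd) tvec" where
  "differential A B f x \<xi> =
     (let c = (SOME c. c \<in> charts_at A x) in
      (\<lambda>d. if d \<in> charts_at B (f x)
           then frechet_derivative (cmap d \<circ> f \<circ> cinv c) (at (cmap c x)) (\<xi> c) else 0))"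

definition diffeo_onto_image ::
  "('m::topological_space, 'n::finite) chart set \<Rightarrow> ('k::topological_space, 'd::finite) chart set
     \<Rightarrow> 'm set \<Rightarrow> ('m \<Rightarrow> 'k) \<Rightarrow> bool" where
  "diffeo_onto_image A B U f \<longleftrightarrow>
     inj_on f U \<and> smooth_map A B U f \<and> smooth_map B A (f ` U) (inv_into U f)"

text \<open>Isometry is understood locally: a global isometry onto all of
  \<open>\<real>\<^sup>n\<close> cannot be expected, since for example an open ball or a torus with the metric induced by a
  norm is locally but not globally isometric to a Minkowski metric on \<open>\<real>\<^sup>n\<close>. The target metric is the
  same for all points of the manifold.\<close>

definition locally_isometric ::
  "('m::topological_space, 'n::finite) chart set \<Rightarrow> ('m \<Rightarrow> ('m, 'n) tvec \<Rightarrow> real)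
     \<Rightarrow> ('k::topological_space, 'd::finite) chart set \<Rightarrow> ('k \<Rightarrow> ('k, 'd) tvec \<Rightarrow> real) \<Rightarrow> bool" where
  "locally_isometric A F B G \<longleftrightarrow>
     (\<forall>x\<in>points A. \<exists>U f. x \<in> U \<and> diffeo_onto_image A B U f \<and>
        (\<forall>y\<in>U. \<forall>\<xi>\<in>tangent_space A y. G (f y) (differential A B f y \<xi>) = F y \<xi>))"

definition std_chart :: "(real ^ 'n, 'n::finite) chart" where
  "std_chart = (UNIV, id)"

definition std_atlas :: "(real ^ 'n, 'n::finite) chart set" where
  "std_atlas = {std_chart}"

definition smooth_norm :: "(real ^ 'n::finite \<Rightarrow> real) \<Rightarrow> bool" where
  "smooth_norm p \<longleftrightarrow>
     smooth_on (UNIV - {0}) p \<and>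
     (\<forall>\<xi>. 0 \<le> p \<xi>) \<and>
     (\<forall>\<xi>. \<forall>l\<ge>0. p (l *\<^sub>R \<xi>) = l * p \<xi>) \<and>
     (\<forall>\<xi> \<eta>. p (\<xi> + \<eta>) \<le> p \<xi> + p \<eta>) \<and>
     (\<forall>\<xi>. p \<xi> = 0 \<longrightarrow> \<xi> = 0)"

definition minkowski ::
  "(real ^ 'n::finite \<Rightarrow> real) \<Rightarrow> real ^ 'n \<Rightarrow> (real ^ 'n, 'n) tvec \<Rightarrow> real" where
  "minkowski p x \<xi> = p (\<xi> std_chart)"

end

theory Submission
  imports Defs
begin

text \<open>No averaged Riemannian metric is used. Let \<open>\<Gamma>\<close> be the connection whose parallel transport preserves
  \<open>F\<close>; its geodesics solve the Euler--Lagrange equations of \<open>F\<^sup>2 / 2\<close>, and so do, after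
  reparametrization, those of the flat metric. Where the Hessian of \<open>F\<^sup>2 / 2\<close> along the fibre is
  nondegenerate, the two accelerations therefore differ by a multiple of the velocity. Without strict
  convexity this is known only for an open set of directions (those near a direction in which \<open>F\<close> is least
  relative to a Euclidean norm), but it is a polynomial condition on the direction, hence holds for all
  directions: \<open>\<Gamma>\<close> is projectively flat, with curvature
  \<open>R(u,v)w = P(u,w)v - P(v,w)u + (P(u,v) - P(v,u))w\<close>.

  The curvature operators are infinitesimal symmetries of the norm \<open>F\<close> on each tangent space. A norm has
  no infinitesimal symmetry with a nonzero real eigenvalue, a nilpotent part or a spiral; this forces
  \<open>P\<close> to be zero or definite on each plane. If \<open>P\<close> does not vanish at some point, the operators \<open>R(u,v)\<close>
  generate all rotations with respect to \<open>P\<close>, so that \<open>F\<close> is Euclidean there and, by parallel transport,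
  everywhere, and \<open>F\<close> is Riemannian. Otherwise \<open>\<Gamma>\<close> is flat, and \<open>F\<close> does not depend on the point in affine
  coordinates of \<open>\<Gamma>\<close>; the norms obtained at different points are linearly isometric by parallel
  transport.\<close>

text \<open>What can be used is a comparison: two solutions with the same position and velocity have
  accelerations that differ by a vector in the kernel of the Hessian. The curvature operators are
  symmetries because \<open>F\<close> is annihilated by the horizontal fields
  \<open>(v, - \<Gamma> v u)\<close> and hence by their brackets. The forbidden symmetries are
  impossible because their flows carry a vector to infinity on a line or rescale it, while
  \<open>F\<close> stays constant along them.

  All differential equations that have to be solved are linear. Parallel transport is built along
  rays of a chart only; affine coordinates of a flat connection come from a Frobenius type theorem
  for linear total differential equations, in which torsion-freeness and vanishing curvature are the
  integrability conditions; and the geodesics of the flat metric are straight lines in its affine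
  coordinates.\<close>

abbreviation fd :: "('a::real_normed_vector \<Rightarrow> 'b::real_normed_vector) \<Rightarrow> 'a \<Rightarrow> 'a \<Rightarrow> 'b" where
  "fd f x \<equiv> frechet_derivative f (at x)"

lemma fd_eq: "(f has_derivative f') (at x) \<Longrightarrow> fd f x = f'"
  by (metis frechet_derivative_at)

section \<open>Calculus of \<open>C^k\<close> maps on open sets\<close>

text \<open>Openness of \<open>S\<close> matters: equality on an open set passes to the derivatives
  taken in the ambient space, so the induction can continue with the directional derivatives of
  \<open>f\<close> and \<open>g\<close>.\<close>

lemma Ck_on_cong:
  assumes "open S" "\<And>x. x \<in> S \<Longrightarrow> f x = g x"
  shows "Ck_on k S f \<longleftrightarrow> Ck_on k S g"
  using assms(2)
proof (induction k arbitrary: f g)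
  case 0
  then show ?case by (simp cong: continuous_on_cong)
next
  case (Suc k)
  have 1: "(f has_derivative f') (at x) \<longleftrightarrow> (g has_derivative f') (at x)" if "x \<in> S" for x f'
    using has_derivative_transform_within_open[OF _ assms(1) that, of f f' UNIV g]
      has_derivative_transform_within_open[OF _ assms(1) that, of g f' UNIV f] Suc.prems by auto
  then have 2: "f differentiable (at x) \<longleftrightarrow> g differentiable (at x)" if "x \<in> S" for x
    using that unfolding differentiable_def by blast
  have 3: "fd f x = fd g x" if "x \<in> S" for x
    unfolding frechet_derivative_def using 1[OF that] by simp
  have "Ck_on k S (\<lambda>x. fd f x v) \<longleftrightarrow> Ck_on k S (\<lambda>x. fd g x v)" for v
    by (rule Suc.IH) (simp add: 3)
  then show ?case
    using 2 by auto
qed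

lemma Ck_on_subset: "Ck_on k S f \<Longrightarrow> T \<subseteq> S \<Longrightarrow> Ck_on k T f"
  by (induction k arbitrary: f) (auto intro: continuous_on_subset)

lemma Ck_on_has_derivative: "Ck_on (Suc k) S f \<Longrightarrow> x \<in> S \<Longrightarrow> (f has_derivative fd f x) (at x)"
  by (simp add: frechet_derivative_works)

text \<open>Allows the derivative to be given by a formula instead of
  \<open>frechet_derivative\<close>; the two agree on \<open>S\<close> by uniqueness of
  derivatives.\<close>

lemma Ck_on_SucI:
  assumes "open S" and D: "\<And>x. x \<in> S \<Longrightarrow> (f has_derivative f' x) (at x)"
    and "\<And>v. Ck_on k S (\<lambda>x. f' x v)"
  shows "Ck_on (Suc k) S f"
proof -
  have "Ck_on k S (\<lambda>x. fd f x v) \<longleftrightarrow> Ck_on k S (\<lambda>x. f' x v)" for v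
    by (rule Ck_on_cong[OF assms(1)]) (simp add: fd_eq[OF D])
  moreover have "f differentiable at x" if "x \<in> S" for x
    using D[OF that] by (auto simp: differentiable_def)
  ultimately show ?thesis using assms(3) by simp
qed

lemma Ck_on_SucD: "Ck_on (Suc k) S f \<Longrightarrow> Ck_on k S f"
proof (induction k arbitrary: f)
  case 0
  then show ?case
    by (auto intro!: continuous_at_imp_continuous_on differentiable_imp_continuous_within)
qed auto

lemma Ck_on_bounded_linear:
  assumes "bounded_linear h" "Ck_on k S f" "open S"
  shows "Ck_on k S (\<lambda>x. h (f x))"
  using assms(2)
proof (induction k arbitrary: f)
  case 0
  then show ?case using assms(1) by (auto intro: bounded_linear.continuous_on)
next
  case (Suc k)
  show ?case
  proof (rule Ck_on_SucI[OF assms(3)])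
    show "((\<lambda>x. h (f x)) has_derivative (\<lambda>v. h (fd f x v))) (at x)" if "x \<in> S" for x
      using bounded_linear.has_derivative[OF assms(1) Ck_on_has_derivative[OF Suc.prems that]] .
    show "Ck_on k S (\<lambda>x. h (fd f x v))" for v
      using Suc by simp
  qed
qed

lemma Ck_on_const: "Ck_on k S (\<lambda>x. c)"
  by (induction k arbitrary: c) auto

lemma Ck_on_id: "Ck_on k S (\<lambda>x. x)"
proof (cases k)
  case (Suc l)
  have "fd (\<lambda>x. x) x = (\<lambda>v. v)" for x :: 'a
    by (rule fd_eq) simp
  then show ?thesis by (simp add: Suc Ck_on_const)
qed simp

lemma Ck_on_add:
  assumes "open S" "Ck_on k S f" "Ck_on k S g"
  shows "Ck_on k S (\<lambda>x. f x + g x)"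
  using assms(2,3)
proof (induction k arbitrary: f g)
  case 0
  then show ?case by (auto intro: continuous_intros)
next
  case (Suc k)
  show ?case
  proof (rule Ck_on_SucI[OF assms(1)])
    show "((\<lambda>x. f x + g x) has_derivative (\<lambda>v. fd f x v + fd g x v)) (at x)" if "x \<in> S" for x
      using Ck_on_has_derivative[OF Suc.prems(1) that] Ck_on_has_derivative[OF Suc.prems(2) that]
      by (rule has_derivative_add)
    show "Ck_on k S (\<lambda>x. fd f x v + fd g x v)" for v
      using Suc by simp
  qed
qed

lemma Ck_on_sum:
  assumes "open S" "\<And>i. i \<in> I \<Longrightarrow> Ck_on k S (f i)"
  shows "Ck_on k S (\<lambda>x. \<Sum>i\<in>I. f i x)"
  using assms(2)
  by (induction I rule: infinite_finite_induct) (auto intro: Ck_on_const Ck_on_add assms(1))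

lemma Ck_on_bounded_bilinear:
  assumes "bounded_bilinear pr" "open S" "Ck_on k S f" "Ck_on k S g"
  shows "Ck_on k S (\<lambda>x. pr (f x) (g x))"
  using assms(3,4)
proof (induction k arbitrary: f g)
  case 0
  then show ?case using assms(1) by (auto intro: bounded_bilinear.continuous_on)
next
  case (Suc k)
  show ?case
  proof (rule Ck_on_SucI[OF assms(2)])
    show "((\<lambda>x. pr (f x) (g x)) has_derivative (\<lambda>v. pr (f x) (fd g x v) + pr (fd f x v) (g x))) (at x)"
      if "x \<in> S" for x
      using Ck_on_has_derivative[OF Suc.prems(1) that] Ck_on_has_derivative[OF Suc.prems(2) that]
      by (rule bounded_bilinear.FDERIV[OF assms(1)])
    have "Ck_on k S f" "Ck_on k S g"
      using Suc.prems by (blast dest: Ck_on_SucD)+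
    moreover have "Ck_on k S (\<lambda>x. fd f x v)" "Ck_on k S (\<lambda>x. fd g x v)" for v
      using Suc.prems by auto
    ultimately show "Ck_on k S (\<lambda>x. pr (f x) (fd g x v) + pr (fd f x v) (g x))" for v
      using Suc.IH assms(2) by (intro Ck_on_add) auto
  qed
qed

lemmas Ck_on_scaleR = Ck_on_bounded_bilinear[OF bounded_bilinear_scaleR]
lemmas Ck_on_mult = Ck_on_bounded_bilinear[OF bounded_bilinear_mult]
lemmas Ck_on_inner = Ck_on_bounded_bilinear[OF bounded_bilinear_inner]

lemma Ck_on_Pair:
  assumes "open S" "Ck_on k S f" "Ck_on k S g"
  shows "Ck_on k S (\<lambda>x. (f x, g x))"
proof -
  have "Ck_on k S (\<lambda>x. (f x, 0) + (0, g x))"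
    using assms
    by (intro Ck_on_add Ck_on_bounded_linear[where h = "\<lambda>a. (a, 0)"]
        Ck_on_bounded_linear[where h = "\<lambda>a. (0, a)"])
      (auto intro: bounded_linear_Pair bounded_linear_zero bounded_linear_ident)
  then show ?thesis by simp
qed

lemma fd_basis_sum:
  fixes f :: "'a::euclidean_space \<Rightarrow> 'b::real_normed_vector"
  assumes "f differentiable (at x)"
  shows "fd f x v = (\<Sum>b\<in>Basis. (v \<bullet> b) *\<^sub>R fd f x b)"
proof -
  interpret linear "fd f x" by (rule linear_frechet_derivative[OF assms])
  have "fd f x v = fd f x (\<Sum>b\<in>Basis. (v \<bullet> b) *\<^sub>R b)"
    by (simp add: euclidean_representation)
  then show ?thesis by (simp add: sum scale)
qed

text \<open>The direction \<open>fd f x v\<close> in the chain rule moves with \<open>x\<close>,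
  whereas \<open>Ck_on\<close> speaks about fixed directions. Expansion of that direction in a basis
  leaves products of \<open>C^k\<close> functions, and the induction hypothesis applies to
  \<open>\<lambda>y. fd g y b\<close>.\<close>

lemma Ck_on_compose:
  fixes f :: "'a::real_normed_vector \<Rightarrow> 'b::euclidean_space" and g :: "'b \<Rightarrow> 'c::real_normed_vector"
  assumes "open S" "open T" "f ` S \<subseteq> T" "Ck_on k S f" "Ck_on k T g"
  shows "Ck_on k S (\<lambda>x. g (f x))"
  using assms(4,5)
proof (induction k arbitrary: g)
  case 0
  then show ?case using continuous_on_compose2[OF _ _ assms(3), of g] by simp
next
  case (Suc k)
  have f: "Ck_on k S f" "Ck_on k S (\<lambda>x. fd f x v)" for v
    using Ck_on_SucD[OF Suc.prems(1)] Suc.prems(1) by auto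
  have g: "Ck_on k S (\<lambda>x. fd g (f x) b)" for b
    using Suc.IH[of "\<lambda>y. fd g y b"] Suc.prems(2) f(1) by simp
  show ?case
  proof (rule Ck_on_SucI[OF assms(1)])
    show "((\<lambda>x. g (f x)) has_derivative (\<lambda>v. \<Sum>b\<in>Basis. (fd f x v \<bullet> b) *\<^sub>R fd g (f x) b)) (at x)"
      if "x \<in> S" for x
    proof -
      have fx: "f x \<in> T" using that assms(3) by auto
      have eq: "(\<lambda>v. \<Sum>b\<in>Basis. (fd f x v \<bullet> b) *\<^sub>R fd g (f x) b) = (\<lambda>v. fd g (f x) (fd f x v))"
        by (rule ext, rule fd_basis_sum[symmetric]) (use Suc.prems(2) fx in simp)
      show ?thesis
        unfolding eq by (rule has_derivative_compose[OF Ck_on_has_derivative[OF Suc.prems(1) that]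
          Ck_on_has_derivative[OF Suc.prems(2) fx]])
    qed
    show "Ck_on k S (\<lambda>x. \<Sum>b\<in>Basis. (fd f x v \<bullet> b) *\<^sub>R fd g (f x) b)" for v
      by (intro Ck_on_sum Ck_on_scaleR Ck_on_inner Ck_on_const assms(1) f g)
  qed
qed

lemma Ck_on_local:
  assumes "\<And>x. x \<in> S \<Longrightarrow> \<exists>T. open T \<and> x \<in> T \<and> Ck_on k (S \<inter> T) f"
  shows "Ck_on k S f"
  using assms
proof (induction k arbitrary: f)
  case 0
  show ?case unfolding Ck_on.simps
  proof (subst continuous_on_eq_continuous_within, safe)
    fix x assume "x \<in> S"
    then obtain T where "open T" "x \<in> T" "continuous_on (S \<inter> T) f" using 0 by auto
    then have "continuous (at x within S \<inter> T) f"
      using \<open>x \<in> S\<close> by (simp add: continuous_on_eq_continuous_within)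
    then show "continuous (at x within S) f"
      using at_within_nhd[of x T "S \<inter> T" S] \<open>open T\<close> \<open>x \<in> T\<close> by auto
  qed
next
  case (Suc k)
  have "f differentiable at x" if x: "x \<in> S" for x
    using Suc.prems[OF x] x by auto
  moreover have "Ck_on k S (\<lambda>x. fd f x v)" for v
    by (rule Suc.IH) (use Suc.prems in force)
  ultimately show ?case by simp
qed

section \<open>Smooth functions\<close>

lemma smooth_on_cong: "open S \<Longrightarrow> (\<And>x. x \<in> S \<Longrightarrow> f x = g x) \<Longrightarrow> smooth_on S f \<longleftrightarrow> smooth_on S g"
  unfolding smooth_on_def using Ck_on_cong[of S f g] by simp

lemma smooth_on_subset: "smooth_on S f \<Longrightarrow> T \<subseteq> S \<Longrightarrow> smooth_on T f"
  unfolding smooth_on_def by (auto intro: Ck_on_subset)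

lemma smooth_on_differentiable: "smooth_on S f \<Longrightarrow> x \<in> S \<Longrightarrow> f differentiable (at x)"
  unfolding smooth_on_def using Ck_on.simps(2) by blast

lemma smooth_on_has_derivative: "smooth_on S f \<Longrightarrow> x \<in> S \<Longrightarrow> (f has_derivative fd f x) (at x)"
  using smooth_on_differentiable frechet_derivative_works by blast

lemma smooth_on_continuous: "smooth_on S f \<Longrightarrow> continuous_on S f"
  unfolding smooth_on_def by (metis Ck_on.simps(1))

lemma smooth_on_fd: "smooth_on S f \<Longrightarrow> smooth_on S (\<lambda>x. fd f x v)"
  unfolding smooth_on_def using Ck_on.simps(2) by blast

text \<open>The bootstrap for solutions of differential equations: the derivative is an expression
  in the function itself, so each order of differentiability yields the next.\<close>

lemma smooth_onI:
  assumes "open S" "continuous_on S f" "\<And>x. x \<in> S \<Longrightarrow> (f has_derivative f' x) (at x)"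
    and "\<And>k v. Ck_on k S f \<Longrightarrow> Ck_on k S (\<lambda>x. f' x v)"
  shows "smooth_on S f"
  unfolding smooth_on_def
proof
  show "Ck_on k S f" for k
  proof (induction k)
    case 0
    then show ?case using assms(2) by simp
  next
    case (Suc k)
    show ?case by (rule Ck_on_SucI[OF assms(1,3) assms(4)[OF Suc]])
  qed
qed

lemma smooth_on_const: "smooth_on S (\<lambda>x. c)"
  by (simp add: smooth_on_def Ck_on_const)

lemma smooth_on_id: "smooth_on S (\<lambda>x. x)"
  by (simp add: smooth_on_def Ck_on_id)

lemma smooth_on_bounded_linear:
  "bounded_linear h \<Longrightarrow> open S \<Longrightarrow> smooth_on S f \<Longrightarrow> smooth_on S (\<lambda>x. h (f x))"
  by (simp add: smooth_on_def Ck_on_bounded_linear)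

lemma smooth_on_add:
  "open S \<Longrightarrow> smooth_on S f \<Longrightarrow> smooth_on S g \<Longrightarrow> smooth_on S (\<lambda>x. f x + g x)"
  by (simp add: smooth_on_def Ck_on_add)

lemma smooth_on_minus:
  "open S \<Longrightarrow> smooth_on S f \<Longrightarrow> smooth_on S (\<lambda>x. - f x)"
  by (intro smooth_on_bounded_linear[where h = uminus]) (auto intro: bounded_linear_minus bounded_linear_ident)

lemma smooth_on_diff:
  "open S \<Longrightarrow> smooth_on S f \<Longrightarrow> smooth_on S g \<Longrightarrow> smooth_on S (\<lambda>x. f x - g x)"
  using smooth_on_add[of S f "\<lambda>x. - g x"] smooth_on_minus by auto

lemma smooth_on_sum:
  "open S \<Longrightarrow> (\<And>i. i \<in> I \<Longrightarrow> smooth_on S (f i)) \<Longrightarrow> smooth_on S (\<lambda>x. \<Sum>i\<in>I. f i x)"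
  by (simp add: smooth_on_def Ck_on_sum)

lemma smooth_on_scaleR:
  "open S \<Longrightarrow> smooth_on S f \<Longrightarrow> smooth_on S g \<Longrightarrow> smooth_on S (\<lambda>x. f x *\<^sub>R g x)"
  by (simp add: smooth_on_def Ck_on_scaleR)

lemma smooth_on_mult:
  fixes f g :: "'a::real_normed_vector \<Rightarrow> real"
  shows "open S \<Longrightarrow> smooth_on S f \<Longrightarrow> smooth_on S g \<Longrightarrow> smooth_on S (\<lambda>x. f x * g x)"
  by (simp add: smooth_on_def Ck_on_mult)

lemma smooth_on_inner:
  fixes f g :: "'a::real_normed_vector \<Rightarrow> 'b::real_inner"
  shows "open S \<Longrightarrow> smooth_on S f \<Longrightarrow> smooth_on S g \<Longrightarrow> smooth_on S (\<lambda>x. f x \<bullet> g x)"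
  by (simp add: smooth_on_def Ck_on_inner)

lemma smooth_on_Pair:
  "open S \<Longrightarrow> smooth_on S f \<Longrightarrow> smooth_on S g \<Longrightarrow> smooth_on S (\<lambda>x. (f x, g x))"
  by (simp add: smooth_on_def Ck_on_Pair)

lemma smooth_on_compose:
  fixes f :: "'a::real_normed_vector \<Rightarrow> 'b::euclidean_space"
  shows "open S \<Longrightarrow> open T \<Longrightarrow> f ` S \<subseteq> T \<Longrightarrow> smooth_on S f \<Longrightarrow> smooth_on T g
    \<Longrightarrow> smooth_on S (\<lambda>x. g (f x))"
  unfolding smooth_on_def using Ck_on_compose[of S T f _ g] by simp

lemma smooth_on_local:
  assumes "\<And>x. x \<in> S \<Longrightarrow> \<exists>T. open T \<and> x \<in> T \<and> smooth_on (S \<inter> T) f"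
  shows "smooth_on S f"
  unfolding smooth_on_def
proof
  fix k
  have "\<exists>T. open T \<and> x \<in> T \<and> Ck_on k (S \<inter> T) f" if "x \<in> S" for x
    using assms[OF that] by (auto simp: smooth_on_def)
  then show "Ck_on k S f" by (rule Ck_on_local)
qed

section \<open>Symmetry of second derivatives\<close>

text \<open>Mean value theorem twice: in \<open>s\<close> for the increment of \<open>f\<close> in
  direction \<open>h v\<close>, and then in \<open>t\<close> for the derivative so obtained. The
  second difference is symmetric in \<open>u\<close> and \<open>v\<close>, which makes it
  useful.\<close>

lemma second_difference:
  fixes f :: "'a::euclidean_space \<Rightarrow> real"
  assumes "open S" "smooth_on S f" "h > 0"
    and in_S: "\<And>s t. s \<in> {0..h} \<Longrightarrow> t \<in> {0..h} \<Longrightarrow> x + s *\<^sub>R u + t *\<^sub>R v \<in> S"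
  shows "\<exists>s t. 0 < s \<and> s < h \<and> 0 < t \<and> t < h \<and>
    f (x + h *\<^sub>R u + h *\<^sub>R v) - f (x + h *\<^sub>R u) - f (x + h *\<^sub>R v) + f x =
    h\<^sup>2 * fd (\<lambda>y. fd f y u) (x + s *\<^sub>R u + t *\<^sub>R v) v"
proof -
  let ?P = "\<lambda>s t. x + s *\<^sub>R u + t *\<^sub>R v"
  have dl: "((\<lambda>s. g (?P s t)) has_real_derivative fd g (?P s t) u) (at s)"
    and dr: "((\<lambda>t. g (?P s t)) has_real_derivative fd g (?P s t) v) (at t)"
    if st: "s \<in> {0..h}" "t \<in> {0..h}" and g: "smooth_on S g" for g :: "'a \<Rightarrow> real" and s t
  proof -
    have D: "(g has_derivative fd g (?P s t)) (at (?P s t))"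
      using smooth_on_has_derivative[OF g in_S[OF st]] .
    then interpret linear "fd g (?P s t)" by (rule has_derivative_linear)
    have "((\<lambda>s. g (?P s t)) has_derivative (\<lambda>r. fd g (?P s t) (r *\<^sub>R u))) (at s)"
      by (rule has_derivative_compose[of "\<lambda>s. ?P s t" _ s UNIV g, OF _ D])
        (auto intro!: derivative_eq_intros)
    then show "((\<lambda>s. g (?P s t)) has_real_derivative fd g (?P s t) u) (at s)"
      by (simp add: has_field_derivative_def scale mult.commute[of _ "fd g (?P s t) u"])
    have "((\<lambda>t. g (?P s t)) has_derivative (\<lambda>r. fd g (?P s t) (r *\<^sub>R v))) (at t)"
      by (rule has_derivative_compose[of "\<lambda>t. ?P s t" _ t UNIV g, OF _ D])
        (auto intro!: derivative_eq_intros)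
    then show "((\<lambda>t. g (?P s t)) has_real_derivative fd g (?P s t) v) (at t)"
      by (simp add: has_field_derivative_def scale mult.commute[of _ "fd g (?P s t) v"])
  qed
  let ?g = "\<lambda>s. f (?P s h) - f (?P s 0)"
  have "\<exists>s>0. s < h \<and> ?g h - ?g 0 = (h - 0) * (fd f (?P s h) u - fd f (?P s 0) u)"
    by (rule MVT2[OF \<open>h > 0\<close>], rule DERIV_diff[OF dl[of _ h f] dl[of _ 0 f]])
      (use \<open>h > 0\<close> assms(2) in auto)
  then obtain s where s: "0 < s" "s < h"
    "?g h - ?g 0 = (h - 0) * (fd f (?P s h) u - fd f (?P s 0) u)" by auto
  have "\<exists>t>0. t < h \<and> fd f (?P s h) u - fd f (?P s 0) u
      = (h - 0) * fd (\<lambda>y. fd f y u) (?P s t) v"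
    by (rule MVT2[OF \<open>h > 0\<close>], rule dr[of s _ "\<lambda>y. fd f y u"])
      (use s smooth_on_fd[OF assms(2), of u] in auto)
  then obtain t where t: "0 < t" "t < h" "fd f (?P s h) u - fd f (?P s 0) u
      = (h - 0) * fd (\<lambda>y. fd f y u) (?P s t) v" by auto
  have "?g h - ?g 0 = h\<^sup>2 * fd (\<lambda>y. fd f y u) (?P s t) v"
    using s(3) t(3) by (simp add: power2_eq_square)
  then show ?thesis using s t by (intro exI[of _ s] exI[of _ t]) (simp add: algebra_simps)
qed

text \<open>Both mixed derivatives, at points close to \<open>x\<close>, equal the same second
  difference divided by \<open>h\<^sup>2\<close>; continuity carries the equality to
  \<open>x\<close>.\<close>

lemma fd_fd_commute:
  fixes f :: "'a::euclidean_space \<Rightarrow> real"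
  assumes "open S" "smooth_on S f" "x \<in> S"
  shows "fd (\<lambda>y. fd f y u) x v = fd (\<lambda>y. fd f y v) x u"
proof (rule ccontr)
  let ?A = "\<lambda>y. fd (\<lambda>y. fd f y u) y v" and ?B = "\<lambda>y. fd (\<lambda>y. fd f y v) y u"
  assume ne: "?A x \<noteq> ?B x"
  define e where "e = \<bar>?A x - ?B x\<bar> / 2"
  have "e > 0" using ne by (simp add: e_def)
  have "continuous_on S ?A" "continuous_on S ?B"
    using smooth_on_fd[OF smooth_on_fd[OF assms(2)]] smooth_on_continuous by blast+
  then have "continuous (at x) ?A" "continuous (at x) ?B"
    using assms by (simp_all add: continuous_on_eq_continuous_at)
  then obtain d1 d2 where d12: "d1 > 0" "d2 > 0"
    "\<And>y. dist y x < d1 \<Longrightarrow> dist (?A y) (?A x) < e" "\<And>y. dist y x < d2 \<Longrightarrow> dist (?B y) (?B x) < e"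
    using \<open>e > 0\<close> unfolding continuous_at_eps_delta by metis
  obtain d3 where d3: "d3 > 0" "ball x d3 \<subseteq> S" using assms openE by blast
  define d where "d = min d1 (min d2 d3)"
  \<comment> \<open>The whole parallelogram spanned by \<open>h u\<close> and \<open>h v\<close>
    then lies within distance \<open>d / 2\<close> of \<open>x\<close>; the summand 1 covers
    \<open>u = v = 0\<close>.\<close>
  define h where "h = d / (2 * (norm u + norm v + 1))"
  have pos: "norm u + norm v + 1 > 0" by (smt (verit) norm_ge_zero)
  have "d > 0" using d12 d3 by (simp add: d_def)
  then have "h > 0" using pos by (simp add: h_def)
  have near: "dist (x + s *\<^sub>R u + t *\<^sub>R v) x < d" if "s \<in> {0..h}" "t \<in> {0..h}" for s t
  proof -
    have "dist (x + s *\<^sub>R u + t *\<^sub>R v) x = norm (s *\<^sub>R u + t *\<^sub>R v)" by (simp add: dist_norm)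
    also have "\<dots> \<le> s * norm u + t * norm v"
      using that norm_triangle_ineq[of "s *\<^sub>R u" "t *\<^sub>R v"] by simp
    also have "\<dots> \<le> h * norm u + h * norm v"
      using that by (intro add_mono mult_right_mono) auto
    also have "\<dots> \<le> h * (norm u + norm v + 1)" using \<open>h > 0\<close> by (simp add: algebra_simps)
    also have "\<dots> = d / 2"
      unfolding h_def using pos by (simp add: field_simps del: distrib_left_numeral)
    also have "\<dots> < d" using \<open>d > 0\<close> by simp
    finally show ?thesis .
  qed
  have inS: "x + s *\<^sub>R u + t *\<^sub>R v \<in> S" if "s \<in> {0..h}" "t \<in> {0..h}" for s t
    using near[OF that] d3 by (auto simp: d_def dist_commute)
  have inS': "x + s *\<^sub>R v + t *\<^sub>R u \<in> S" if "s \<in> {0..h}" "t \<in> {0..h}" for s t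
    using inS[OF that(2,1)] by (simp add: algebra_simps)
  obtain s t where st: "0 < s" "s < h" "0 < t" "t < h"
    "f (x + h *\<^sub>R u + h *\<^sub>R v) - f (x + h *\<^sub>R u) - f (x + h *\<^sub>R v) + f x = h\<^sup>2 * ?A (x + s *\<^sub>R u + t *\<^sub>R v)"
    using second_difference[OF assms(1,2) \<open>h > 0\<close>, of x u v, OF inS] by blast
  obtain s' t' where st': "0 < s'" "s' < h" "0 < t'" "t' < h"
    "f (x + h *\<^sub>R v + h *\<^sub>R u) - f (x + h *\<^sub>R v) - f (x + h *\<^sub>R u) + f x = h\<^sup>2 * ?B (x + s' *\<^sub>R v + t' *\<^sub>R u)"
    using second_difference[OF assms(1,2) \<open>h > 0\<close>, of x v u, OF inS'] by blast
  have "h\<^sup>2 * ?A (x + s *\<^sub>R u + t *\<^sub>R v) = h\<^sup>2 * ?B (x + s' *\<^sub>R v + t' *\<^sub>R u)"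
    unfolding st(5)[symmetric] st'(5)[symmetric] by (simp add: add.commute add.left_commute)
  then have AB: "?A (x + s *\<^sub>R u + t *\<^sub>R v) = ?B (x + t' *\<^sub>R u + s' *\<^sub>R v)"
    using \<open>h > 0\<close> by (simp add: add.commute add.left_commute)
  have "dist (?A (x + s *\<^sub>R u + t *\<^sub>R v)) (?A x) < e"
    by (rule d12(3)) (use near[of s t] st in \<open>auto simp: d_def\<close>)
  moreover have "dist (?B (x + t' *\<^sub>R u + s' *\<^sub>R v)) (?B x) < e"
    by (rule d12(4)) (use near[of t' s'] st' in \<open>auto simp: d_def\<close>)
  ultimately have "\<bar>?A x - ?B x\<bar> < 2 * e" unfolding AB dist_real_def by linarith
  then show False by (simp add: e_def)
qed

section \<open>Smooth families of bilinear maps\<close>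

text \<open>In finite dimension smoothness for fixed arguments is joint smoothness, since a bilinear
  map is a finite combination of its values on basis vectors. Christoffel symbols, metric
  coefficients and, after a small trick, derivatives of functions have this form.\<close>

definition smooth_bilinear ::
  "'a::euclidean_space set \<Rightarrow> ('a \<Rightarrow> 'b::euclidean_space \<Rightarrow> 'c::euclidean_space \<Rightarrow> 'd::real_normed_vector) \<Rightarrow> bool" where
  "smooth_bilinear U w \<longleftrightarrow> open U \<and> (\<forall>y\<in>U. bilinear (w y)) \<and> (\<forall>h s. smooth_on U (\<lambda>y. w y h s))"

lemma smooth_bilinearD:
  assumes "smooth_bilinear U w"
  shows "open U" "y \<in> U \<Longrightarrow> bilinear (w y)" "smooth_on U (\<lambda>y. w y h s)"
  using assms by (auto simp: smooth_bilinear_def)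

lemma bilinear_basis_sum:
  fixes w :: "'b::euclidean_space \<Rightarrow> 'c::euclidean_space \<Rightarrow> 'd::real_vector"
  assumes "bilinear w"
  shows "w h s = (\<Sum>(b, b')\<in>Basis \<times> Basis. ((h \<bullet> b) * (s \<bullet> b')) *\<^sub>R w b b')"
proof -
  have "w h s = w (\<Sum>b\<in>Basis. (h \<bullet> b) *\<^sub>R b) (\<Sum>b\<in>Basis. (s \<bullet> b) *\<^sub>R b)"
    by (simp add: euclidean_representation)
  also have "\<dots> = (\<Sum>(b, b')\<in>Basis \<times> Basis. w ((h \<bullet> b) *\<^sub>R b) ((s \<bullet> b') *\<^sub>R b'))"
    by (rule bilinear_sum[OF assms])
  finally show ?thesis
    by (simp add: bilinear_lmul[OF assms] bilinear_rmul[OF assms] mult.commute case_prod_unfold)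
qed

lemma bilinear_norm_le_basis:
  fixes w :: "'b::euclidean_space \<Rightarrow> 'c::euclidean_space \<Rightarrow> 'd::real_normed_vector"
  assumes "bilinear w" "\<And>b b'. b \<in> Basis \<Longrightarrow> b' \<in> Basis \<Longrightarrow> norm (w b b') \<le> B b b'"
  shows "norm (w h s) \<le> (\<Sum>(b, b')\<in>Basis \<times> Basis. B b b') * (norm h * norm s)"
proof -
  have "norm (w h s) \<le> (\<Sum>(b, b')\<in>Basis \<times> Basis. norm (((h \<bullet> b) * (s \<bullet> b')) *\<^sub>R w b b'))"
    by (subst bilinear_basis_sum[OF assms(1), of h s]) (simp only: case_prod_unfold norm_sum)
  also have "\<dots> \<le> (\<Sum>(b, b')\<in>Basis \<times> Basis. (norm h * norm s) * B b b')"
  proof (rule sum_mono, safe)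
    fix b :: 'b and b' :: 'c assume b: "b \<in> Basis" "b' \<in> Basis"
    have "\<bar>h \<bullet> b\<bar> * \<bar>s \<bullet> b'\<bar> \<le> norm h * norm s"
      using b by (intro mult_mono Basis_le_norm) auto
    then have "(\<bar>h \<bullet> b\<bar> * \<bar>s \<bullet> b'\<bar>) * norm (w b b') \<le> (norm h * norm s) * B b b'"
      using assms(2)[OF b] by (rule mult_mono) auto
    then show "norm (((h \<bullet> b) * (s \<bullet> b')) *\<^sub>R w b b') \<le> (norm h * norm s) * B b b'"
      by (simp add: abs_mult)
  qed
  finally show ?thesis by (simp add: sum_distrib_left sum_distrib_right case_prod_unfold mult_ac)
qed

lemma Ck_on_bilinear_family:
  fixes w :: "'a::euclidean_space \<Rightarrow> 'b::euclidean_space \<Rightarrow> 'c::euclidean_space \<Rightarrow> 'd::real_normed_vector"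
  assumes w: "smooth_bilinear U w" and S: "open S" "p ` S \<subseteq> U"
    and "Ck_on k S p" "Ck_on k S h" "Ck_on k S s"
  shows "Ck_on k S (\<lambda>x. w (p x) (h x) (s x))"
proof -
  have "Ck_on k S (\<lambda>x. w (p x) b b')" for b b'
    using Ck_on_compose[OF S(1) smooth_bilinearD(1)[OF w] S(2) assms(4), of "\<lambda>y. w y b b'"]
      smooth_bilinearD(3)[OF w] by (simp add: smooth_on_def)
  then have "Ck_on k S (\<lambda>x. \<Sum>a\<in>Basis \<times> Basis. ((h x \<bullet> fst a) * (s x \<bullet> snd a)) *\<^sub>R w (p x) (fst a) (snd a))"
    by (intro Ck_on_sum Ck_on_scaleR Ck_on_mult Ck_on_inner Ck_on_const S assms)
  moreover have "(\<Sum>a\<in>Basis \<times> Basis. ((h x \<bullet> fst a) * (s x \<bullet> snd a)) *\<^sub>R w (p x) (fst a) (snd a))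
      = w (p x) (h x) (s x)" if "x \<in> S" for x
    using bilinear_basis_sum[OF smooth_bilinearD(2)[OF w], of "p x" "h x" "s x"] S(2) that
    by (auto simp: case_prod_unfold)
  ultimately show ?thesis
    using Ck_on_cong[OF S(1), of "\<lambda>x. \<Sum>a\<in>Basis \<times> Basis. ((h x \<bullet> fst a) * (s x \<bullet> snd a)) *\<^sub>R w (p x) (fst a) (snd a)"
      "\<lambda>x. w (p x) (h x) (s x)"] by simp
qed

lemma fd_bilinear_family:
  fixes w :: "'a::euclidean_space \<Rightarrow> 'b::euclidean_space \<Rightarrow> 'c::euclidean_space \<Rightarrow> 'd::real_normed_vector"
  assumes w: "smooth_bilinear U w" and "y \<in> U"
  shows "fd (\<lambda>z. w z h s) y v
    = (\<Sum>a\<in>Basis \<times> Basis. ((h \<bullet> fst a) * (s \<bullet> snd a)) *\<^sub>R fd (\<lambda>z. w z (fst a) (snd a)) y v)"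
proof -
  have "((\<lambda>z. \<Sum>a\<in>Basis \<times> Basis. ((h \<bullet> fst a) * (s \<bullet> snd a)) *\<^sub>R w z (fst a) (snd a)) has_derivative
    (\<lambda>v. \<Sum>a\<in>Basis \<times> Basis. ((h \<bullet> fst a) * (s \<bullet> snd a)) *\<^sub>R fd (\<lambda>z. w z (fst a) (snd a)) y v)) (at y)"
    by (intro has_derivative_sum has_derivative_scaleR_right smooth_on_has_derivative[OF smooth_bilinearD(3)[OF w] assms(2)])
  then have "((\<lambda>z. w z h s) has_derivative
    (\<lambda>v. \<Sum>a\<in>Basis \<times> Basis. ((h \<bullet> fst a) * (s \<bullet> snd a)) *\<^sub>R fd (\<lambda>z. w z (fst a) (snd a)) y v)) (at y)"
    by (rule has_derivative_transform_within_open[OF _ smooth_bilinearD(1)[OF w] assms(2)])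
      (simp add: bilinear_basis_sum[OF smooth_bilinearD(2)[OF w], of _ h s] case_prod_unfold)
  from fd_eq[OF this] show ?thesis by simp
qed

text \<open>Product rule in three slots; the base point contributes the derivative of the
  coefficients with both arguments frozen. The expansion over the bases reduces it to products of
  scalar functions with the coefficients \<open>w (p x) b b'\<close>.\<close>

lemma has_derivative_bilinear_family:
  fixes w :: "'a::euclidean_space \<Rightarrow> 'b::euclidean_space \<Rightarrow> 'c::euclidean_space \<Rightarrow> 'd::real_normed_vector"
    and p :: "'e::real_normed_vector \<Rightarrow> 'a"
  assumes w: "smooth_bilinear U w" and pU: "p x \<in> U" and xT: "x \<in> T"
    and p: "(p has_derivative p') (at x within T)" and h: "(h has_derivative h') (at x within T)"
    and s: "(s has_derivative s') (at x within T)"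
  shows "((\<lambda>x. w (p x) (h x) (s x)) has_derivative
    (\<lambda>v. fd (\<lambda>z. w z (h x) (s x)) (p x) (p' v) + w (p x) (h' v) (s x) + w (p x) (h x) (s' v)))
    (at x within T)"
proof -
  let ?B = "Basis \<times> Basis :: ('b \<times> 'c) set"
  have wd: "((\<lambda>x. w (p x) b b') has_derivative (\<lambda>v. fd (\<lambda>z. w z b b') (p x) (p' v))) (at x within T)" for b b'
    by (rule has_derivative_compose[OF p smooth_on_has_derivative[OF smooth_bilinearD(3)[OF w] pU]])
  have "((\<lambda>x. \<Sum>a\<in>?B. ((h x \<bullet> fst a) * (s x \<bullet> snd a)) *\<^sub>R w (p x) (fst a) (snd a)) has_derivative
     (\<lambda>v. \<Sum>a\<in>?B. ((h x \<bullet> fst a) * (s x \<bullet> snd a)) *\<^sub>R fd (\<lambda>z. w z (fst a) (snd a)) (p x) (p' v) +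
        ((h x \<bullet> fst a) * (s' v \<bullet> snd a) + (h' v \<bullet> fst a) * (s x \<bullet> snd a)) *\<^sub>R w (p x) (fst a) (snd a)))
     (at x within T)"
    by (intro has_derivative_sum has_derivative_scaleR has_derivative_mult wd
        has_derivative_inner_left h s)
  moreover have "(\<lambda>v. \<Sum>a\<in>?B. ((h x \<bullet> fst a) * (s x \<bullet> snd a)) *\<^sub>R fd (\<lambda>z. w z (fst a) (snd a)) (p x) (p' v) +
        ((h x \<bullet> fst a) * (s' v \<bullet> snd a) + (h' v \<bullet> fst a) * (s x \<bullet> snd a)) *\<^sub>R w (p x) (fst a) (snd a))
     = (\<lambda>v. fd (\<lambda>z. w z (h x) (s x)) (p x) (p' v) + w (p x) (h' v) (s x) + w (p x) (h x) (s' v))"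
    by (rule ext)
      (simp add: fd_bilinear_family[OF w pU, of "h x"] bilinear_basis_sum[OF smooth_bilinearD(2)[OF w pU], of "h' _"]
        bilinear_basis_sum[OF smooth_bilinearD(2)[OF w pU], of "h x"] case_prod_unfold
        sum.distrib scaleR_add_left)
  ultimately have D: "((\<lambda>x. \<Sum>a\<in>?B. ((h x \<bullet> fst a) * (s x \<bullet> snd a)) *\<^sub>R w (p x) (fst a) (snd a)) has_derivative
     (\<lambda>v. fd (\<lambda>z. w z (h x) (s x)) (p x) (p' v) + w (p x) (h' v) (s x) + w (p x) (h x) (s' v))) (at x within T)"
    by simp
  have eq: "(\<Sum>a\<in>?B. ((h x \<bullet> fst a) * (s x \<bullet> snd a)) *\<^sub>R w (p x) (fst a) (snd a)) = w (p x) (h x) (s x)"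
    if "p x \<in> U" for x
    using bilinear_basis_sum[OF smooth_bilinearD(2)[OF w that], of "h x" "s x"] by (simp add: case_prod_unfold)
  \<comment> \<open>The basis expansion represents \<open>w\<close> only at points of
    \<open>U\<close>, so the two functions agree merely near \<open>x\<close>.\<close>
  have "eventually (\<lambda>x. p x \<in> U) (at x within T)"
    using has_derivative_continuous[OF p] pU smooth_bilinearD(1)[OF w]
    by (simp add: continuous_within topological_tendstoD)
  then have "eventually (\<lambda>x. (\<Sum>a\<in>?B. ((h x \<bullet> fst a) * (s x \<bullet> snd a)) *\<^sub>R w (p x) (fst a) (snd a))
      = w (p x) (h x) (s x)) (at x within T)"
    by (rule eventually_mono) (rule eq)
  from D this eq[OF pU] xT show ?thesis
    by (rule has_derivative_transform_eventually)
qed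

section \<open>Uniform Lipschitz and Taylor bounds on compact convex sets\<close>

lemma norm_fd_diff_le:
  fixes f :: "'a::euclidean_space \<Rightarrow> 'b::real_normed_vector"
  assumes "\<And>b. b \<in> Basis \<Longrightarrow> norm (fd f z b - g b) \<le> B b" "f differentiable (at z)" "linear g"
  shows "norm (fd f z v - g v) \<le> (\<Sum>b\<in>Basis. B b) * norm v"
proof -
  have gs: "g v = (\<Sum>b\<in>Basis. (v \<bullet> b) *\<^sub>R g b)"
  proof -
    interpret linear g by fact
    have "g v = g (\<Sum>b\<in>Basis. (v \<bullet> b) *\<^sub>R b)" by (simp add: euclidean_representation)
    then show ?thesis by (simp add: sum scale)
  qed
  have "norm (fd f z v - g v) = norm (\<Sum>b\<in>Basis. (v \<bullet> b) *\<^sub>R (fd f z b - g b))"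
    by (subst fd_basis_sum[OF assms(2)], subst gs) (simp add: scaleR_diff_right sum_subtractf)
  also have "\<dots> \<le> (\<Sum>b\<in>Basis. norm ((v \<bullet> b) *\<^sub>R (fd f z b - g b)))" by (rule norm_sum)
  also have "\<dots> \<le> (\<Sum>b\<in>Basis. norm v * B b)"
    by (rule sum_mono) (auto intro!: mult_mono Basis_le_norm assms(1))
  finally show ?thesis by (simp add: sum_distrib_left sum_distrib_right mult.commute)
qed

lemma smooth_on_compact_Lipschitz:
  fixes f :: "'a::euclidean_space \<Rightarrow> 'b::real_normed_vector"
  assumes "smooth_on U f" "compact C" "convex C" "C \<subseteq> U"
  shows "\<exists>B\<ge>0. \<forall>z\<in>C. \<forall>z'\<in>C. norm (f z) \<le> B \<and> norm (f z' - f z) \<le> B * norm (z' - z)"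
proof -
  have bdd: "\<exists>B\<ge>0. \<forall>z\<in>C. norm (g z) \<le> B" if "smooth_on U g" for g :: "'a \<Rightarrow> 'b"
  proof -
    have "bounded (g ` C)"
      using smooth_on_continuous[OF that] assms by (meson compact_continuous_image compact_imp_bounded continuous_on_subset)
    then obtain B where "B > 0" "\<forall>x\<in>g ` C. norm x \<le> B" unfolding bounded_pos by blast
    then show ?thesis by (intro exI[of _ B]) auto
  qed
  obtain B0 where B0: "B0 \<ge> 0" "\<forall>z\<in>C. norm (f z) \<le> B0" using bdd[OF assms(1)] by auto
  have "\<exists>B\<ge>0. \<forall>z\<in>C. norm (fd f z b) \<le> B" for b
    by (rule bdd[OF smooth_on_fd[OF assms(1)]])
  then obtain B1 where B1: "\<And>b. B1 b \<ge> 0" "\<And>b z. z \<in> C \<Longrightarrow> norm (fd f z b) \<le> B1 b" by metis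
  define K where "K = sum B1 Basis"
  have D: "f differentiable (at z)" if "z \<in> C" for z
    using that assms smooth_on_differentiable by blast
  have K: "norm (fd f z v) \<le> K * norm v" if "z \<in> C" for z v
    using norm_fd_diff_le[of f z "\<lambda>_. 0" B1 v] B1(2)[OF that] D[OF that] by (auto simp: K_def module_hom_zero)
  have "norm (f z' - f z) \<le> K * norm (z' - z)" if "z \<in> C" "z' \<in> C" for z z'
  proof (rule differentiable_bound[OF assms(3)])
    show "(f has_derivative fd f z) (at z within C)" if "z \<in> C" for z
      using D[OF that] by (simp add: frechet_derivative_works has_derivative_at_withinI)
    show "onorm (fd f z) \<le> K" if "z \<in> C" for z
      by (rule onorm_le) (rule K[OF that])
  qed (use that in auto)
  moreover have "K \<ge> 0" using B1 by (simp add: K_def sum_nonneg)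
  ultimately have "norm (f z) \<le> max B0 K \<and> norm (f z' - f z) \<le> max B0 K * norm (z' - z)"
    if "z \<in> C" "z' \<in> C" for z z'
    using that B0 by (meson max.cobounded1 max.cobounded2 mult_right_mono norm_ge_zero order_trans)
  then show ?thesis using B0 by (intro exI[of _ "max B0 K"]) auto
qed

text \<open>The derivative is Lipschitz on \<open>C\<close> by the previous bound applied to the
  partial derivatives; the mean value inequality for \<open>f\<close> minus its linearization on the
  segment from \<open>z\<close> to \<open>z'\<close> then gives a quadratic remainder.\<close>

lemma smooth_on_compact_Taylor:
  fixes f :: "'a::euclidean_space \<Rightarrow> 'b::real_normed_vector"
  assumes "smooth_on U f" "compact C" "convex C" "C \<subseteq> U"
  shows "\<exists>B\<ge>0. \<forall>z\<in>C. \<forall>z'\<in>C. norm (f z' - f z - fd f z (z' - z)) \<le> B * (norm (z' - z))\<^sup>2"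
proof -
  have "\<exists>B\<ge>0. \<forall>z\<in>C. \<forall>z'\<in>C. norm (fd f z' b - fd f z b) \<le> B * norm (z' - z)" for b
    using smooth_on_compact_Lipschitz[OF smooth_on_fd[OF assms(1), of b] assms(2-4)] by blast
  then obtain B where B: "\<And>b. B b \<ge> 0"
    "\<And>b z z'. z \<in> C \<Longrightarrow> z' \<in> C \<Longrightarrow> norm (fd f z' b - fd f z b) \<le> B b * norm (z' - z)" by metis
  define K where "K = sum B Basis"
  have D: "f differentiable (at z)" if "z \<in> C" for z
    using that assms smooth_on_differentiable by blast
  have "norm (f z' - f z - fd f z (z' - z)) \<le> K * (norm (z' - z))\<^sup>2" if z: "z \<in> C" "z' \<in> C" for z z'
  proof -
    have seg: "closed_segment z z' \<subseteq> C" using z assms(3) by (simp add: closed_segment_subset)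
    have "norm (f z' - f z - fd f z (z' - z)) \<le> norm (z' - z) * (K * norm (z' - z))"
    proof (rule differentiable_bound_linearization[where S = "closed_segment z z'"])
      show "z + t *\<^sub>R (z' - z) \<in> closed_segment z z'" if "t \<in> {0..1}" for t
        using that by (auto simp: in_segment algebra_simps)
      show "(f has_derivative fd f y) (at y within closed_segment z z')" if "y \<in> closed_segment z z'" for y
        using D seg that by (auto simp: frechet_derivative_works intro: has_derivative_at_withinI)
      show "onorm (fd f y - fd f z) \<le> K * norm (z' - z)" if y: "y \<in> closed_segment z z'" for y
      proof (rule onorm_le)
        fix v
        have le: "norm (fd f y b - fd f z b) \<le> B b * norm (z' - z)" for b
        proof -
          have "norm (fd f y b - fd f z b) \<le> B b * norm (y - z)" using B(2)[of z y b] z y seg by auto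
          also have "\<dots> \<le> B b * norm (z' - z)"
            using segment_bound1[OF y] B(1) by (intro mult_left_mono) (auto simp: norm_minus_commute)
          finally show ?thesis .
        qed
        have "norm (fd f y v - fd f z v) \<le> (\<Sum>b\<in>Basis. B b * norm (z' - z)) * norm v"
          by (rule norm_fd_diff_le[OF le])
            (use D y z seg in \<open>auto intro!: linear_frechet_derivative\<close>)
        then show "norm ((fd f y - fd f z) v) \<le> K * norm (z' - z) * norm v"
          by (simp add: K_def sum_distrib_right)
      qed
    qed auto
    then show ?thesis by (simp add: power2_eq_square mult_ac)
  qed
  moreover have "K \<ge> 0" using B by (simp add: K_def sum_nonneg)
  ultimately show ?thesis by auto
qed

lemma bilinear_diff_family:
  assumes "bilinear f" "bilinear g" shows "bilinear (\<lambda>h s. f h s - g h s)"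
  using assms by (auto simp: bilinear_def intro: linear_compose_sub)

lemma bilinear_fd_family:
  fixes w :: "'a::euclidean_space \<Rightarrow> 'b::euclidean_space \<Rightarrow> 'c::euclidean_space \<Rightarrow> 'd::real_normed_vector"
  assumes w: "smooth_bilinear U w" and "y \<in> U"
  shows "bilinear (\<lambda>h s. fd (\<lambda>z. w z h s) y v)"
proof -
  have "bilinear (\<lambda>h s. \<Sum>a\<in>Basis \<times> Basis. ((h \<bullet> fst a) * (s \<bullet> snd a)) *\<^sub>R fd (\<lambda>z. w z (fst a) (snd a)) y v)"
    unfolding bilinear_def
    by (auto intro!: linearI simp: inner_add_left algebra_simps sum.distrib scaleR_sum_right)
  then show ?thesis by (subst fd_bilinear_family[OF assms])
qed

text \<open>A single constant controls size, Lipschitz behaviour and Taylor remainder, uniformly in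
  the two linear arguments. These are the three kinds of error that occur when solutions on
  neighbouring rays are compared.\<close>

lemma smooth_bilinear_bounds:
  fixes w :: "'a::euclidean_space \<Rightarrow> 'b::euclidean_space \<Rightarrow> 'c::euclidean_space \<Rightarrow> 'd::real_normed_vector"
  assumes w: "smooth_bilinear U w" and C: "compact C" "convex C" "C \<subseteq> U"
  obtains B where "B \<ge> 0"
    "\<And>z h s. z \<in> C \<Longrightarrow> norm (w z h s) \<le> B * (norm h * norm s)"
    "\<And>z z' h s. z \<in> C \<Longrightarrow> z' \<in> C \<Longrightarrow> norm (w z' h s - w z h s) \<le> B * norm (z' - z) * (norm h * norm s)"
    "\<And>z z' h s. z \<in> C \<Longrightarrow> z' \<in> C \<Longrightarrow> norm (w z' h s - w z h s - fd (\<lambda>y. w y h s) z (z' - z))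
      \<le> B * (norm (z' - z))\<^sup>2 * (norm h * norm s)"
proof -
  have "\<exists>B\<ge>0. \<forall>z\<in>C. \<forall>z'\<in>C. norm (w z b b') \<le> B \<and> norm (w z' b b' - w z b b') \<le> B * norm (z' - z)" for b b'
    by (rule smooth_on_compact_Lipschitz[OF smooth_bilinearD(3)[OF w] C])
  then obtain B1 where B1: "\<And>b b'. B1 b b' \<ge> 0" "\<And>b b' z. z \<in> C \<Longrightarrow> norm (w z b b') \<le> B1 b b'"
    "\<And>b b' z z'. z \<in> C \<Longrightarrow> z' \<in> C \<Longrightarrow> norm (w z' b b' - w z b b') \<le> B1 b b' * norm (z' - z)"
    by metis
  have "\<exists>B\<ge>0. \<forall>z\<in>C. \<forall>z'\<in>C. norm (w z' b b' - w z b b' - fd (\<lambda>y. w y b b') z (z' - z)) \<le> B * (norm (z' - z))\<^sup>2" for b b'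
    by (rule smooth_on_compact_Taylor[OF smooth_bilinearD(3)[OF w] C])
  then obtain B2 where B2: "\<And>b b'. B2 b b' \<ge> 0"
    "\<And>b b' z z'. z \<in> C \<Longrightarrow> z' \<in> C \<Longrightarrow> norm (w z' b b' - w z b b' - fd (\<lambda>y. w y b b') z (z' - z)) \<le> B2 b b' * (norm (z' - z))\<^sup>2"
    by metis
  define S where "S = (\<lambda>B :: 'b \<Rightarrow> 'c \<Rightarrow> real. \<Sum>(b, b')\<in>Basis \<times> Basis. B b b')"
  define B where "B = S B1 + S B2"
  have S0: "S B1 \<ge> 0" "S B2 \<ge> 0" using B1 B2 by (auto simp: S_def intro: sum_nonneg)
  have bil: "bilinear (w z)" if "z \<in> C" for z using that C w smooth_bilinearD(2) by blast
  show thesis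
  proof (rule that[of B])
    show "B \<ge> 0" using S0 by (simp add: B_def)
    show "norm (w z h s) \<le> B * (norm h * norm s)" if "z \<in> C" for z h s
    proof -
      have "norm (w z h s) \<le> S B1 * (norm h * norm s)"
        unfolding S_def by (rule bilinear_norm_le_basis[OF bil[OF that] B1(2)[OF that]])
      also have "\<dots> \<le> B * (norm h * norm s)" using S0 by (intro mult_right_mono) (auto simp: B_def)
      finally show ?thesis .
    qed
    show "norm (w z' h s - w z h s) \<le> B * norm (z' - z) * (norm h * norm s)" if "z \<in> C" "z' \<in> C" for z z' h s
    proof -
      have "norm (w z' h s - w z h s) \<le> S (\<lambda>b b'. B1 b b' * norm (z' - z)) * (norm h * norm s)"
        unfolding S_def by (rule bilinear_norm_le_basis[OF bilinear_diff_family[OF bil[OF that(2)] bil[OF that(1)]] B1(3)[OF that]])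
      also have "\<dots> = (S B1 * norm (z' - z)) * (norm h * norm s)"
        by (simp add: S_def sum_distrib_right case_prod_unfold)
      also have "\<dots> \<le> (B * norm (z' - z)) * (norm h * norm s)"
        using S0 by (intro mult_right_mono) (auto simp: B_def)
      finally show ?thesis .
    qed
    show "norm (w z' h s - w z h s - fd (\<lambda>y. w y h s) z (z' - z)) \<le> B * (norm (z' - z))\<^sup>2 * (norm h * norm s)"
      if "z \<in> C" "z' \<in> C" for z z' h s
    proof -
      have "norm (w z' h s - w z h s - fd (\<lambda>y. w y h s) z (z' - z)) \<le> S (\<lambda>b b'. B2 b b' * (norm (z' - z))\<^sup>2) * (norm h * norm s)"
        unfolding S_def
        by (rule bilinear_norm_le_basis[OF bilinear_diff_family[OF bilinear_diff_family[OF bil[OF that(2)] bil[OF that(1)]]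
             bilinear_fd_family[OF w]] B2(2)[OF that]]) (use that C in auto)
      also have "\<dots> = (S B2 * (norm (z' - z))\<^sup>2) * (norm h * norm s)"
        by (simp add: S_def sum_distrib_right case_prod_unfold)
      also have "\<dots> \<le> (B * (norm (z' - z))\<^sup>2) * (norm h * norm s)"
        using S0 by (intro mult_right_mono) (auto simp: B_def)
      finally show ?thesis .
    qed
  qed
qed

section \<open>Linear total differential equations\<close>

lemma continuous_on_bilinear_family:
  fixes w :: "'a::euclidean_space \<Rightarrow> 'b::euclidean_space \<Rightarrow> 'c::euclidean_space \<Rightarrow> 'd::real_normed_vector"
  assumes w: "smooth_bilinear U w" and "p ` S \<subseteq> U"
    and "continuous_on S p" "continuous_on S h" "continuous_on S s"
  shows "continuous_on S (\<lambda>x. w (p x) (h x) (s x))"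
proof -
  have "continuous_on S (\<lambda>x. w (p x) b b')" for b b'
    using continuous_on_compose2[OF smooth_on_continuous[OF smooth_bilinearD(3)[OF w]] assms(3,2)] .
  then have "continuous_on S (\<lambda>x. \<Sum>a\<in>Basis \<times> Basis. ((h x \<bullet> fst a) * (s x \<bullet> snd a)) *\<^sub>R w (p x) (fst a) (snd a))"
    using assms by (intro continuous_intros)
  moreover have "(\<Sum>a\<in>Basis \<times> Basis. ((h x \<bullet> fst a) * (s x \<bullet> snd a)) *\<^sub>R w (p x) (fst a) (snd a))
      = w (p x) (h x) (s x)" if "x \<in> S" for x
    using bilinear_basis_sum[OF smooth_bilinearD(2)[OF w], of "p x" "h x" "s x"] assms(2) that
    by (auto simp: case_prod_unfold)
  ultimately show ?thesis
    by (simp cong: continuous_on_cong)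
qed

text \<open>Picard iteration for \<open>s (x0 + v) = s0 + integral {0..1} (\<lambda>t. w (x0 + t v)
  v (s (x0 + t v)))\<close>, on all rays simultaneously so that the solution is continuous in the
  point and not only along each ray. The bound \<open>B * r \<le> 1 / 2\<close> makes the operator a
  contraction with factor \<open>1 / 2\<close>.\<close>

lemma radial_solution_exists:
  fixes w :: "'a::euclidean_space \<Rightarrow> 'a \<Rightarrow> 'v::euclidean_space \<Rightarrow> 'v"
  assumes w: "smooth_bilinear U w" and r: "0 < r" "cball x0 r \<subseteq> U"
    and B: "0 \<le> B" "B * r \<le> 1 / 2"
    and wB: "\<And>z h s. z \<in> cball x0 r \<Longrightarrow> norm (w z h s) \<le> B * (norm h * norm s)"
  shows "\<exists>s. continuous_on UNIV s \<and> bounded (range s) \<and> s x0 = s0 \<and>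
    (\<forall>y t. norm (t *\<^sub>R y) < r \<longrightarrow>
      ((\<lambda>t. s (x0 + t *\<^sub>R y)) has_vector_derivative w (x0 + t *\<^sub>R y) y (s (x0 + t *\<^sub>R y))) (at t))"
proof -
  \<comment> \<open>Composition with the projection onto the ball extends the equation to the whole
    space, so that the iteration runs in the complete space of bounded continuous functions; inside
    the ball nothing changes.\<close>
  define \<rho> where "\<rho> y = closest_point (cball 0 r) (y - x0)" for y :: 'a
  have ne: "cball (0::'a) r \<noteq> {}" using r by simp
  have \<rho>_cont: "continuous_on S \<rho>" for S
    unfolding \<rho>_def
    by (rule continuous_on_compose2[OF continuous_on_closest_point[of "cball 0 r" UNIV]])
      (use ne in \<open>auto intro!: continuous_intros\<close>)
  have \<rho>_in: "norm (\<rho> y) \<le> r" for y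
    using closest_point_in_set[OF closed_cball ne, of "y - x0"] by (simp add: \<rho>_def)
  have \<rho>_eq: "\<rho> y = y - x0" if "norm (y - x0) \<le> r" for y
    unfolding \<rho>_def by (rule closest_point_self) (use that in simp)
  have in_cball: "x0 + t *\<^sub>R \<rho> y \<in> cball x0 r" if "t \<in> {0..1}" for t y
    using that \<rho>_in[of y] mult_mono[of t 1 "norm (\<rho> y)" r] by (simp add: dist_norm)
  define I where "I s y = integral {0..1} (\<lambda>t. w (x0 + t *\<^sub>R \<rho> y) (\<rho> y) (s (x0 + t *\<^sub>R \<rho> y)))" for s y
  have cont2: "continuous_on (UNIV \<times> {0..1}) (\<lambda>(y, t). w (x0 + t *\<^sub>R \<rho> y) (\<rho> y) (s (x0 + t *\<^sub>R \<rho> y)))"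
    if "continuous_on UNIV s" for s
    unfolding case_prod_unfold
  proof (rule continuous_on_bilinear_family[OF w])
    show "(\<lambda>x. x0 + snd x *\<^sub>R \<rho> (fst x)) ` (UNIV \<times> {0..1}) \<subseteq> U"
      using in_cball r(2) by fastforce
    have \<rho>f: "continuous_on (UNIV \<times> {0..1::real}) (\<lambda>x. \<rho> (fst x))"
      using continuous_on_compose2[OF \<rho>_cont[of UNIV] continuous_on_fst[OF continuous_on_id]] by auto
    show "continuous_on (UNIV \<times> {0..1::real}) (\<lambda>x. \<rho> (fst x))" by (rule \<rho>f)
    show 1: "continuous_on (UNIV \<times> {0..1}) (\<lambda>x. x0 + snd x *\<^sub>R \<rho> (fst x))"
      by (intro continuous_intros \<rho>f)
    show "continuous_on (UNIV \<times> {0..1}) (\<lambda>x. s (x0 + snd x *\<^sub>R \<rho> (fst x)))"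
      by (rule continuous_on_compose2[OF that 1]) auto
  qed
  have cont1: "continuous_on {0..1} (\<lambda>t. w (x0 + t *\<^sub>R \<rho> y) (\<rho> y) (s (x0 + t *\<^sub>R \<rho> y)))"
    if "continuous_on UNIV s" for s y
    using continuous_on_compose2[OF cont2[OF that], of "{0..1}" "\<lambda>t. (y, t)"]
    by (simp add: image_subset_iff continuous_on_Pair)
  have I_cont: "continuous_on UNIV (I s)" if "continuous_on UNIV s" for s
    unfolding I_def using integral_continuous_on_param[of UNIV 0 1, OF cont2[OF that, folded box_real(2)]] by simp
  have I_diff: "norm (I s y - I s' y) \<le> M / 2"
    if "continuous_on UNIV s" "continuous_on UNIV s'" "\<And>z. norm (s z - s' z) \<le> M" for s s' y M
  proof -
    have "I s y - I s' y = integral {0..1} (\<lambda>t. w (x0 + t *\<^sub>R \<rho> y) (\<rho> y) (s (x0 + t *\<^sub>R \<rho> y))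
        - w (x0 + t *\<^sub>R \<rho> y) (\<rho> y) (s' (x0 + t *\<^sub>R \<rho> y)))"
      unfolding I_def by (rule integral_diff[symmetric]) (intro integrable_continuous_real cont1 that)+
    also have "norm \<dots> \<le> (M / 2) * (1 - 0)"
    proof (rule integral_bound)
      show "continuous_on {0..1} (\<lambda>t. w (x0 + t *\<^sub>R \<rho> y) (\<rho> y) (s (x0 + t *\<^sub>R \<rho> y))
        - w (x0 + t *\<^sub>R \<rho> y) (\<rho> y) (s' (x0 + t *\<^sub>R \<rho> y)))"
        by (intro continuous_on_diff cont1 that)
      fix t :: real assume t: "t \<in> {0..1}"
      let ?z = "x0 + t *\<^sub>R \<rho> y"
      have "w ?z (\<rho> y) (s ?z) - w ?z (\<rho> y) (s' ?z) = w ?z (\<rho> y) (s ?z - s' ?z)"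
        using bilinear_rsub[OF smooth_bilinearD(2)[OF w]] in_cball[OF t] r(2) by (metis subsetD)
      also have "norm \<dots> \<le> B * (norm (\<rho> y) * norm (s ?z - s' ?z))" by (rule wB[OF in_cball[OF t]])
      also have "\<dots> \<le> B * (r * M)"
        using \<rho>_in[of y] that(3)[of ?z] B r by (intro mult_left_mono mult_mono) auto
      also have "\<dots> \<le> 1/2 * M"
        using mult_right_mono[OF B(2), of M] that(3)[of ?z] norm_ge_zero[of "s ?z - s' ?z"]
        by (simp add: mult.assoc)
      finally show "norm (w ?z (\<rho> y) (s ?z) - w ?z (\<rho> y) (s' ?z)) \<le> M / 2" by simp
    qed simp
    finally show ?thesis by simp
  qed
  have w0: "w z h 0 = 0" if "z \<in> cball x0 r" for z h
    using wB[OF that, of h 0] by simp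
  have I0: "I (\<lambda>_. 0) y = 0" for y
  proof -
    have "I (\<lambda>_. 0) y = integral {0..1::real} (\<lambda>t. 0 :: 'v)"
      unfolding I_def
    proof (rule Henstock_Kurzweil_Integration.integral_cong)
      fix t :: real assume "t \<in> {0..1}"
      from w0[OF in_cball[OF this]] show "w (x0 + t *\<^sub>R \<rho> y) (\<rho> y) 0 = 0" .
    qed
    then show ?thesis by simp
  qed
  define T where "T s = Bcontfun (\<lambda>y. s0 + I (apply_bcontfun s) y)" for s :: "'a \<Rightarrow>\<^sub>C 'v"
  have sc: "continuous_on UNIV (apply_bcontfun s)" for s :: "'a \<Rightarrow>\<^sub>C 'v"
    using apply_bcontfun[of s] by (auto simp: bcontfun_def)
  have T: "apply_bcontfun (T s) = (\<lambda>y. s0 + I (apply_bcontfun s) y)" for s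
    unfolding T_def
  proof (rule Bcontfun_inverse, rule bcontfun_normI)
    show "continuous_on UNIV (\<lambda>y. s0 + I (apply_bcontfun s) y)" by (intro continuous_intros I_cont sc)
    fix y
    have "norm (I (apply_bcontfun s) y - I (\<lambda>_. 0) y) \<le> norm s / 2"
      by (rule I_diff[OF sc]) (auto simp: norm_bounded)
    then show "norm (s0 + I (apply_bcontfun s) y) \<le> norm s0 + norm s / 2"
      using I0 norm_triangle_ineq[of s0 "I (apply_bcontfun s) y"] by simp
  qed
  have "dist (T f) (T g) \<le> 1/2 * dist f g" for f g
  proof (rule dist_bound)
    fix y
    have "norm (I (apply_bcontfun f) y - I (apply_bcontfun g) y) \<le> dist f g / 2"
      by (rule I_diff[OF sc sc]) (simp add: dist_norm[symmetric] dist_bounded)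
    then show "dist (apply_bcontfun (T f) y) (apply_bcontfun (T g) y) \<le> 1/2 * dist f g"
      by (simp add: T dist_norm)
  qed
  then have "\<exists>!f. T f = f" by (intro banach_fix_type[of "1/2"]) auto
  then obtain f where f: "T f = f" by blast
  define s where "s = apply_bcontfun f"
  have s: "s y = s0 + I s y" for y using T[of f] f by (simp add: s_def fun_eq_iff)
  have s_cont: "continuous_on UNIV s" unfolding s_def by (rule sc)
  have "\<rho> x0 = 0" using \<rho>_eq[of x0] r by simp
  have lin0: "w x0 0 v = 0" for v using wB[of x0 0 v] r by simp
  have "I s x0 = 0" unfolding I_def by (simp add: \<open>\<rho> x0 = 0\<close> lin0)
  then have s_x0: "s x0 = s0" using s[of x0] by simp
  have "((\<lambda>t. s (x0 + t *\<^sub>R y)) has_vector_derivative w (x0 + t *\<^sub>R y) y (s (x0 + t *\<^sub>R y))) (at t)"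
    if ty: "norm (t *\<^sub>R y) < r" for y t
  proof -
    \<comment> \<open>A symmetric interval containing \<open>t\<close> in its interior on which the
      ray stays in the ball; this makes the derivative at \<open>t\<close> two-sided, also for
      \<open>t \<le> 0\<close>.\<close>
    obtain a where a: "\<bar>t\<bar> < a" "a * norm y < r"
    proof (cases "y = 0")
      case True then show thesis using that[of "\<bar>t\<bar> + 1"] r by simp
    next
      case False
      then have "\<bar>t\<bar> < r / norm y" using ty by (simp add: field_simps)
      then obtain a where "\<bar>t\<bar> < a" "a < r / norm y" using dense by blast
      then show thesis using that[of a] False by (simp add: field_simps)
    qed
    have inb: "norm (\<theta> *\<^sub>R y) \<le> r" if "\<theta> \<in> {-a..a}" for \<theta>
      using that a mult_right_mono[of "\<bar>\<theta>\<bar>" a "norm y"] by (simp add: abs_le_iff)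
    define g where "g \<theta> = w (x0 + \<theta> *\<^sub>R y) y (s (x0 + \<theta> *\<^sub>R y))" for \<theta>
    have inU: "x0 + \<theta> *\<^sub>R y \<in> U" if "\<theta> \<in> {-a..a}" for \<theta>
      using inb[OF that] r(2) by (auto simp: dist_norm)
    have g_cont: "continuous_on {-a..a} g"
      unfolding g_def
    proof (rule continuous_on_bilinear_family[OF w])
      show "(\<lambda>\<theta>. x0 + \<theta> *\<^sub>R y) ` {-a..a} \<subseteq> U" using inU by auto
      show 1: "continuous_on {-a..a} (\<lambda>\<theta>. x0 + \<theta> *\<^sub>R y)" by (intro continuous_intros)
      show "continuous_on {-a..a} (\<lambda>\<theta>. s (x0 + \<theta> *\<^sub>R y))"
        by (rule continuous_on_compose2[OF s_cont 1]) auto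
    qed auto
    define G where "G \<theta> = integral {-a..\<theta>} g" for \<theta>
    have G: "(G has_vector_derivative g \<theta>) (at \<theta> within {-a..a})" if "\<theta> \<in> {-a..a}" for \<theta>
      unfolding G_def using integral_has_vector_derivative[OF g_cont that] .
    \<comment> \<open>The substitution \<open>\<tau> * \<theta>\<close> turns the fixed point
      equation at \<open>x0 + \<theta> y\<close> into an integral along one fixed ray, whose
      dependence on its end point can be differentiated.\<close>
    have sG: "s (x0 + \<theta> *\<^sub>R y) = s0 + G \<theta> - G 0" if \<theta>: "\<theta> \<in> {-a..a}" for \<theta>
    proof -
      have sub: "(\<lambda>\<tau>. \<tau> * \<theta>) ` {0..1} \<subseteq> {-a..a}"
      proof (rule image_subsetI)
        fix \<tau> :: real assume "\<tau> \<in> {0..1}"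
        then have "\<bar>\<tau> * \<theta>\<bar> \<le> 1 * \<bar>\<theta>\<bar>" unfolding abs_mult by (intro mult_right_mono) auto
        then show "\<tau> * \<theta> \<in> {-a..a}" using \<theta> by auto
      qed
      have "((\<lambda>\<tau>. \<theta> *\<^sub>R g (\<tau> * \<theta>)) has_integral (G (1 * \<theta>) - G (0 * \<theta>))) {0..1}"
      proof (rule fundamental_theorem_of_calculus)
        fix \<tau> :: real assume \<tau>: "\<tau> \<in> {0..1}"
        have 1: "((\<lambda>\<tau>. \<tau> * \<theta>) has_vector_derivative \<theta>) (at \<tau> within {0..1})"
          unfolding has_real_derivative_iff_has_vector_derivative[symmetric]
          by (auto intro!: derivative_eq_intros)
        have 2: "(G has_vector_derivative g (\<tau> * \<theta>)) (at (\<tau> * \<theta>) within (\<lambda>\<tau>. \<tau> * \<theta>) ` {0..1})"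
          by (rule has_vector_derivative_within_subset[OF G[OF subsetD[OF sub imageI[OF \<tau>]]] sub])
        show "((\<lambda>\<tau>. G (\<tau> * \<theta>)) has_vector_derivative \<theta> *\<^sub>R g (\<tau> * \<theta>)) (at \<tau> within {0..1})"
          using vector_diff_chain_within[OF 1 2] by (simp add: o_def)
      qed simp
      from integral_unique[OF this] have int: "integral {0..1} (\<lambda>\<tau>. \<theta> *\<^sub>R g (\<tau> * \<theta>)) = G \<theta> - G 0"
        by simp
      have "\<rho> (x0 + \<theta> *\<^sub>R y) = \<theta> *\<^sub>R y" using \<rho>_eq[of "x0 + \<theta> *\<^sub>R y"] inb[OF \<theta>] by simp
      then have "I s (x0 + \<theta> *\<^sub>R y) = integral {0..1} (\<lambda>\<tau>. w (x0 + (\<tau> * \<theta>) *\<^sub>R y) (\<theta> *\<^sub>R y) (s (x0 + (\<tau> * \<theta>) *\<^sub>R y)))"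
        by (simp add: I_def)
      also have "\<dots> = integral {0..1} (\<lambda>\<tau>. \<theta> *\<^sub>R g (\<tau> * \<theta>))"
      proof (rule Henstock_Kurzweil_Integration.integral_cong)
        fix \<tau> :: real assume \<tau>: "\<tau> \<in> {0..1}"
        have "x0 + (\<tau> * \<theta>) *\<^sub>R y \<in> U"
          by (rule inU[OF subsetD[OF sub imageI[OF \<tau>]]])
        then show "w (x0 + (\<tau> * \<theta>) *\<^sub>R y) (\<theta> *\<^sub>R y) (s (x0 + (\<tau> * \<theta>) *\<^sub>R y)) = \<theta> *\<^sub>R g (\<tau> * \<theta>)"
          unfolding g_def by (rule bilinear_lmul[OF smooth_bilinearD(2)[OF w]])
      qed
      finally show ?thesis using s[of "x0 + \<theta> *\<^sub>R y"] int by simp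
    qed
    have t: "t \<in> {-a<..<a}" using a by auto
    then have "(G has_vector_derivative g t) (at t)"
      using G[of t] at_within_Icc_at[of "-a" t a] by simp
    then have "((\<lambda>\<theta>. s0 + G \<theta> - G 0) has_vector_derivative g t) (at t)"
      by (auto intro!: derivative_eq_intros)
    then show ?thesis unfolding g_def[symmetric]
      by (rule has_vector_derivative_transform_within_open[OF _ open_greaterThanLessThan t]) (simp add: sG)
  qed
  moreover have "bounded (range s)" unfolding s_def using apply_bcontfun[of f] by (simp add: bcontfun_def)
  ultimately show ?thesis using s_cont s_x0 by blast
qed

lemma small_radius:
  fixes w :: "'a::euclidean_space \<Rightarrow> 'a \<Rightarrow> 'v::euclidean_space \<Rightarrow> 'v"
  assumes w: "smooth_bilinear U w" and "x0 \<in> U"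
  obtains r B where "0 < r" "cball x0 r \<subseteq> U" "0 \<le> B" "B * r \<le> 1 / 2"
    "\<And>z h s. z \<in> cball x0 r \<Longrightarrow> norm (w z h s) \<le> B * (norm h * norm s)"
    "\<And>z z' h s. z \<in> cball x0 r \<Longrightarrow> z' \<in> cball x0 r \<Longrightarrow>
      norm (w z' h s - w z h s) \<le> B * norm (z' - z) * (norm h * norm s)"
    "\<And>z z' h s. z \<in> cball x0 r \<Longrightarrow> z' \<in> cball x0 r \<Longrightarrow>
      norm (w z' h s - w z h s - fd (\<lambda>y. w y h s) z (z' - z)) \<le> B * (norm (z' - z))\<^sup>2 * (norm h * norm s)"
proof -
  obtain r0 where r0: "r0 > 0" "cball x0 r0 \<subseteq> U"
    using open_contains_cball smooth_bilinearD(1)[OF w] assms(2) by blast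
  obtain B where B: "B \<ge> 0"
    "\<And>z h s. z \<in> cball x0 r0 \<Longrightarrow> norm (w z h s) \<le> B * (norm h * norm s)"
    "\<And>z z' h s. z \<in> cball x0 r0 \<Longrightarrow> z' \<in> cball x0 r0 \<Longrightarrow>
      norm (w z' h s - w z h s) \<le> B * norm (z' - z) * (norm h * norm s)"
    "\<And>z z' h s. z \<in> cball x0 r0 \<Longrightarrow> z' \<in> cball x0 r0 \<Longrightarrow>
      norm (w z' h s - w z h s - fd (\<lambda>y. w y h s) z (z' - z)) \<le> B * (norm (z' - z))\<^sup>2 * (norm h * norm s)"
    using smooth_bilinear_bounds[OF w compact_cball convex_cball r0(2)] by metis
  \<comment> \<open>Shrinking the ball keeps the bounds with the same \<open>B\<close>; the summand
    1 keeps the quotient meaningful for \<open>B = 0\<close>.\<close>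
  define r where "r = min r0 (1 / (2 * (B + 1)))"
  have r: "r > 0" "r \<le> r0" using r0 B by (auto simp: r_def)
  have sub: "cball x0 r \<subseteq> cball x0 r0" using r by auto
  have "B * r \<le> B * (1 / (2 * (B + 1)))" using B by (intro mult_left_mono) (auto simp: r_def)
  also have "\<dots> \<le> 1 / 2" using B by (simp add: field_simps)
  finally show thesis using that[of r B] r B sub r0 by blast
qed

text \<open>Parallel transport along the rays from \<open>x0\<close>, for an arbitrary connection;
  transverse derivatives are governed by \<open>w\<close> only under the integrability condition in
  \<open>flat_system_solvable\<close>. Linearity is built in by superposing the solutions that start
  at basis vectors.\<close>

lemma radial_transport:
  fixes w :: "'a::euclidean_space \<Rightarrow> 'a \<Rightarrow> 'v::euclidean_space \<Rightarrow> 'v"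
  assumes w: "smooth_bilinear U w" and "x0 \<in> U"
  obtains r T where "0 < r" "cball x0 r \<subseteq> U" "\<And>y. linear (T y)" "\<And>s. T x0 s = s"
    "\<And>y t s. norm (t *\<^sub>R y) < r \<Longrightarrow>
      ((\<lambda>t. T (x0 + t *\<^sub>R y) s) has_vector_derivative w (x0 + t *\<^sub>R y) y (T (x0 + t *\<^sub>R y) s)) (at t)"
proof -
  obtain r B where r: "0 < r" "cball x0 r \<subseteq> U" "0 \<le> B" "B * r \<le> 1 / 2"
    "\<And>z h s. z \<in> cball x0 r \<Longrightarrow> norm (w z h s) \<le> B * (norm h * norm s)"
    using small_radius[OF assms] by metis
  have "\<exists>s. s x0 = b \<and> (\<forall>y t. norm (t *\<^sub>R y) < r \<longrightarrow>
      ((\<lambda>t. s (x0 + t *\<^sub>R y)) has_vector_derivative w (x0 + t *\<^sub>R y) y (s (x0 + t *\<^sub>R y))) (at t))" for b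
    using radial_solution_exists[OF w r, of b] by blast
  then obtain s where s: "\<And>b. s b x0 = b" "\<And>b y t. norm (t *\<^sub>R y) < r \<Longrightarrow>
      ((\<lambda>t. s b (x0 + t *\<^sub>R y)) has_vector_derivative w (x0 + t *\<^sub>R y) y (s b (x0 + t *\<^sub>R y))) (at t)"
    by metis
  define T where "T y v = (\<Sum>b\<in>Basis. (v \<bullet> b) *\<^sub>R s b y)" for y v
  show thesis
  proof (rule that[of r T])
    show "linear (T y)" for y
      unfolding T_def by (rule linearI) (auto simp: inner_add_left scaleR_add_left sum.distrib scaleR_sum_right)
    show "T x0 v = v" for v by (simp add: T_def s(1) euclidean_representation)
    fix y :: 'a and t v assume ty: "norm (t *\<^sub>R y) < r"
    then have "x0 + t *\<^sub>R y \<in> U" using r(2) by (auto simp: dist_norm)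
    then interpret W: linear "w (x0 + t *\<^sub>R y) y"
      using smooth_bilinearD(2)[OF w] by (auto simp: bilinear_def)
    have "((\<lambda>t. T (x0 + t *\<^sub>R y) v) has_vector_derivative
      (\<Sum>b\<in>Basis. (v \<bullet> b) *\<^sub>R w (x0 + t *\<^sub>R y) y (s b (x0 + t *\<^sub>R y)))) (at t)"
      unfolding T_def has_vector_derivative_def
      using s(2)[OF ty, unfolded has_vector_derivative_def]
      by (auto intro!: derivative_eq_intros simp: scaleR_sum_right mult.commute)
    then show "((\<lambda>t. T (x0 + t *\<^sub>R y) v) has_vector_derivative w (x0 + t *\<^sub>R y) y (T (x0 + t *\<^sub>R y) v)) (at t)"
      by (simp add: T_def W.sum W.scale)
  qed (use r in auto)
qed

text \<open>A substitute for Gronwall's inequality on the unit interval: at a maximum of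
  \<open>norm (\<phi> t)\<close> the mean value inequality bounds the maximum by half of itself plus
  \<open>e\<close>.\<close>

lemma derivative_half_self_bound:
  fixes \<phi> :: "real \<Rightarrow> 'v::real_normed_vector"
  assumes D: "\<And>t. t \<in> {0..1} \<Longrightarrow> (\<phi> has_vector_derivative \<phi>' t) (at t)"
    and "\<phi> 0 = 0" and B: "\<And>t. t \<in> {0..1} \<Longrightarrow> norm (\<phi>' t) \<le> norm (\<phi> t) / 2 + e" and t: "t \<in> {0..1}"
  shows "norm (\<phi> t) \<le> 2 * e"
proof -
  have "continuous_on {0..1} (\<lambda>t. norm (\<phi> t))"
    using D has_vector_derivative_continuous
    by (intro continuous_on_norm continuous_at_imp_continuous_on) blast
  then obtain m where m: "m \<in> {0..1}" "\<And>t. t \<in> {0..1} \<Longrightarrow> norm (\<phi> t) \<le> norm (\<phi> m)"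
    using continuous_attains_sup[of "{0..1::real}" "\<lambda>t. norm (\<phi> t)"] by auto
  have "norm (\<phi> m - \<phi> 0) \<le> (norm (\<phi> m) / 2 + e) * norm (m - 0)"
  proof (rule differentiable_bound[of "{0..1}"])
    show "(\<phi> has_derivative (\<lambda>h. h *\<^sub>R \<phi>' t)) (at t within {0..1})" if "t \<in> {0..1}" for t
      using D[OF that] by (simp add: has_vector_derivative_def has_derivative_at_withinI)
    show "onorm (\<lambda>h. h *\<^sub>R \<phi>' t) \<le> norm (\<phi> m) / 2 + e" if "t \<in> {0..1}" for t
    proof (rule onorm_le)
      fix h :: real
      have "norm (\<phi>' t) \<le> norm (\<phi> m) / 2 + e" using B[OF that] m(2)[OF that] by simp
      then show "norm (h *\<^sub>R \<phi>' t) \<le> (norm (\<phi> m) / 2 + e) * norm h"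
        by (simp add: mult.commute mult_left_mono)
    qed
  qed (use m in auto)
  also have "\<dots> \<le> (norm (\<phi> m) / 2 + e) * 1"
    using m(1) order_trans[OF norm_ge_zero B[OF m(1)]] by (intro mult_left_mono) auto
  finally have "norm (\<phi> m) \<le> 2 * e" using assms(2) by simp
  then show ?thesis using m(2)[OF t] by simp
qed

lemma has_derivative_quadratic_bound:
  fixes f :: "'a::real_normed_vector \<Rightarrow> 'b::real_normed_vector"
  assumes "bounded_linear f'" "d > 0" "K \<ge> 0"
    and "\<And>h. norm h < d \<Longrightarrow> norm (f (x + h) - f x - f' h) \<le> K * (norm h)\<^sup>2"
  shows "(f has_derivative f') (at x)"
  unfolding has_derivative_at_alt
proof (intro conjI allI impI assms(1))
  fix e :: real assume "e > 0"
  define d' where "d' = min d (e / (K + 1))"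
  have "norm (f y - f x - f' (y - x)) \<le> e * norm (y - x)" if "norm (y - x) < d'" for y
  proof -
    have "norm (y - x) \<le> e / (K + 1)" using that by (simp add: d'_def)
    then have "(K + 1) * norm (y - x) \<le> e" using assms(3) by (simp add: field_simps)
    then have "K * norm (y - x) \<le> e" using norm_ge_zero[of "y - x"] unfolding distrib_right by linarith
    then have "(K * norm (y - x)) * norm (y - x) \<le> e * norm (y - x)" by (rule mult_right_mono) simp
    then show ?thesis using assms(4)[of "y - x"] that by (simp add: d'_def power2_eq_square)
  qed
  moreover have "d' > 0" using assms \<open>e > 0\<close> by (simp add: d'_def)
  ultimately show "\<exists>d>0. \<forall>y. norm (y - x) < d \<longrightarrow> norm (f y - f x - f' (y - x)) \<le> e * norm (y - x)" by blast
qed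

text \<open>Along the ray through \<open>y\<close>, compare the solution on the neighbouring ray through \<open>y + h\<close> with
  \<open>X + Z\<close>, where \<open>Z\<close> is the value that the equation predicts for the derivative in direction \<open>t h\<close>.
  Flatness says precisely that \<open>Z\<close> solves the linearized equation, so that the error is quadratic
  in \<open>h\<close>.\<close>

lemma flat_system_solvable:
  fixes w :: "'a::euclidean_space \<Rightarrow> 'a \<Rightarrow> 'v::euclidean_space \<Rightarrow> 'v"
  assumes w: "smooth_bilinear U w" and "x0 \<in> U"
    and flat: "\<And>y h k s. y \<in> U \<Longrightarrow>
      fd (\<lambda>z. w z h s) y k + w y h (w y k s) = fd (\<lambda>z. w z k s) y h + w y k (w y h s)"
  obtains r where "0 < r" "cball x0 r \<subseteq> U"
    "\<And>s0. \<exists>s. s x0 = s0 \<and> smooth_on (ball x0 r) s \<and>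
      (\<forall>y\<in>ball x0 r. (s has_derivative (\<lambda>h. w y h (s y))) (at y))"
proof -
  obtain r B where r: "0 < r" "cball x0 r \<subseteq> U" and B: "0 \<le> B" "B * r \<le> 1 / 2"
    and wB: "\<And>z h s. z \<in> cball x0 r \<Longrightarrow> norm (w z h s) \<le> B * (norm h * norm s)"
    and wL: "\<And>z z' h s. z \<in> cball x0 r \<Longrightarrow> z' \<in> cball x0 r \<Longrightarrow>
      norm (w z' h s - w z h s) \<le> B * norm (z' - z) * (norm h * norm s)"
    and wT: "\<And>z z' h s. z \<in> cball x0 r \<Longrightarrow> z' \<in> cball x0 r \<Longrightarrow>
      norm (w z' h s - w z h s - fd (\<lambda>y. w y h s) z (z' - z)) \<le> B * (norm (z' - z))\<^sup>2 * (norm h * norm s)"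
    using small_radius[OF assms(1,2)] by metis
  have bil: "bilinear (w z)" if "z \<in> cball x0 r" for z
    using that r smooth_bilinearD(2)[OF w] by blast
  have "\<exists>s. s x0 = s0 \<and> smooth_on (ball x0 r) s \<and>
      (\<forall>y\<in>ball x0 r. (s has_derivative (\<lambda>h. w y h (s y))) (at y))" for s0
  proof -
    obtain s where s: "continuous_on UNIV s" "bounded (range s)" "s x0 = s0"
      "\<And>y t. norm (t *\<^sub>R y) < r \<Longrightarrow>
      ((\<lambda>t. s (x0 + t *\<^sub>R y)) has_vector_derivative w (x0 + t *\<^sub>R y) y (s (x0 + t *\<^sub>R y))) (at t)"
      using radial_solution_exists[OF w r B wB, of s0] by blast
    obtain C where C: "C > 0" "\<And>y. norm (s y) \<le> C"
      using s(2) unfolding bounded_pos by auto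
    have D: "(s has_derivative (\<lambda>h. w y h (s y))) (at y)" if y: "y \<in> ball x0 r" for y
    proof -
      define v where "v = y - x0"
      have v: "norm v < r" using y by (simp add: v_def dist_norm norm_minus_commute)
      \<comment> \<open>\<open>C1\<close> bounds the difference of two solutions in terms of
        \<open>norm h\<close>, and \<open>C2\<close> collects the four quadratic error terms in the
        equation for \<open>W\<close>; the factor 2 in \<open>C1\<close> and the one in front of
        \<open>C2\<close> are those of \<open>derivative_half_self_bound\<close>.\<close>
      define C1 where "C1 = 2 * (B * C + B * r * C)"
      define C2 where "C2 = B * r * C1 + B * r * C + B * C1 + B * C"
      have C12: "C1 \<ge> 0" "C2 \<ge> 0" using B C r by (auto simp: C1_def C2_def)
      have quad: "norm (s (y + h) - s y - w y h (s y)) \<le> (2 * C2) * (norm h)\<^sup>2" if h: "norm h < r - norm v" for h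
      proof -
        have vh: "norm (v + h) < r" using h norm_triangle_ineq[of v h] by simp
        have scale: "norm (t *\<^sub>R u) \<le> norm u" if "t \<in> {0..1}" for t and u :: 'a
          using that by (simp add: mult_left_le_one_le)
        define z where "z t = x0 + t *\<^sub>R v" for t
        define z' where "z' t = x0 + t *\<^sub>R (v + h)" for t
        have zin: "z t \<in> cball x0 r" "z' t \<in> cball x0 r" if "t \<in> {0..1}" for t
          using scale[OF that, of v] scale[OF that, of "v + h"] v vh by (auto simp: z_def z'_def dist_norm)
        have zz: "z' t - z t = t *\<^sub>R h" for t by (simp add: z_def z'_def algebra_simps)
        have zz_le: "norm (z' t - z t) \<le> norm h" if "t \<in> {0..1}" for t
          unfolding zz by (rule scale[OF that])
        define X where "X t = s (z t)" for t
        define Y where "Y t = s (z' t)" for t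
        define Z where "Z t = w (z t) (t *\<^sub>R h) (X t)" for t
        have X: "(X has_vector_derivative w (z t) v (X t)) (at t)" if "t \<in> {0..1}" for t
          using s(4)[of t v] scale[OF that, of v] v unfolding X_def z_def by linarith
        have Y: "(Y has_vector_derivative w (z' t) (v + h) (Y t)) (at t)" if "t \<in> {0..1}" for t
          using s(4)[of t "v + h"] scale[OF that, of "v + h"] vh unfolding Y_def z'_def by linarith
        have XY: "norm (X t) \<le> C" "norm (Y t) \<le> C" for t using C by (auto simp: X_def Y_def)
        define V where "V t = Y t - X t" for t
        have V_le: "norm (V t) \<le> C1 * norm h" if t: "t \<in> {0..1}" for t
        proof -
          have "norm (V t) \<le> 2 * ((B * C + B * r * C) * norm h)"
          proof (rule derivative_half_self_bound[OF _ _ _ t])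
            fix t :: real assume t: "t \<in> {0..1}"
            show "(V has_vector_derivative w (z' t) (v + h) (Y t) - w (z t) v (X t)) (at t)"
              unfolding V_def by (intro has_vector_derivative_diff X Y t)
            note b = bil[OF zin(1)[OF t]] and b' = bil[OF zin(2)[OF t]]
            have "w (z' t) (v + h) (Y t) - w (z t) v (X t)
              = w (z t) v (V t) + w (z' t) h (Y t) + (w (z' t) v (Y t) - w (z t) v (Y t))"
              by (simp add: V_def bilinear_rsub[OF b] bilinear_ladd[OF b'])
            also have "norm \<dots> \<le> norm (V t) / 2 + B * (norm h * C) + B * norm h * (r * C)"
            proof (intro norm_triangle_mono)
              have "norm (w (z t) v (V t)) \<le> B * (norm v * norm (V t))" by (rule wB[OF zin(1)[OF t]])
              also have "\<dots> \<le> B * (r * norm (V t))" using v B by (intro mult_left_mono mult_right_mono) auto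
              also have "\<dots> \<le> norm (V t) / 2" using mult_right_mono[OF B(2), of "norm (V t)"] by simp
              finally show "norm (w (z t) v (V t)) \<le> norm (V t) / 2" .
              show "norm (w (z' t) h (Y t)) \<le> B * (norm h * C)"
                by (rule order_trans[OF wB[OF zin(2)[OF t]]]) (use B XY in \<open>intro mult_left_mono, auto\<close>)
              show "norm (w (z' t) v (Y t) - w (z t) v (Y t)) \<le> B * norm h * (r * C)"
                by (rule order_trans[OF wL[OF zin[OF t]]])
                  (use B XY v r C zz_le[OF t] in \<open>intro mult_mono, auto\<close>)
            qed
            finally show "norm (w (z' t) (v + h) (Y t) - w (z t) v (X t)) \<le> norm (V t) / 2 + (B * C + B * r * C) * norm h"
              by (simp add: algebra_simps)
          qed (simp add: V_def X_def Y_def z_def z'_def)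
          then show ?thesis by (simp only: C1_def mult.assoc)
        qed
        define W where "W t = V t - Z t" for t
        have "norm (W 1) \<le> 2 * (C2 * (norm h)\<^sup>2)"
        proof (rule derivative_half_self_bound[of _ "\<lambda>t. w (z' t) (v + h) (Y t) - w (z t) v (X t)
              - (fd (\<lambda>q. w q (t *\<^sub>R h) (X t)) (z t) v + w (z t) h (X t) + w (z t) (t *\<^sub>R h) (w (z t) v (X t)))"])
          fix t :: real assume t: "t \<in> {0..1}"
          have zU: "z t \<in> U" using zin[OF t] r by auto
          have "((\<lambda>t. w (z t) (t *\<^sub>R h) (X t)) has_derivative
            (\<lambda>a. fd (\<lambda>q. w q (t *\<^sub>R h) (X t)) (z t) (a *\<^sub>R v) + w (z t) (a *\<^sub>R h) (X t)
               + w (z t) (t *\<^sub>R h) (a *\<^sub>R w (z t) v (X t)))) (at t)"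
          proof (rule has_derivative_bilinear_family[OF w, of z t])
            show "(z has_derivative (\<lambda>a. a *\<^sub>R v)) (at t)"
              unfolding z_def by (auto intro!: derivative_eq_intros)
            show "((\<lambda>t. t *\<^sub>R h) has_derivative (\<lambda>a. a *\<^sub>R h)) (at t)"
              by (auto intro!: derivative_eq_intros)
            show "(X has_derivative (\<lambda>a. a *\<^sub>R w (z t) v (X t))) (at t)"
              using X[OF t] by (simp add: has_vector_derivative_def)
          qed (use zU in auto)
          moreover have "linear (fd (\<lambda>q. w q (t *\<^sub>R h) (X t)) (z t))"
            by (intro linear_frechet_derivative smooth_on_differentiable[OF smooth_bilinearD(3)[OF w] zU])
          ultimately have "(Z has_vector_derivative fd (\<lambda>q. w q (t *\<^sub>R h) (X t)) (z t) v + w (z t) h (X t)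
               + w (z t) (t *\<^sub>R h) (w (z t) v (X t))) (at t)"
            unfolding Z_def has_vector_derivative_def
            by (simp add: linear_scale bilinear_lmul[OF bil[OF zin(1)[OF t]]] bilinear_rmul[OF bil[OF zin(1)[OF t]]]
                scaleR_add_right)
          then show "(W has_vector_derivative w (z' t) (v + h) (Y t) - w (z t) v (X t)
              - (fd (\<lambda>q. w q (t *\<^sub>R h) (X t)) (z t) v + w (z t) h (X t) + w (z t) (t *\<^sub>R h) (w (z t) v (X t)))) (at t)"
            unfolding W_def V_def by (intro has_vector_derivative_diff X Y t)
          note b = bil[OF zin(1)[OF t]] and b' = bil[OF zin(2)[OF t]]
          \<comment> \<open>Flatness trades the derivative of the coefficients along the ray for one
            along \<open>t h\<close>, which is the displacement \<open>z' t - z t\<close> and so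
            fits the Taylor bound.\<close>
          have Z': "fd (\<lambda>q. w q (t *\<^sub>R h) (X t)) (z t) v + w (z t) (t *\<^sub>R h) (w (z t) v (X t))
            = fd (\<lambda>q. w q v (X t)) (z t) (t *\<^sub>R h) + w (z t) v (Z t)"
            unfolding Z_def by (rule flat[OF zU])
          have "w (z' t) (v + h) (Y t) - w (z t) v (X t)
              - (fd (\<lambda>q. w q (t *\<^sub>R h) (X t)) (z t) v + w (z t) h (X t) + w (z t) (t *\<^sub>R h) (w (z t) v (X t)))
            = w (z' t) (v + h) (Y t) - w (z t) v (X t) - w (z t) h (X t)
              - (fd (\<lambda>q. w q v (X t)) (z t) (t *\<^sub>R h) + w (z t) v (Z t))"
            unfolding Z'[symmetric] by (simp add: algebra_simps)
          \<comment> \<open>The first of the five terms is at most \<open>norm (W t) / 2\<close>;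
            each of the others has two small factors among \<open>h\<close>, \<open>V t\<close> and
            the displacement.\<close>
          also have "\<dots> = w (z t) v (W t) + (w (z' t) v (V t) - w (z t) v (V t))
             + (w (z' t) v (X t) - w (z t) v (X t) - fd (\<lambda>q. w q v (X t)) (z t) (z' t - z t))
             + w (z' t) h (V t) + (w (z' t) h (X t) - w (z t) h (X t))"
          proof -
            have "w (z t) v (W t) = w (z t) v (Y t) - w (z t) v (X t) - w (z t) v (Z t)"
              by (simp only: W_def V_def bilinear_rsub[OF b])
            moreover have "w (z' t) v (V t) = w (z' t) v (Y t) - w (z' t) v (X t)"
              "w (z t) v (V t) = w (z t) v (Y t) - w (z t) v (X t)"
              "w (z' t) h (V t) = w (z' t) h (Y t) - w (z' t) h (X t)"
              by (simp_all only: V_def bilinear_rsub[OF b] bilinear_rsub[OF b'])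
            ultimately show ?thesis by (simp add: zz bilinear_ladd[OF b'])
          qed
          also have "norm \<dots> \<le> norm (W t) / 2 + B * norm h * (r * (C1 * norm h)) + B * (norm h)\<^sup>2 * (r * C)
             + B * (norm h * (C1 * norm h)) + B * norm h * (norm h * C)"
          proof (intro norm_triangle_mono)
            have "norm (w (z t) v (W t)) \<le> B * (norm v * norm (W t))" by (rule wB[OF zin(1)[OF t]])
            also have "\<dots> \<le> B * (r * norm (W t))" using v B by (intro mult_left_mono mult_right_mono) auto
            also have "\<dots> \<le> norm (W t) / 2" using mult_right_mono[OF B(2), of "norm (W t)"] by simp
            finally show "norm (w (z t) v (W t)) \<le> norm (W t) / 2" .
            show "norm (w (z' t) v (V t) - w (z t) v (V t)) \<le> B * norm h * (r * (C1 * norm h))"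
              by (rule order_trans[OF wL[OF zin[OF t]]])
                (use B v r C12 V_le[OF t] zz_le[OF t] in \<open>intro mult_mono, auto\<close>)
            show "norm (w (z' t) v (X t) - w (z t) v (X t) - fd (\<lambda>q. w q v (X t)) (z t) (z' t - z t)) \<le> B * (norm h)\<^sup>2 * (r * C)"
              by (rule order_trans[OF wT[OF zin[OF t]]])
                (use B XY v r C zz_le[OF t] in \<open>intro mult_mono power_mono, auto\<close>)
            show "norm (w (z' t) h (V t)) \<le> B * (norm h * (C1 * norm h))"
              by (rule order_trans[OF wB[OF zin(2)[OF t]]]) (use B V_le[OF t] in \<open>intro mult_left_mono, auto\<close>)
            show "norm (w (z' t) h (X t) - w (z t) h (X t)) \<le> B * norm h * (norm h * C)"
              by (rule order_trans[OF wL[OF zin[OF t]]])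
                (use B XY C zz_le[OF t] in \<open>intro mult_mono, auto\<close>)
          qed
          finally show "norm (w (z' t) (v + h) (Y t) - w (z t) v (X t)
              - (fd (\<lambda>q. w q (t *\<^sub>R h) (X t)) (z t) v + w (z t) h (X t) + w (z t) (t *\<^sub>R h) (w (z t) v (X t))))
              \<le> norm (W t) / 2 + C2 * (norm h)\<^sup>2"
            by (simp add: C2_def algebra_simps power2_eq_square)
        next
          show "W 0 = 0"
            using r by (simp add: W_def V_def X_def Y_def Z_def z_def z'_def bilinear_lzero[OF bil[of x0]])
        qed simp
        moreover have "W 1 = s (y + h) - s y - w y h (s y)"
          by (simp add: W_def V_def X_def Y_def Z_def z_def z'_def v_def algebra_simps)
        ultimately show ?thesis by simp
      qed
      have yc: "y \<in> cball x0 r" using y by simp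
      have "bounded_linear (\<lambda>h. w y h (s y))"
        using bil[OF yc] by (simp add: bilinear_def linear_conv_bounded_linear)
      then show ?thesis
        by (rule has_derivative_quadratic_bound[of _ "r - norm v" "2 * C2", OF _ _ _ quad])
          (use v C12 in auto)
    qed
    have "smooth_on (ball x0 r) s"
    proof (rule smooth_onI[OF open_ball continuous_on_subset[OF s(1)] D])
      show "Ck_on k (ball x0 r) (\<lambda>y. w y h (s y))" if "Ck_on k (ball x0 r) s" for k h
        by (rule Ck_on_bilinear_family[OF w open_ball _ Ck_on_id Ck_on_const that])
          (use r ball_subset_cball in auto)
    qed auto
    then show ?thesis using s(3) D by blast
  qed
  then show thesis using that r by blast
qed

section \<open>Affine coordinates of a flat symmetric connection\<close>

text \<open>The sum is the transpose of \<open>L\<close> applied to the covector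
  \<open>\<alpha>\<close>, written out in the basis.\<close>

lemma inner_dual_basis_sum:
  fixes L :: "'a::euclidean_space \<Rightarrow> 'b::real_inner"
  assumes "linear L"
  shows "(\<Sum>b\<in>Basis. (\<alpha> \<bullet> L b) *\<^sub>R b) \<bullet> v = \<alpha> \<bullet> L v"
proof -
  interpret linear L by fact
  have "\<alpha> \<bullet> L v = \<alpha> \<bullet> L (\<Sum>b\<in>Basis. (v \<bullet> b) *\<^sub>R b)" by (simp add: euclidean_representation)
  also have "\<dots> = (\<Sum>b\<in>Basis. (v \<bullet> b) * (\<alpha> \<bullet> L b))" by (simp add: sum scale inner_sum_right)
  also have "\<dots> = (\<Sum>b\<in>Basis. (\<alpha> \<bullet> L b) *\<^sub>R b) \<bullet> v"
    unfolding inner_sum_left by (rule sum.cong) (simp_all add: inner_commute)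
  finally show ?thesis by simp
qed

text \<open>Parallel vector fields have the derivative \<open>- \<Gamma> y h s\<close> in direction
  \<open>h\<close>, and vanishing curvature is exactly the integrability condition of this system.
  The frame is assembled linearly from the fields starting at basis vectors.\<close>

lemma parallel_frame:
  fixes \<Gamma> :: "'a::euclidean_space \<Rightarrow> 'a \<Rightarrow> 'a \<Rightarrow> 'a"
  assumes \<Gamma>: "smooth_bilinear U \<Gamma>" and x0: "x0 \<in> U"
    and flat: "\<And>y u v w. y \<in> U \<Longrightarrow> fd (\<lambda>z. \<Gamma> z v w) y u - fd (\<lambda>z. \<Gamma> z u w) y v
      + \<Gamma> y u (\<Gamma> y v w) - \<Gamma> y v (\<Gamma> y u w) = 0"
  obtains r G where "0 < r" "cball x0 r \<subseteq> U" "\<And>y. linear (G y)" "\<And>b. G x0 b = b"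
    "\<And>b. smooth_on (ball x0 r) (\<lambda>y. G y b)"
    "\<And>y b. y \<in> ball x0 r \<Longrightarrow> ((\<lambda>y. G y b) has_derivative (\<lambda>v. - \<Gamma> y v (G y b))) (at y)"
proof -
  have bil: "bilinear (\<Gamma> y)" if "y \<in> U" for y by (rule smooth_bilinearD(2)[OF \<Gamma> that])
  have D: "((\<lambda>z. \<Gamma> z h s) has_derivative fd (\<lambda>z. \<Gamma> z h s) y) (at y)" if "y \<in> U" for y h s
    by (rule smooth_on_has_derivative[OF smooth_bilinearD(3)[OF \<Gamma>] that])
  define w where "w y h s = - \<Gamma> y h s" for y h s
  have w: "smooth_bilinear U w"
    unfolding smooth_bilinear_def w_def using smooth_bilinearD[OF \<Gamma>]
    by (auto simp: bilinear_def intro!: smooth_on_minus linear_compose_neg)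
  have fw: "fd (\<lambda>z. w z h s) y k = - fd (\<lambda>z. \<Gamma> z h s) y k" if "y \<in> U" for y h s k
    unfolding w_def fd_eq[OF has_derivative_minus[OF D[OF that]]] ..
  have "fd (\<lambda>z. w z h s) y k + w y h (w y k s) = fd (\<lambda>z. w z k s) y h + w y k (w y h s)"
    if y: "y \<in> U" for y h k s
    unfolding fw[OF y] using flat[OF y, of h s k] by (simp add: w_def bilinear_rneg[OF bil[OF y]] algebra_simps)
  from flat_system_solvable[OF w x0 this] obtain r where r: "0 < r" "cball x0 r \<subseteq> U"
    "\<And>s0. \<exists>s. s x0 = s0 \<and> smooth_on (ball x0 r) s \<and>
      (\<forall>y\<in>ball x0 r. (s has_derivative (\<lambda>h. w y h (s y))) (at y))" by metis
  then obtain g where g: "\<And>b. g b x0 = b" "\<And>b. smooth_on (ball x0 r) (g b)"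
    "\<And>b y. y \<in> ball x0 r \<Longrightarrow> (g b has_derivative (\<lambda>h. w y h (g b y))) (at y)" by metis
  define G where "G y b = (\<Sum>i\<in>Basis. (b \<bullet> i) *\<^sub>R g i y)" for y b
  show thesis
  proof (rule that[of r G])
    show "linear (G y)" for y
      unfolding G_def by (rule linearI) (auto simp: inner_add_left scaleR_add_left sum.distrib scaleR_sum_right)
    show "G x0 b = b" for b by (simp add: G_def g(1) euclidean_representation)
    show "smooth_on (ball x0 r) (\<lambda>y. G y b)" for b
      unfolding G_def by (intro smooth_on_sum smooth_on_scaleR smooth_on_const g open_ball)
    fix y b assume y: "y \<in> ball x0 r"
    then have "y \<in> U" using r(2) by auto
    then interpret W: linear "\<Gamma> y v" for v
      using bil by (simp add: bilinear_def)
    have "((\<lambda>y. G y b) has_derivative (\<lambda>v. \<Sum>i\<in>Basis. (b \<bullet> i) *\<^sub>R w y v (g i y))) (at y)"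
      unfolding G_def by (intro has_derivative_sum has_derivative_scaleR_right g(3) y)
    then show "((\<lambda>y. G y b) has_derivative (\<lambda>v. - \<Gamma> y v (G y b))) (at y)"
      by (simp add: G_def W.sum W.scale w_def sum_negf)
  qed (use r in auto)
qed

text \<open>An affine function is sought together with its differential \<open>\<alpha>\<close>, as
  a solution of \<open>df = \<alpha>\<close> and
  \<open>d\<alpha> = \<alpha> \<circ> \<Gamma>\<close>. The first equation is integrable by
  torsion-freeness, the second by vanishing curvature. The components of \<open>E\<close> are the
  differentials of the coordinate functions.\<close>

lemma affine_functions:
  fixes \<Gamma> :: "'a::euclidean_space \<Rightarrow> 'a \<Rightarrow> 'a \<Rightarrow> 'a"
  assumes \<Gamma>: "smooth_bilinear U \<Gamma>" and x0: "x0 \<in> U"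
    and sym: "\<And>y u v. y \<in> U \<Longrightarrow> \<Gamma> y u v = \<Gamma> y v u"
    and flat: "\<And>y u v w. y \<in> U \<Longrightarrow> fd (\<lambda>z. \<Gamma> z v w) y u - fd (\<lambda>z. \<Gamma> z u w) y v
      + \<Gamma> y u (\<Gamma> y v w) - \<Gamma> y v (\<Gamma> y u w) = 0"
  obtains r f E where "0 < r" "cball x0 r \<subseteq> U" "f x0 = 0" "\<And>y. linear (E y)" "\<And>b. E x0 b = b"
    "smooth_on (ball x0 r) f" "\<And>y. y \<in> ball x0 r \<Longrightarrow> (f has_derivative E y) (at y)"
    "\<And>y b. y \<in> ball x0 r \<Longrightarrow> ((\<lambda>y. E y b) has_derivative (\<lambda>v. E y (\<Gamma> y v b))) (at y)"
proof -
  have bil: "bilinear (\<Gamma> y)" if "y \<in> U" for y by (rule smooth_bilinearD(2)[OF \<Gamma> that])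
  have lin: "linear (\<Gamma> y u)" if "y \<in> U" for y u using bil[OF that] by (simp add: bilinear_def)
  have D: "((\<lambda>z. \<Gamma> z h s) has_derivative fd (\<lambda>z. \<Gamma> z h s) y) (at y)" if "y \<in> U" for y h s
    by (rule smooth_on_has_derivative[OF smooth_bilinearD(3)[OF \<Gamma>] that])
  \<comment> \<open>A state is a value together with a covector; the second component is the
    covector \<open>b \<mapsto> snd s \<bullet> \<Gamma> y h b\<close>, represented by its
    coefficients.\<close>
  define w :: "'a \<Rightarrow> 'a \<Rightarrow> real \<times> 'a \<Rightarrow> real \<times> 'a" where
    "w y h s = (snd s \<bullet> h, \<Sum>b\<in>Basis. (snd s \<bullet> \<Gamma> y h b) *\<^sub>R b)" for y h s
  have U: "open U" by (rule smooth_bilinearD(1)[OF \<Gamma>])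
  have w: "smooth_bilinear U w"
    unfolding smooth_bilinear_def
  proof (intro conjI ballI allI U)
    show "bilinear (w y)" if "y \<in> U" for y
      unfolding bilinear_def w_def
      by (auto intro!: linearI simp: inner_add_left inner_add_right bilinear_ladd[OF bil[OF that]]
          bilinear_lmul[OF bil[OF that]] scaleR_add_left sum.distrib scaleR_sum_right)
    show "smooth_on U (\<lambda>y. w y h s)" for h s
      unfolding w_def
      by (intro smooth_on_Pair smooth_on_sum smooth_on_scaleR smooth_on_inner smooth_on_const U
          smooth_bilinearD(3)[OF \<Gamma>])
  qed
  have fw: "fd (\<lambda>z. w z h s) y k = (0, \<Sum>b\<in>Basis. (snd s \<bullet> fd (\<lambda>z. \<Gamma> z h b) y k) *\<^sub>R b)"
    if "y \<in> U" for y h s k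
  proof -
    have "((\<lambda>z. w z h s) has_derivative (\<lambda>k. (0, \<Sum>b\<in>Basis. (snd s \<bullet> fd (\<lambda>z. \<Gamma> z h b) y k) *\<^sub>R b))) (at y)"
      unfolding w_def
      by (intro has_derivative_Pair has_derivative_const has_derivative_sum has_derivative_scaleR_left
          has_derivative_inner_right D[OF that])
    from fd_eq[OF this] show ?thesis by simp
  qed
  have fl: "fd (\<lambda>z. w z h s) y k + w y h (w y k s) = fd (\<lambda>z. w z k s) y h + w y k (w y h s)"
    if y: "y \<in> U" for y h k s
  proof -
    have eq: "fd (\<lambda>z. w z h s) y k + w y h (w y k s) =
      (snd s \<bullet> \<Gamma> y k h, \<Sum>b\<in>Basis. (snd s \<bullet> (fd (\<lambda>z. \<Gamma> z h b) y k + \<Gamma> y k (\<Gamma> y h b))) *\<^sub>R b)" for h k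
      unfolding fw[OF y] unfolding w_def
      by (simp add: inner_dual_basis_sum[OF lin[OF y]] inner_add_right scaleR_add_left sum.distrib)
    have "fd (\<lambda>z. \<Gamma> z h b) y k + \<Gamma> y k (\<Gamma> y h b) = fd (\<lambda>z. \<Gamma> z k b) y h + \<Gamma> y h (\<Gamma> y k b)" for b
      using flat[OF y, of h b k] by (simp add: algebra_simps)
    then show ?thesis unfolding eq by (simp add: sym[OF y, of h k])
  qed
  from flat_system_solvable[OF w x0 fl] obtain r where r: "0 < r" "cball x0 r \<subseteq> U"
    "\<And>s0. \<exists>s. s x0 = s0 \<and> smooth_on (ball x0 r) s \<and>
      (\<forall>y\<in>ball x0 r. (s has_derivative (\<lambda>h. w y h (s y))) (at y))" by metis
  then have "\<exists>s. s x0 = (0, i) \<and> smooth_on (ball x0 r) s \<and>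
      (\<forall>y\<in>ball x0 r. (s has_derivative (\<lambda>h. w y h (s y))) (at y))" for i by blast
  then obtain g where g: "\<And>i. g i x0 = (0, i)" "\<And>i. smooth_on (ball x0 r) (g i)"
    "\<And>i y. y \<in> ball x0 r \<Longrightarrow> (g i has_derivative (\<lambda>h. w y h (g i y))) (at y)" by metis
  define f where "f y = (\<Sum>i\<in>Basis. fst (g i y) *\<^sub>R i)" for y
  define E where "E y u = (\<Sum>i\<in>Basis. (snd (g i y) \<bullet> u) *\<^sub>R i)" for y u
  show thesis
  proof (rule that[of r f E])
    show "f x0 = 0" by (simp add: f_def g(1))
    show "linear (E y)" for y
      unfolding E_def by (rule linearI) (auto simp: inner_add_right scaleR_add_left sum.distrib scaleR_sum_right)
    show "E x0 b = b" for b by (simp add: E_def g(1) inner_commute[of _ b] euclidean_representation)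
    have "smooth_on (ball x0 r) (\<lambda>y. fst (g i y))" for i
      by (rule smooth_on_bounded_linear[OF bounded_linear_fst open_ball g(2)])
    then show "smooth_on (ball x0 r) f"
      unfolding f_def by (intro smooth_on_sum smooth_on_scaleR smooth_on_const open_ball)
    fix y assume y: "y \<in> ball x0 r"
    then have yU: "y \<in> U" using r(2) by auto
    have "(f has_derivative (\<lambda>h. \<Sum>i\<in>Basis. fst (w y h (g i y)) *\<^sub>R i)) (at y)"
      unfolding f_def
      by (intro has_derivative_sum has_derivative_scaleR_left has_derivative_fst g(3) y)
    then show "(f has_derivative E y) (at y)" by (simp add: E_def[abs_def] w_def)
    fix b
    have "((\<lambda>y. E y b) has_derivative (\<lambda>h. \<Sum>i\<in>Basis. (snd (w y h (g i y)) \<bullet> b) *\<^sub>R i)) (at y)"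
      unfolding E_def
      by (intro has_derivative_sum has_derivative_scaleR_left has_derivative_inner_left has_derivative_snd g(3) y)
    then show "((\<lambda>y. E y b) has_derivative (\<lambda>v. E y (\<Gamma> y v b))) (at y)"
      by (simp add: E_def w_def inner_dual_basis_sum[OF lin[OF yU]])
  qed (use r in auto)
qed

text \<open>A parallel covector paired with a parallel vector field is constant. Hence the frame
  \<open>G\<close> inverts the differential \<open>E\<close> of the coordinate map wherever it does
  so at \<open>x0\<close>, and the local inverse \<open>h\<close> satisfies an equation
  \<open>h' = G \<circ> h\<close> with smooth \<open>G\<close>, which gives its smoothness by
  bootstrap.\<close>

lemma flat_coordinates:
  fixes \<Gamma> :: "'a::euclidean_space \<Rightarrow> 'a \<Rightarrow> 'a \<Rightarrow> 'a"
  assumes \<Gamma>: "smooth_bilinear U \<Gamma>" and x0: "x0 \<in> U"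
    and sym: "\<And>y u v. y \<in> U \<Longrightarrow> \<Gamma> y u v = \<Gamma> y v u"
    and flat: "\<And>y u v w. y \<in> U \<Longrightarrow> fd (\<lambda>z. \<Gamma> z v w) y u - fd (\<lambda>z. \<Gamma> z u w) y v
      + \<Gamma> y u (\<Gamma> y v w) - \<Gamma> y v (\<Gamma> y u w) = 0"
  obtains r f h E G where "0 < r" "ball x0 r \<subseteq> U" "f x0 = 0" "open (f ` ball x0 r)"
    "homeomorphism (ball x0 r) (f ` ball x0 r) f h"
    "smooth_on (ball x0 r) f" "smooth_on (f ` ball x0 r) h"
    "\<And>y. linear (E y)" "\<And>y. linear (G y)" "\<And>b. G x0 b = b"
    "\<And>y b. y \<in> ball x0 r \<Longrightarrow> E y (G y b) = b" "\<And>y b. y \<in> ball x0 r \<Longrightarrow> G y (E y b) = b"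
    "\<And>y. y \<in> ball x0 r \<Longrightarrow> (f has_derivative E y) (at y)"
    "\<And>z. z \<in> f ` ball x0 r \<Longrightarrow> (h has_derivative G (h z)) (at z)"
    "\<And>y b. y \<in> ball x0 r \<Longrightarrow> ((\<lambda>y. G y b) has_derivative (\<lambda>v. - \<Gamma> y v (G y b))) (at y)"
proof -
  obtain r1 G where G: "0 < r1" "cball x0 r1 \<subseteq> U" "\<And>y. linear (G y)" "\<And>b. G x0 b = b"
    "\<And>b. smooth_on (ball x0 r1) (\<lambda>y. G y b)"
    "\<And>y b. y \<in> ball x0 r1 \<Longrightarrow> ((\<lambda>y. G y b) has_derivative (\<lambda>v. - \<Gamma> y v (G y b))) (at y)"
    by (rule parallel_frame[OF \<Gamma> x0 flat], assumption) (rule that)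
  obtain r2 f E where E: "0 < r2" "cball x0 r2 \<subseteq> U" "f x0 = 0" "\<And>y. linear (E y)" "\<And>b. E x0 b = b"
    "smooth_on (ball x0 r2) f" "\<And>y. y \<in> ball x0 r2 \<Longrightarrow> (f has_derivative E y) (at y)"
    "\<And>y b. y \<in> ball x0 r2 \<Longrightarrow> ((\<lambda>y. E y b) has_derivative (\<lambda>v. E y (\<Gamma> y v b))) (at y)"
    by (rule affine_functions[OF \<Gamma> x0 sym flat], assumption, assumption) (rule that)
  define r0 where "r0 = min r1 r2"
  have r0: "r0 > 0" "ball x0 r0 \<subseteq> ball x0 r1" "ball x0 r0 \<subseteq> ball x0 r2" "ball x0 r0 \<subseteq> U"
    using G(1,2) E(1) by (auto simp: r0_def)
  have EG: "E y (G y b) = b" if y: "y \<in> ball x0 r0" for y b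
  proof -
    have Es: "E z v = (\<Sum>i\<in>Basis. (v \<bullet> i) *\<^sub>R E z i)" for z v
    proof -
      interpret linear "E z" by (rule E(4))
      have "E z v = E z (\<Sum>i\<in>Basis. (v \<bullet> i) *\<^sub>R i)" by (simp add: euclidean_representation)
      then show ?thesis by (simp add: sum scale)
    qed
    have "((\<lambda>z. E z (G z b)) has_derivative (\<lambda>v. 0)) (at z within ball x0 r0)" if z: "z \<in> ball x0 r0" for z
    proof -
      have "((\<lambda>z. \<Sum>i\<in>Basis. (G z b \<bullet> i) *\<^sub>R E z i) has_derivative
        (\<lambda>v. \<Sum>i\<in>Basis. (G z b \<bullet> i) *\<^sub>R E z (\<Gamma> z v i) + (- \<Gamma> z v (G z b) \<bullet> i) *\<^sub>R E z i)) (at z)"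
        using z r0 by (intro has_derivative_sum has_derivative_scaleR has_derivative_inner_left G(6) E(8)) auto
      moreover have "(\<Sum>i\<in>Basis. (G z b \<bullet> i) *\<^sub>R E z (\<Gamma> z v i) + (- \<Gamma> z v (G z b) \<bullet> i) *\<^sub>R E z i) = 0" for v
      proof -
        have "linear (\<lambda>u. E z (\<Gamma> z v u))"
          using smooth_bilinearD(2)[OF \<Gamma>] z r0(4) E(4) linear_compose[of "\<Gamma> z v" "E z"]
          by (auto simp: bilinear_def o_def)
        then interpret L: linear "\<lambda>u. E z (\<Gamma> z v u)" .
        have "(\<Sum>i\<in>Basis. (G z b \<bullet> i) *\<^sub>R E z (\<Gamma> z v i)) = E z (\<Gamma> z v (\<Sum>i\<in>Basis. (G z b \<bullet> i) *\<^sub>R i))"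
          by (simp add: L.sum L.scale)
        then have "(\<Sum>i\<in>Basis. (G z b \<bullet> i) *\<^sub>R E z (\<Gamma> z v i)) = E z (\<Gamma> z v (G z b))"
          by (simp add: euclidean_representation)
        moreover have "(\<Sum>i\<in>Basis. (- \<Gamma> z v (G z b) \<bullet> i) *\<^sub>R E z i) = - E z (\<Gamma> z v (G z b))"
          using Es[of z "- \<Gamma> z v (G z b)"] linear_neg[OF E(4)[of z]] by metis
        ultimately show ?thesis unfolding sum.distrib by simp
      qed
      ultimately have "((\<lambda>z. E z (G z b)) has_derivative (\<lambda>v. 0)) (at z)"
        by (simp add: Es[of _ "G _ b", symmetric])
      then show ?thesis by (rule has_derivative_at_withinI)
    qed
    from has_derivative_zero_unique[OF convex_ball this y, of x0] r0(1)
    have "E y (G y b) = E x0 (G x0 b)" by simp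
    then show ?thesis by (simp add: E G)
  qed
  have GE: "G y (E y b) = b" if y: "y \<in> ball x0 r0" for y b
  proof -
    have "inj (G y)" using EG[OF y] by (metis injI)
    then have "surj (G y)" using linear_inj_imp_surj[OF G(3)] by blast
    then obtain a where "b = G y a" by (metis surjD)
    then show ?thesis using EG[OF y] by simp
  qed
  have bE: "blinfun_apply (Blinfun (E y)) = E y" for y
    using E(4) by (simp add: bounded_linear_Blinfun_apply linear_conv_bounded_linear)
  have contE: "continuous_on (ball x0 r0) (\<lambda>y. Blinfun (E y))"
  proof (rule continuous_on_blinfun_componentwise)
    show "continuous_on (ball x0 r0) (\<lambda>y. blinfun_apply (Blinfun (E y)) i)" for i
      unfolding bE using E(8) r0(3)
      by (intro continuous_at_imp_continuous_on ballI has_derivative_continuous) blast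
  qed
  have derE: "(f has_derivative blinfun_apply (Blinfun (E y))) (at y)" if "y \<in> ball x0 r0" for y
    unfolding bE using E(7) r0(3) that by blast
  have inv: "id_blinfun o\<^sub>L Blinfun (E x0) = id_blinfun"
    by (rule blinfun_eqI) (simp add: bE E(5))
  obtain U' V h h' where h: "open U'" "U' \<subseteq> ball x0 r0" "x0 \<in> U'" "open V" "homeomorphism U' V f h"
    "\<And>z. z \<in> V \<Longrightarrow> (h has_derivative (h' z)) (at z)"
    "\<And>z. z \<in> V \<Longrightarrow> h' z = inv (blinfun_apply (Blinfun (E (h z))))"
  proof (rule inverse_function_theorem[OF open_ball derE contE _ inv], assumption)
    show "x0 \<in> ball x0 r0" using r0(1) by simp
  qed (rule that)
  obtain r where r: "r > 0" "ball x0 r \<subseteq> U'" using h(1,3) openE by blast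
  let ?B = "ball x0 r"
  have Br0: "?B \<subseteq> ball x0 r0" using r h(2) by auto
  have fBV: "f ` ?B \<subseteq> V" using h(5) r(2) by (auto simp: homeomorphism_def)
  have hom: "homeomorphism ?B (f ` ?B) f h"
    by (rule homeomorphism_of_subsets[OF h(5) r(2) order_refl refl])
  have "openin (top_of_set V) (f ` ?B)"
    using homeomorphism_imp_open_map[OF h(5), of ?B] r(2) by (simp add: open_subset)
  then have op: "open (f ` ?B)" using h(4) openin_open_trans by blast
  have hB: "h z \<in> ?B" if "z \<in> f ` ?B" for z using hom that by (auto simp: homeomorphism_def)
  have hD: "(h has_derivative G (h z)) (at z)" if "z \<in> f ` ?B" for z
  proof -
    have "inv (E (h z)) = G (h z)"
      using EG[of "h z"] GE[of "h z"] hB[OF that] Br0 by (intro inv_equality) auto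
    then show ?thesis using h(6,7)[of z] that fBV by (auto simp: bE)
  qed
  have hs: "smooth_on (f ` ?B) h"
  proof (rule smooth_onI[OF op _ hD])
    show "continuous_on (f ` ?B) h" using hom by (simp add: homeomorphism_def)
    fix k v assume hk: "Ck_on k (f ` ?B) h"
    have "Ck_on k ?B (\<lambda>y. G y v)"
      using G(5)[of v] Br0 r0(2) by (auto simp: smooth_on_def intro: Ck_on_subset)
    have "h ` f ` ?B \<subseteq> ?B" using hB by blast
    then show "Ck_on k (f ` ?B) (\<lambda>z. G (h z) v)"
      by (rule Ck_on_compose[OF op open_ball _ hk \<open>Ck_on k ?B (\<lambda>y. G y v)\<close>])
  qed
  show thesis
  proof (rule that[of r f h E G])
    show "smooth_on ?B f" by (rule smooth_on_subset[OF E(6)]) (use Br0 r0(3) in blast)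
    show "E y (G y b) = b" "G y (E y b) = b" if "y \<in> ?B" for y b
      using EG GE that Br0 by blast+
    show "(f has_derivative E y) (at y)" if "y \<in> ?B" for y
      using E(7) that Br0 r0(3) by blast
    show "((\<lambda>y. G y b) has_derivative (\<lambda>v. - \<Gamma> y v (G y b))) (at y)" if "y \<in> ?B" for y b
      using G(6) that Br0 r0(2) by blast
    show "?B \<subseteq> U" using Br0 r0(4) by blast
  qed (fact r(1) E(3) op hom hs E(4) G(3) G(4) hD)+
qed

section \<open>Smooth gauges and their infinitesimal symmetries\<close>

locale smooth_gauge =
  fixes p :: "'a::euclidean_space \<Rightarrow> real"
  assumes smooth: "smooth_on (UNIV - {0}) p"
    and pos: "\<xi> \<noteq> 0 \<Longrightarrow> 0 < p \<xi>"
    and hom: "0 \<le> l \<Longrightarrow> p (l *\<^sub>R \<xi>) = l * p \<xi>"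
    and tri: "p (\<xi> + \<eta>) \<le> p \<xi> + p \<eta>"
begin

lemma zero: "p 0 = 0"
  using hom[of 0 0] by simp

lemma open_punctured: "open (UNIV - {0::'a})"
  by (simp add: open_Diff)

lemma derivative: "\<xi> \<noteq> 0 \<Longrightarrow> (p has_derivative fd p \<xi>) (at \<xi>)"
  using smooth_on_has_derivative[OF smooth] by simp

lemma linear_fd: "\<xi> \<noteq> 0 \<Longrightarrow> linear (fd p \<xi>)"
  using derivative has_derivative_linear by blast

lemma along_curve:
  assumes "(\<zeta> has_vector_derivative \<zeta>') (at t)" "\<zeta> t \<noteq> 0"
  shows "((\<lambda>t. p (\<zeta> t)) has_real_derivative fd p (\<zeta> t) \<zeta>') (at t)"
proof -
  have "((\<lambda>t. p (\<zeta> t)) has_derivative (\<lambda>h. fd p (\<zeta> t) (h *\<^sub>R \<zeta>'))) (at t)"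
    by (rule has_derivative_compose[OF assms(1)[unfolded has_vector_derivative_def] derivative[OF assms(2)]])
  then show ?thesis
    using linear_scale[OF linear_fd[OF assms(2)]] by (simp add: has_field_derivative_def mult_commute_abs)
qed

lemma euler:
  assumes "\<xi> \<noteq> 0" shows "fd p \<xi> \<xi> = p \<xi>"
proof -
  have "((\<lambda>t. t *\<^sub>R \<xi>) has_vector_derivative \<xi>) (at 1)"
    by (auto intro!: derivative_eq_intros)
  from along_curve[OF this] assms
  have "((\<lambda>t. p (t *\<^sub>R \<xi>)) has_real_derivative fd p \<xi> \<xi>) (at 1)" by simp
  moreover have "((\<lambda>t. t * p \<xi>) has_real_derivative p \<xi>) (at 1)"
    by (auto intro!: derivative_eq_intros)
  then have "((\<lambda>t. p (t *\<^sub>R \<xi>)) has_real_derivative p \<xi>) (at 1)"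
    by (rule has_field_derivative_transform_within_open[where S = "{0<..}"]) (auto simp: hom)
  ultimately show ?thesis by (rule DERIV_unique)
qed

section \<open>Which linear fields can be tangent to the level sets of a gauge\<close>

text \<open>The Lie algebra of the linear isometry group of \<open>p\<close>: the linear vector
  field \<open>\<xi> \<mapsto> T \<xi>\<close> is tangent to the level sets of
  \<open>p\<close>.\<close>

definition skew :: "('a \<Rightarrow> 'a) \<Rightarrow> bool" where
  "skew T \<longleftrightarrow> linear T \<and> (\<forall>\<xi>. \<xi> \<noteq> 0 \<longrightarrow> fd p \<xi> (T \<xi>) = 0)"

lemma constant_along_curve:
  assumes "\<And>t. (\<zeta> has_vector_derivative \<zeta>' t) (at t)" "\<And>t. \<zeta> t \<noteq> 0" "\<And>t. fd p (\<zeta> t) (\<zeta>' t) = 0"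
  shows "p (\<zeta> s) = p (\<zeta> t)"
  by (rule DERIV_isconst_all) (use along_curve[OF assms(1,2)] assms(3) in auto)

text \<open>By Euler's identity the derivative of \<open>p\<close> at \<open>e\<close> in the
  direction of \<open>e\<close> is \<open>p e\<close>, which is positive.\<close>

lemma skew_eigenvalue:
  assumes "skew T" "T e = \<mu> *\<^sub>R e" "e \<noteq> 0"
  shows "\<mu> = 0"
proof -
  have "fd p e (T e) = 0" using assms(1,3) by (simp add: skew_def)
  then have "\<mu> * p e = 0"
    unfolding assms(2) using linear_scale[OF linear_fd[OF assms(3)]] euler[OF assms(3)] by simp
  then show ?thesis using pos[OF assms(3)] by simp
qed

text \<open>The flow line through \<open>e\<close> is the straight line \<open>e + t T e\<close>.
  The gauge is constant on it, but it would have to grow linearly in \<open>t\<close> if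
  \<open>T e\<close> were nonzero.\<close>

lemma skew_nilpotent:
  assumes T: "skew T" and TT: "T (T e) = 0"
  shows "T e = 0"
proof (rule ccontr)
  assume ne: "T e \<noteq> 0"
  interpret T: linear T using T by (simp add: skew_def)
  let ?z = "\<lambda>t. e + t *\<^sub>R T e"
  have Tz: "T (?z t) = T e" for t by (simp add: T.add T.scale TT)
  have z: "?z t \<noteq> 0" for t
    using Tz[of t] ne T.zero by metis
  have const: "p (?z t) = p (?z 0)" for t
  proof (rule constant_along_curve[OF _ z])
    show "(?z has_vector_derivative T e) (at t)" for t
      by (auto intro!: derivative_eq_intros)
    show "fd p (?z t) (T e) = 0" for t
      using T z[of t] Tz[of t] by (metis skew_def)
  qed
  \<comment> \<open>Chosen so that \<open>t * p (T e)\<close> exceeds by 1 the bound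
    \<open>p e + p (- e)\<close> that the triangle inequality yields.\<close>
  define t where "t = (p e + p (- e) + 1) / p (T e)"
  have "p e \<ge> 0" "p (- e) \<ge> 0" using pos[of e] pos[of "-e"] zero by (cases "e = 0"; simp)+
  then have t: "t \<ge> 0" using pos[OF ne] by (simp add: t_def)
  have "t * p (T e) = p (?z t + (- e))" using hom[OF t, of "T e"] by simp
  also have "\<dots> \<le> p (?z t) + p (- e)" by (rule tri)
  also have "\<dots> = p e + p (- e)" using const[of t] by simp
  finally show False using pos[OF ne] by (simp add: t_def)
qed

text \<open>On the span of \<open>e\<close> and \<open>T e\<close> the operator acts as the complex
  number \<open>\<mu> + i \<nu>\<close>. The orbit of \<open>e\<close> is a logarithmic spiral that
  after the time \<open>2 * pi / \<nu>\<close> returns to a positive multiple of \<open>e\<close>;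
  constancy of the gauge makes this multiple 1.\<close>

lemma skew_elliptic_trace:
  assumes T: "skew T" and e: "e \<noteq> 0" and TT: "T (T e) = \<tau> *\<^sub>R T e - \<Delta> *\<^sub>R e" and disc: "\<tau>\<^sup>2 < 4 * \<Delta>"
  shows "\<tau> = 0"
proof -
  interpret T: linear T using T by (simp add: skew_def)
  define \<mu> where "\<mu> = \<tau> / 2"
  define \<nu> where "\<nu> = sqrt (\<Delta> - \<mu>\<^sup>2)"
  have "\<Delta> - \<mu>\<^sup>2 > 0" using disc by (simp add: \<mu>_def power_divide)
  then have \<nu>: "\<nu> > 0" "\<nu> * \<nu> = \<Delta> - \<mu>\<^sup>2" by (auto simp: \<nu>_def)
  \<comment> \<open>The second vector of the basis in which \<open>T\<close> takes the normal form
    of a rotation with scaling.\<close>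
  define f where "f = (1 / \<nu>) *\<^sub>R (T e - \<mu> *\<^sub>R e)"
  have Te: "T e = \<mu> *\<^sub>R e + \<nu> *\<^sub>R f" using \<nu> by (simp add: f_def)
  have "\<nu> *\<^sub>R T f = T (T e) - \<mu> *\<^sub>R T e" using \<nu> by (simp add: f_def T.scale T.diff)
  also have "\<dots> = \<mu> *\<^sub>R T e - \<Delta> *\<^sub>R e" unfolding TT by (simp add: \<mu>_def scaleR_left_diff_distrib[symmetric])
  also have "\<dots> = (\<mu> * \<nu>) *\<^sub>R f - (\<Delta> - \<mu>\<^sup>2) *\<^sub>R e"
    by (simp add: Te algebra_simps power2_eq_square)
  also have "\<dots> = \<nu> *\<^sub>R (\<mu> *\<^sub>R f - \<nu> *\<^sub>R e)" by (simp add: \<nu>(2)[symmetric] algebra_simps)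
  finally have Tf: "T f = \<mu> *\<^sub>R f - \<nu> *\<^sub>R e" using \<nu> by simp
  \<comment> \<open>A vanishing combination on the unit circle would be killed by
    \<open>T - \<mu>\<close> too, and the two resulting relations combine to
    \<open>(x\<^sup>2 + y\<^sup>2) e = 0\<close>.\<close>
  have indep: "x *\<^sub>R e + y *\<^sub>R f \<noteq> 0" if "x\<^sup>2 + y\<^sup>2 = 1" for x y :: real
  proof
    assume 0: "x *\<^sub>R e + y *\<^sub>R f = 0"
    then have 1: "T (x *\<^sub>R e + y *\<^sub>R f) - \<mu> *\<^sub>R (x *\<^sub>R e + y *\<^sub>R f) = 0" by simp
    have "T (x *\<^sub>R e + y *\<^sub>R f) - \<mu> *\<^sub>R (x *\<^sub>R e + y *\<^sub>R f) = \<nu> *\<^sub>R (x *\<^sub>R f - y *\<^sub>R e)"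
      by (simp add: T.add T.scale Te Tf algebra_simps)
    then have 2: "x *\<^sub>R f = y *\<^sub>R e" using 1 \<nu> by simp
    have "(x\<^sup>2 + y\<^sup>2) *\<^sub>R e = x *\<^sub>R (x *\<^sub>R e + y *\<^sub>R f) - y *\<^sub>R (x *\<^sub>R f - y *\<^sub>R e)"
      by (simp add: algebra_simps power2_eq_square)
    then show False using 0 2 e that by simp
  qed
  define z where "z t = exp (\<mu> * t) *\<^sub>R (cos (\<nu> * t) *\<^sub>R e + sin (\<nu> * t) *\<^sub>R f)" for t
  have z0: "z t \<noteq> 0" for t using indep[of "cos (\<nu> * t)" "sin (\<nu> * t)"] by (simp add: z_def)
  have "(z has_vector_derivative T (z t)) (at t)" for t
  proof -
    have "(z has_vector_derivative exp (\<mu> * t) *\<^sub>R ((- (\<nu> * sin (\<nu> * t))) *\<^sub>R e + (\<nu> * cos (\<nu> * t)) *\<^sub>R f)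
        + (\<mu> * exp (\<mu> * t)) *\<^sub>R (cos (\<nu> * t) *\<^sub>R e + sin (\<nu> * t) *\<^sub>R f)) (at t)"
      unfolding z_def by (auto intro!: derivative_eq_intros simp: mult_ac)
    moreover have "exp (\<mu> * t) *\<^sub>R ((- (\<nu> * sin (\<nu> * t))) *\<^sub>R e + (\<nu> * cos (\<nu> * t)) *\<^sub>R f)
        + (\<mu> * exp (\<mu> * t)) *\<^sub>R (cos (\<nu> * t) *\<^sub>R e + sin (\<nu> * t) *\<^sub>R f) = T (z t)"
      by (simp add: z_def T.add T.scale Te Tf algebra_simps)
    ultimately show ?thesis by simp
  qed
  then have "p (z (2 * pi / \<nu>)) = p (z 0)"
    by (rule constant_along_curve[OF _ z0]) (use T z0 in \<open>auto simp: skew_def\<close>)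
  moreover have "z (2 * pi / \<nu>) = exp (\<mu> * (2 * pi / \<nu>)) *\<^sub>R e" "z 0 = e" using \<nu> by (simp_all add: z_def)
  ultimately have "exp (\<mu> * (2 * pi / \<nu>)) * p e = p e" using hom[of "exp (\<mu> * (2 * pi / \<nu>))" e] by simp
  then have "\<mu> = 0" using pos[OF e] \<nu> by simp
  then show ?thesis by (simp add: \<mu>_def)
qed

text \<open>\<open>\<tau>\<close> and \<open>\<Delta>\<close> are trace and determinant on the
  plane, and Cayley--Hamilton holds on it. With complex eigenvalues the trace vanishes by the spiral
  argument. With real eigenvalues both must be zero, and then the restriction is nilpotent and hence
  zero.\<close>

lemma skew_on_plane:
  assumes T: "skew T" and indep: "\<And>x y. x *\<^sub>R u + y *\<^sub>R v = 0 \<Longrightarrow> x = 0 \<and> y = 0"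
    and Tu: "T u = \<alpha> *\<^sub>R u + a *\<^sub>R v" and Tv: "T v = \<beta> *\<^sub>R v - d *\<^sub>R u"
  shows "\<alpha> = 0 \<and> \<beta> = 0 \<and> a = 0 \<and> d = 0 \<or> \<alpha> + \<beta> = 0 \<and> \<alpha> * \<beta> + a * d > 0"
proof -
  interpret T: linear T using T by (simp add: skew_def)
  define \<tau> where "\<tau> = \<alpha> + \<beta>"
  define \<Delta> where "\<Delta> = \<alpha> * \<beta> + a * d"
  have u: "u \<noteq> 0" and v: "v \<noteq> 0" using indep[of 1 0] indep[of 0 1] by auto
  have TTu: "T (T u) = \<tau> *\<^sub>R T u - \<Delta> *\<^sub>R u"
    unfolding Tu by (simp add: T.add T.scale Tu Tv \<tau>_def \<Delta>_def algebra_simps)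
  have TTv: "T (T v) = \<tau> *\<^sub>R T v - \<Delta> *\<^sub>R v"
    unfolding Tv by (simp add: T.diff T.scale Tu Tv \<tau>_def \<Delta>_def algebra_simps)
  have u0: "\<alpha> = 0 \<and> a = 0" if "T u = 0" using indep[of \<alpha> a] that Tu by simp
  have v0: "d = 0 \<and> \<beta> = 0" if "T v = 0" using indep[of "-d" \<beta>] that Tv by simp
  show ?thesis
  proof (cases "\<tau>\<^sup>2 < 4 * \<Delta>")
    case True
    then have "\<tau> = 0" by (rule skew_elliptic_trace[OF T u TTu])
    then show ?thesis using True by (simp add: \<tau>_def \<Delta>_def)
  next
    case False
    define r where "r = sqrt (\<tau>\<^sup>2 - 4 * \<Delta>)"
    have r: "r * r = \<tau>\<^sup>2 - 4 * \<Delta>" using False by (simp add: r_def)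
    define m where "m = (\<tau> + r) / 2"
    define m' where "m' = (\<tau> - r) / 2"
    have mm: "m + m' = \<tau>" "m * m' = \<Delta>"
      using r by (auto simp: m_def m'_def field_simps power2_eq_square)
    \<comment> \<open>By the factored characteristic polynomial, either \<open>T u = m' u\<close> or
      \<open>T u - m' u\<close> is an eigenvector for \<open>m\<close>.\<close>
    have "T (T u - m' *\<^sub>R u) = m *\<^sub>R (T u - m' *\<^sub>R u)"
      by (simp add: T.diff T.scale TTu mm[symmetric] algebra_simps)
    then have "m = 0 \<or> m' = 0"
      using skew_eigenvalue[OF T, of "T u - m' *\<^sub>R u" m] skew_eigenvalue[OF T, of u m'] u by force
    then have \<Delta>0: "\<Delta> = 0" using mm by auto
    \<comment> \<open>With determinant zero, \<open>T u\<close> and \<open>T v\<close> satisfy the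
      eigenvector equation for \<open>\<tau>\<close>; if \<open>\<tau>\<close> is not zero, neither
      of them can be a nonzero vector.\<close>
    have \<tau>0: "\<tau> = 0"
    proof (rule ccontr)
      assume "\<tau> \<noteq> 0"
      then have "T u = 0" "T v = 0"
        using skew_eigenvalue[OF T, of "T u" \<tau>] skew_eigenvalue[OF T, of "T v" \<tau>] TTu TTv \<Delta>0 by auto
      then show False using u0 v0 \<open>\<tau> \<noteq> 0\<close> by (simp add: \<tau>_def)
    qed
    have "T u = 0" "T v = 0"
      using skew_nilpotent[OF T, of u] skew_nilpotent[OF T, of v] TTu TTv \<Delta>0 \<tau>0 by auto
    then show ?thesis using u0 v0 by simp
  qed
qed

text \<open>The operator in \<open>skew_curvature\<close> is the curvature of a projectively flat connection with
  projective Schouten tensor \<open>P\<close>. If it preserves the gauge, then on every plane \<open>P\<close> vanishes or is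
  definite; in the definite case rotations show that the gauge is Euclidean.\<close>

lemma projective_curvature_alternative:
  fixes P :: "'a \<Rightarrow> 'a \<Rightarrow> real"
  assumes dim: "2 \<le> DIM('a)" and P: "bilinear P"
    and skew_curvature: "\<And>u v. skew (\<lambda>\<xi>. P u \<xi> *\<^sub>R v - P v \<xi> *\<^sub>R u + (P u v - P v u) *\<^sub>R \<xi>)"
  shows "(\<forall>u v. P u v = 0) \<or> (\<exists>B. bilinear B \<and> (\<forall>\<xi>. (p \<xi>)\<^sup>2 = B \<xi> \<xi>))"
proof (cases "\<forall>u v. P u v = 0")
  case False
  note bl = bilinear_ladd[OF P] bilinear_radd[OF P] bilinear_lmul[OF P] bilinear_rmul[OF P]
    bilinear_lsub[OF P] bilinear_rsub[OF P]
  define indep where "indep u v \<longleftrightarrow> (\<forall>x y. x *\<^sub>R u + y *\<^sub>R v = 0 \<longrightarrow> x = 0 \<and> y = 0)" for u v :: 'a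
  have indepI: "indep u v" if "u \<noteq> 0" "\<And>c. v \<noteq> c *\<^sub>R u" for u v
    unfolding indep_def
  proof (intro allI impI)
    fix x y assume 0: "x *\<^sub>R u + y *\<^sub>R v = 0"
    have "y = 0"
    proof (rule ccontr)
      assume "y \<noteq> 0"
      have "v = (1 / y) *\<^sub>R (x *\<^sub>R u + y *\<^sub>R v) + (- x / y) *\<^sub>R u" using \<open>y \<noteq> 0\<close> by (simp add: algebra_simps)
      then have "v = (- x / y) *\<^sub>R u" using 0 by simp
      then show False using that(2) by blast
    qed
    then show "x = 0 \<and> y = 0" using 0 that(1) by simp
  qed
  \<comment> \<open>The curvature operator has the diagonal entries \<open>P u v - 2 P v u\<close>
    and \<open>2 P u v - P v u\<close> on the plane. Vanishing of both kills \<open>P u v\<close>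
    and \<open>P v u\<close>; vanishing of their sum is symmetry of \<open>P\<close>, after which
    the positive determinant says that \<open>P\<close> is definite.\<close>
  have plane: "(P u u = 0 \<and> P u v = 0 \<and> P v u = 0 \<and> P v v = 0) \<or>
     (P u v = P v u \<and> P u u * P v v > (P u v)\<^sup>2)" if "indep u v" for u v
  proof -
    let ?T = "\<lambda>\<xi>. P u \<xi> *\<^sub>R v - P v \<xi> *\<^sub>R u + (P u v - P v u) *\<^sub>R \<xi>"
    have "P u v - 2 * P v u = 0 \<and> 2 * P u v - P v u = 0 \<and> P u u = 0 \<and> P v v = 0 \<or>
      (P u v - 2 * P v u) + (2 * P u v - P v u) = 0 \<and>
      (P u v - 2 * P v u) * (2 * P u v - P v u) + P u u * P v v > 0"
    proof (rule skew_on_plane[OF skew_curvature[of u v], where u = u and v = v])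
      have two: "(2 * c) *\<^sub>R x = c *\<^sub>R x + c *\<^sub>R x" for c and x :: 'a
        by (simp add: scaleR_add_left[symmetric])
      show "P u u *\<^sub>R v - P v u *\<^sub>R u + (P u v - P v u) *\<^sub>R u = (P u v - 2 * P v u) *\<^sub>R u + P u u *\<^sub>R v"
        "P u v *\<^sub>R v - P v v *\<^sub>R u + (P u v - P v u) *\<^sub>R v = (2 * P u v - P v u) *\<^sub>R v - P v v *\<^sub>R u"
        by (simp_all add: scaleR_diff_left two)
    qed (use that in \<open>auto simp: indep_def\<close>)
    then show ?thesis
    proof (elim disjE conjE)
      assume h: "(P u v - 2 * P v u) + (2 * P u v - P v u) = 0"
        "(P u v - 2 * P v u) * (2 * P u v - P v u) + P u u * P v v > 0"
      have "P u v = P v u" using h(1) by simp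
      then show ?thesis using h(2) by (simp add: power2_eq_square)
    qed auto
  qed
  \<comment> \<open>A nonzero value on an independent pair puts their plane into the definite case;
    on a dependent pair it is a multiple of \<open>P u u\<close>.\<close>
  obtain u0 where u0: "P u0 u0 \<noteq> 0"
  proof -
    from False obtain u v where uv: "P u v \<noteq> 0" by blast
    show thesis
    proof (cases "indep u v")
      case True then have "P u u \<noteq> 0" using plane[OF True] uv zero_le_power2[of "P u v"] by auto
      then show thesis by (rule that)
    next
      case False
      have "u \<noteq> 0" using uv bilinear_lzero[OF P] by auto
      then obtain c where "v = c *\<^sub>R u" using False indepI by blast
      then show thesis using uv that[of u] by (simp add: bl)
    qed
  qed
  have u0': "u0 \<noteq> 0" using u0 bilinear_lzero[OF P] by auto
  \<comment> \<open>Every plane through \<open>u0\<close> is of the definite kind, so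
    \<open>P\<close> is definite on the whole space, with the sign that it has at
    \<open>u0\<close>.\<close>
  have same_sign: "P \<xi> \<xi> * P u0 u0 > 0" if "\<xi> \<noteq> 0" for \<xi>
  proof (cases "indep u0 \<xi>")
    case True
    then have "P u0 u0 * P \<xi> \<xi> > (P u0 \<xi>)\<^sup>2" using plane[OF True] u0 by auto
    then show ?thesis using order.strict_trans1[OF zero_le_power2[of "P u0 \<xi>"]] by (simp add: mult.commute)
  next
    case False
    then obtain c where c: "\<xi> = c *\<^sub>R u0" using u0' indepI by blast
    then have "P \<xi> \<xi> * P u0 u0 = (c * P u0 u0)\<^sup>2" by (simp add: bl power2_eq_square mult_ac)
    then show ?thesis using c that u0 by simp
  qed
  have nz: "P \<xi> \<xi> \<noteq> 0" if "\<xi> \<noteq> 0" for \<xi> using same_sign[OF that] by auto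
  have sym: "P u v = P v u" if "indep u v" for u v using plane[OF that] by auto
  \<comment> \<open>For a \<open>P\<close>-orthogonal pair of equal length the curvature operator is
    \<open>P u u\<close> times the infinitesimal rotation of the plane, and the circle is its
    orbit.\<close>
  have rotate: "p (cos t *\<^sub>R u + sin t *\<^sub>R v) = p u"
    if uv: "indep u v" "P u v = 0" "P v v = P u u" for u v t
  proof -
    let ?z = "\<lambda>t. cos t *\<^sub>R u + sin t *\<^sub>R v"
    let ?T = "\<lambda>\<xi>. P u \<xi> *\<^sub>R v - P v \<xi> *\<^sub>R u + (P u v - P v u) *\<^sub>R \<xi>"
    have vu: "P v u = 0" using sym[OF uv(1)] uv(2) by simp
    have u: "u \<noteq> 0" using uv(1) unfolding indep_def by (metis add.right_neutral scaleR_one scaleR_zero_left zero_neq_one)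
    have z: "?z t \<noteq> 0" for t
    proof
      assume "?z t = 0"
      then have "cos t = 0 \<and> sin t = 0" using uv(1) unfolding indep_def by blast
      then show False using sin_cos_squared_add[of t] by simp
    qed
    have "p (?z t) = p (?z 0)"
    proof (rule constant_along_curve[OF _ z])
      show "(?z has_vector_derivative (- sin t) *\<^sub>R u + cos t *\<^sub>R v) (at t)" for t
        by (auto intro!: derivative_eq_intros)
      show "fd p (?z t) ((- sin t) *\<^sub>R u + cos t *\<^sub>R v) = 0" for t
      proof -
        have "?T (?z t) = P u u *\<^sub>R ((- sin t) *\<^sub>R u + cos t *\<^sub>R v)"
          by (simp add: bl uv vu algebra_simps)
        moreover have "fd p (?z t) (?T (?z t)) = 0" using skew_curvature[of u v] z by (simp add: skew_def)
        ultimately have "fd p (?z t) (P u u *\<^sub>R ((- sin t) *\<^sub>R u + cos t *\<^sub>R v)) = 0"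
          by (simp only:)
        then have "P u u * fd p (?z t) ((- sin t) *\<^sub>R u + cos t *\<^sub>R v) = 0"
          unfolding linear_scale[OF linear_fd[OF z]] by simp
        then show ?thesis using nz[OF u] by simp
      qed
    qed
    then show ?thesis by simp
  qed
  \<comment> \<open>Gram--Schmidt with respect to \<open>P\<close>, which may be negative definite;
    therefore lengths enter only through quotients such as \<open>P v0 v0 / P u u\<close>.\<close>
  have ortho: "\<exists>v x s. indep u v \<and> P u v = 0 \<and> P v v = P u u \<and> s > 0 \<and> w = x *\<^sub>R u + s *\<^sub>R v"
    if uw: "indep u w" for u w
  proof -
    have u: "u \<noteq> 0" using uw unfolding indep_def by (metis add.right_neutral scaleR_one scaleR_zero_left zero_neq_one)
    define x where "x = P u w / P u u"
    define v0 where "v0 = w - x *\<^sub>R u"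
    have iv0: "indep u v0"
      unfolding indep_def
    proof (intro allI impI)
      fix a b assume "a *\<^sub>R u + b *\<^sub>R v0 = 0"
      then have "(a - b * x) *\<^sub>R u + b *\<^sub>R w = 0" by (simp add: v0_def algebra_simps)
      then have "a - b * x = 0 \<and> b = 0" using uw unfolding indep_def by blast
      then show "a = 0 \<and> b = 0" by simp
    qed
    have uv0: "P u v0 = 0" using nz[OF u] by (simp add: v0_def bl x_def)
    have "P u u * P v0 v0 > 0" using plane[OF iv0] nz[OF u] uv0 by auto
    then have q: "P v0 v0 / P u u > 0" by (auto simp: zero_less_divide_iff zero_less_mult_iff)
    define s where "s = sqrt (P v0 v0 / P u u)"
    have s0: "s > 0" "s * s = P v0 v0 / P u u"
      using q real_sqrt_mult_self[of "P v0 v0 / P u u"] unfolding s_def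
      by (simp_all only: real_sqrt_gt_0_iff abs_of_pos)
    then have s: "s > 0" "s * s * P u u = P v0 v0" using nz[OF u] by simp_all
    define v where "v = (1 / s) *\<^sub>R v0"
    have "indep u v"
      unfolding indep_def
    proof (intro allI impI)
      fix a b assume "a *\<^sub>R u + b *\<^sub>R v = 0"
      then have "a *\<^sub>R u + (b / s) *\<^sub>R v0 = 0" by (simp add: v_def)
      then have "a = 0 \<and> b / s = 0" using iv0 unfolding indep_def by blast
      then show "a = 0 \<and> b = 0" using s by simp
    qed
    moreover have "P u v = 0" by (simp add: v_def bl uv0)
    moreover have "P v v = P u u" using s by (simp add: v_def bl field_simps)
    moreover have "w = x *\<^sub>R u + s *\<^sub>R v" using s by (simp add: v_def v0_def)
    ultimately show ?thesis using s(1) by blast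
  qed
  have equal: "p \<xi> = p u" if u: "u \<noteq> 0" and eq: "P \<xi> \<xi> = P u u" for \<xi> u
  proof (cases "indep u \<xi>")
    case True
    obtain v x s where v: "indep u v" "P u v = 0" "P v v = P u u" "s > 0" "\<xi> = x *\<^sub>R u + s *\<^sub>R v"
      using ortho[OF True] by blast
    have "P \<xi> \<xi> = (x * x + s * s) * P u u"
      using sym[OF v(1)] by (simp add: v(2,3,5) bl algebra_simps)
    then have "x\<^sup>2 + s\<^sup>2 = 1" using eq nz[OF u] by (simp add: power2_eq_square)
    \<comment> \<open>The coefficient \<open>s\<close> is positive, so the angle can be taken
      between \<open>0\<close> and \<open>pi\<close>.\<close>
    then obtain t where "x = cos t" "s = sin t" using sincos_total_pi[of s x] v(4) by auto
    then show ?thesis using rotate[OF v(1-3), of t] v(5) by simp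
  next
    case False
    then obtain c where c: "\<xi> = c *\<^sub>R u" using u indepI by blast
    then have "c * c = 1" using eq nz[OF u] by (simp add: bl)
    then consider "c = 1" | "c = -1" using square_eq_1_iff by blast
    then show ?thesis
    proof cases
      case 1 then show ?thesis using c by simp
    next
      case 2
      \<comment> \<open>Symmetry \<open>p (- u) = p u\<close> comes from a half turn, which requires
        a second direction; here the dimension enters.\<close>
      have "span {u} \<noteq> UNIV"
      proof
        assume "span {u} = UNIV"
        then have "dim (UNIV :: 'a set) \<le> card {u}" by (metis dim_le_card finite.emptyI finite.insertI subset_UNIV)
        then show False using dim by simp
      qed
      then obtain w where "w \<notin> span {u}" by blast
      then have "indep u w" using indepI[OF u] by (metis insertI1 span_base span_scale)
      then obtain v where v: "indep u v" "P u v = 0" "P v v = P u u" using ortho by blast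
      show ?thesis using rotate[OF v, of pi] c 2 by simp
    qed
  qed
  define C where "C = (p u0)\<^sup>2 / P u0 u0"
  have "(p \<xi>)\<^sup>2 = C * P \<xi> \<xi>" for \<xi>
  proof (cases "\<xi> = 0")
    case True then show ?thesis by (simp add: zero bilinear_lzero[OF P])
  next
    case False
    define k where "k = sqrt (P \<xi> \<xi> / P u0 u0)"
    have q: "P \<xi> \<xi> / P u0 u0 > 0" using same_sign[OF False] by (auto simp: zero_less_divide_iff zero_less_mult_iff)
    then have k: "k > 0" "k * k = P \<xi> \<xi> / P u0 u0"
      using real_sqrt_mult_self[of "P \<xi> \<xi> / P u0 u0"] unfolding k_def
      by (simp_all only: real_sqrt_gt_0_iff abs_of_pos)
    have "P \<xi> \<xi> = P (k *\<^sub>R u0) (k *\<^sub>R u0)" using k u0 by (simp add: bl mult.assoc[symmetric])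
    then have "p \<xi> = p (k *\<^sub>R u0)" using k u0' by (intro equal) auto
    then have "(p \<xi>)\<^sup>2 = (k * k) * (p u0)\<^sup>2" using hom[of k u0] k(1) by (simp add: power2_eq_square)
    then show ?thesis by (simp add: k(2) C_def)
  qed
  moreover have "bilinear (\<lambda>u v. C * P u v)"
    unfolding bilinear_def by (auto intro!: linearI simp: bl algebra_simps)
  ultimately show ?thesis by blast
qed simp

section \<open>The energy of a gauge and its Hessian\<close>

abbreviation energy :: "'a \<Rightarrow> real" where
  "energy \<equiv> \<lambda>u. (p u)\<^sup>2 / 2"

lemma smooth_energy: "smooth_on (UNIV - {0}) energy"
proof -
  have "smooth_on (UNIV - {0}) (\<lambda>u. (1 / 2) * (p u * p u))"
    by (intro smooth_on_mult smooth_on_const smooth open_punctured)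
  then show ?thesis by (simp add: power2_eq_square)
qed

lemma fd_energy_scaled:
  assumes "u \<noteq> 0" "k > 0" shows "fd energy (k *\<^sub>R u) w = k * fd energy u w"
proof -
  have D: "(energy has_derivative fd energy x) (at x)" if "x \<noteq> 0" for x
    using smooth_on_has_derivative[OF smooth_energy] that by simp
  have ku: "k *\<^sub>R u \<noteq> 0" using assms by simp
  have "((\<lambda>x. energy (k *\<^sub>R x)) has_derivative (\<lambda>w. fd energy (k *\<^sub>R u) (k *\<^sub>R w))) (at u)"
    by (rule has_derivative_compose[of "\<lambda>x. k *\<^sub>R x" _ u UNIV energy, OF _ D[OF ku]])
      (auto intro!: derivative_eq_intros)
  moreover have "(\<lambda>x. energy (k *\<^sub>R x)) = (\<lambda>x. k\<^sup>2 * energy x)"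
    using assms(2) by (simp add: hom power_mult_distrib)
  ultimately have "((\<lambda>x. k\<^sup>2 * energy x) has_derivative (\<lambda>w. fd energy (k *\<^sub>R u) (k *\<^sub>R w))) (at u)"
    by simp
  moreover have "((\<lambda>x. k\<^sup>2 * energy x) has_derivative (\<lambda>w. k\<^sup>2 * fd energy u w)) (at u)"
    by (rule has_derivative_mult_right[OF D[OF assms(1)]])
  ultimately have "(\<lambda>w. fd energy (k *\<^sub>R u) (k *\<^sub>R w)) = (\<lambda>w. k\<^sup>2 * fd energy u w)"
    by (rule has_derivative_unique)
  from fun_cong[OF this, of w] show ?thesis
    using assms(2) linear_scale[OF has_derivative_linear[OF D[OF ku]]] by (simp add: power2_eq_square)
qed

text \<open>The energy is homogeneous of degree two, so its Hessian has degree zero. This permits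
  comparing accelerations at \<open>k b\<close> instead of \<open>b\<close>, as reparametrization
  changes the length of the velocity.\<close>

lemma hessian_scaled:
  assumes u: "u \<noteq> 0" and k: "k > 0"
  shows "fd (\<lambda>x. fd energy x w) (k *\<^sub>R u) z = fd (\<lambda>x. fd energy x w) u z"
proof -
  let ?N = "\<lambda>x. fd energy x w"
  have D: "(?N has_derivative fd ?N x) (at x)" if "x \<noteq> 0" for x
    using smooth_on_has_derivative[OF smooth_on_fd[OF smooth_energy]] that by simp
  have ku: "k *\<^sub>R u \<noteq> 0" using assms by simp
  have "((\<lambda>x. ?N (k *\<^sub>R x)) has_derivative (\<lambda>z. fd ?N (k *\<^sub>R u) (k *\<^sub>R z))) (at u)"
    by (rule has_derivative_compose[of "\<lambda>x. k *\<^sub>R x" _ u UNIV ?N, OF _ D[OF ku]])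
      (auto intro!: derivative_eq_intros)
  moreover have "((\<lambda>x. k * ?N x) has_derivative (\<lambda>z. k * fd ?N u z)) (at u)"
    by (rule has_derivative_mult_right[OF D[OF u]])
  then have "((\<lambda>x. ?N (k *\<^sub>R x)) has_derivative (\<lambda>z. k * fd ?N u z)) (at u)"
    by (rule has_derivative_transform_within_open[OF _ open_punctured])
      (use u fd_energy_scaled[OF _ k] in auto)
  ultimately have "(\<lambda>z. fd ?N (k *\<^sub>R u) (k *\<^sub>R z)) = (\<lambda>z. k * fd ?N u z)"
    by (rule has_derivative_unique)
  from fun_cong[OF this, of z] show ?thesis
    using k linear_scale[OF has_derivative_linear[OF D[OF ku]]] by simp
qed

text \<open>The energy dominates a multiple \<open>m / 2\<close> of the squared Euclidean norm, with equality at the point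
  \<open>u0\<close> of the unit sphere where the gauge is least; so its Hessian at \<open>u0\<close> is at least \<open>m\<close>.\<close>

lemma hessian_positive_at_minimum:
  obtains u0 m where "u0 \<noteq> 0" "m > 0" "\<And>w. m * (norm w)\<^sup>2 \<le> fd (\<lambda>x. fd energy x w) u0 w"
proof -
  have "continuous_on (sphere 0 1) p"
    using smooth_on_continuous[OF smooth] by (rule continuous_on_subset) auto
  then obtain u0 where u0: "u0 \<in> sphere 0 1" "\<And>u. u \<in> sphere 0 1 \<Longrightarrow> p u0 \<le> p u"
    using continuous_attains_inf[of "sphere (0::'a) 1" p] by auto
  have u0n: "norm u0 = 1" "u0 \<noteq> 0" using u0(1) by auto
  define m where "m = (p u0)\<^sup>2"
  have m: "m > 0" using pos[OF u0n(2)] by (simp add: m_def)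
  have le: "m / 2 * (norm u)\<^sup>2 \<le> energy u" for u
  proof (cases "u = 0")
    case False
    have "p u0 \<le> p ((1 / norm u) *\<^sub>R u)" using False by (intro u0(2)) simp
    then have "p u0 * norm u \<le> p u" using False by (simp add: hom field_simps)
    then have "(p u0 * norm u)\<^sup>2 \<le> (p u)\<^sup>2" using pos[OF u0n(2)] by (intro power_mono) auto
    then show ?thesis by (simp add: m_def power_mult_distrib)
  qed (simp add: zero)
  have "m * (norm w)\<^sup>2 \<le> fd (\<lambda>x. fd energy x w) u0 w" for w
  proof (cases "w = 0")
    case True
    have "linear (fd (\<lambda>x. fd energy x w) u0)"
      using smooth_on_has_derivative[OF smooth_on_fd[OF smooth_energy], of u0 w] u0n(2)
      by (intro has_derivative_linear) simp
    then show ?thesis using True linear_0 by fastforce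
  next
    case False
    \<comment> \<open>Since \<open>u0\<close> has norm 1, for \<open>\<bar>t\<bar> < e\<close> the
      line stays away from the origin, where the energy need not be smooth.\<close>
    define e where "e = 1 / norm w"
    have e: "e > 0" using False by (simp add: e_def)
    have nz: "u0 + t *\<^sub>R w \<noteq> 0" if "\<bar>t\<bar> < e" for t
    proof
      assume "u0 + t *\<^sub>R w = 0"
      then have "norm u0 = norm (t *\<^sub>R w)" by (metis add_eq_0_iff norm_minus_cancel)
      then have "1 = \<bar>t\<bar> * norm w" using u0n by simp
      then show False using that False by (simp add: e_def field_simps)
    qed
    \<comment> \<open>The excess of the energy over \<open>m / 2\<close> times the squared norm
      along the line; it is nonnegative and vanishes at \<open>0\<close>, so its second derivative
      there cannot be negative.\<close>
    define \<phi> where "\<phi> t = energy (u0 + t *\<^sub>R w) - m / 2 * (1 + 2 * t * (u0 \<bullet> w) + t\<^sup>2 * (norm w)\<^sup>2)" for t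
    define \<phi>' where "\<phi>' t = fd energy (u0 + t *\<^sub>R w) w - m / 2 * (2 * (u0 \<bullet> w) + 2 * t * (norm w)\<^sup>2)" for t
    have nsq: "(norm (u0 + t *\<^sub>R w))\<^sup>2 = 1 + 2 * t * (u0 \<bullet> w) + t\<^sup>2 * (norm w)\<^sup>2" for t
    proof -
      have "u0 \<bullet> u0 = 1" using u0n(1) by (simp add: norm_eq_1)
      then show ?thesis
        unfolding power2_norm_eq_inner
        by (simp add: inner_add_left inner_add_right inner_commute[of w u0] power2_eq_square algebra_simps)
    qed
    have \<phi>_ge: "\<phi> t \<ge> 0" for t using le[of "u0 + t *\<^sub>R w"] by (simp add: \<phi>_def nsq)
    have \<phi>_0: "\<phi> 0 = 0" by (simp add: \<phi>_def m_def)
    have line: "((\<lambda>t. g (u0 + t *\<^sub>R w)) has_real_derivative fd g (u0 + t *\<^sub>R w) w) (at t)"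
      if "\<bar>t\<bar> < e" "smooth_on (UNIV - {0}) g" for g t
    proof -
      have D: "(g has_derivative fd g (u0 + t *\<^sub>R w)) (at (u0 + t *\<^sub>R w))"
        using smooth_on_has_derivative[OF that(2)] nz[OF that(1)] by simp
      have "((\<lambda>t. g (u0 + t *\<^sub>R w)) has_derivative (\<lambda>h. fd g (u0 + t *\<^sub>R w) (h *\<^sub>R w))) (at t)"
        by (rule has_derivative_compose[of "\<lambda>t. u0 + t *\<^sub>R w" _ t UNIV g, OF _ D])
          (auto intro!: derivative_eq_intros)
      then show ?thesis
        using linear_scale[OF has_derivative_linear[OF D]] by (simp add: has_field_derivative_def mult_commute_abs)
    qed
    have d1: "(\<phi> has_real_derivative \<phi>' t) (at t)" if "\<bar>t\<bar> < e" for t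
      unfolding \<phi>_def \<phi>'_def
      by (rule DERIV_diff[OF line[OF that smooth_energy]]) (auto intro!: derivative_eq_intros)
    have d2: "(\<phi>' has_real_derivative fd (\<lambda>x. fd energy x w) u0 w - m * (norm w)\<^sup>2) (at 0)"
    proof -
      have "((\<lambda>t. fd energy (u0 + t *\<^sub>R w) w) has_real_derivative fd (\<lambda>x. fd energy x w) u0 w) (at 0)"
        using line[of 0 "\<lambda>x. fd energy x w", OF _ smooth_on_fd[OF smooth_energy]] e by simp
      then show ?thesis unfolding \<phi>'_def
        by (rule DERIV_diff) (auto intro!: derivative_eq_intros)
    qed
    have "\<phi>' 0 = 0"
      by (rule DERIV_local_min[OF d1[of 0] e]) (use e \<phi>_ge \<phi>_0 in auto)
    show ?thesis
    proof (rule ccontr)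
      assume "\<not> ?thesis"
      \<comment> \<open>Otherwise \<open>\<phi>'\<close> would be negative just to the right of
        \<open>0\<close>, and by the mean value theorem so would \<open>\<phi>\<close>.\<close>
      then have "fd (\<lambda>x. fd energy x w) u0 w - m * (norm w)\<^sup>2 < 0" by simp
      from DERIV_neg_dec_right[OF d2 this] obtain d where d: "d > 0" "\<And>h. 0 < h \<Longrightarrow> h < d \<Longrightarrow> \<phi>' h < 0"
        using \<open>\<phi>' 0 = 0\<close> by auto
      define h where "h = min d e / 2"
      have h: "h > 0" "h < d" "h < e" using d(1) e by (auto simp: h_def)
      have "\<exists>z>0. z < h \<and> \<phi> h - \<phi> 0 = (h - 0) * \<phi>' z"
        by (rule MVT2[OF h(1)], rule d1) (use h in auto)
      then obtain z where z: "z > 0" "z < h" "\<phi> h = h * \<phi>' z" using \<phi>_0 by auto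
      have "\<phi> h < 0" using z d(2)[of z] h by (simp add: mult_pos_neg)
      then show False using \<phi>_ge[of h] by simp
    qed
  qed
  then show thesis using that u0n(2) m by blast
qed

text \<open>Positivity at the minimum persists for nearby directions because the entries of the
  Hessian are continuous, and for positive multiples because the Hessian is homogeneous of degree
  zero.\<close>

lemma hessian_nondegenerate:
  obtains N u0 where "open N" "u0 \<in> N" "0 \<notin> N"
    "\<And>u k z. u \<in> N \<Longrightarrow> k > 0 \<Longrightarrow> (\<And>w. fd (\<lambda>x. fd energy x w) (k *\<^sub>R u) z = 0) \<Longrightarrow> z = 0"
proof -
  obtain u0 m where u0: "u0 \<noteq> 0" "m > 0" "\<And>w. m * (norm w)\<^sup>2 \<le> fd (\<lambda>x. fd energy x w) u0 w"
    using hessian_positive_at_minimum by blast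
  define H where "H u w z = fd (\<lambda>x. fd energy x w) u z" for u w z
  have Hs: "smooth_on (UNIV - {0}) (\<lambda>u. H u w z)" for w z
    unfolding H_def by (intro smooth_on_fd smooth_energy)
  have Hz: "linear (H u w)" if "u \<noteq> 0" for u w
  proof -
    have "((\<lambda>x. fd energy x w) has_derivative H u w) (at u)"
      unfolding H_def[abs_def]
      by (rule smooth_on_has_derivative[OF smooth_on_fd[OF smooth_energy]]) (use that in simp)
    then show ?thesis by (rule has_derivative_linear)
  qed
  have Hc: "H u w z = H u z w" if "u \<noteq> 0" for u w z
    unfolding H_def by (rule fd_fd_commute[OF open_punctured smooth_energy]) (use that in simp)
  have Hb: "bilinear (H u)" if "u \<noteq> 0" for u
  proof -
    have "(\<lambda>w. H u w z) = H u z" for z using Hc[OF that] by auto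
    then show ?thesis unfolding bilinear_def using Hz[OF that] by simp
  qed
  \<comment> \<open>An error \<open>e\<close> in each matrix entry changes the quadratic form by at
    most \<open>m / 2\<close> times the squared norm, half of the lower bound at
    \<open>u0\<close>.\<close>
  define e where "e = m / (2 * real (card (Basis \<times> Basis :: ('a \<times> 'a) set)))"
  have card: "card (Basis \<times> Basis :: ('a \<times> 'a) set) > 0" by (simp add: card_cartesian_product)
  have e: "e > 0" using u0(2) card by (simp add: e_def)
  define N where "N = (UNIV - {0}) \<inter> (\<Inter>a\<in>Basis \<times> Basis. {u \<in> UNIV - {0}. \<bar>H u (fst a) (snd a) - H u0 (fst a) (snd a)\<bar> < e})"
  have op: "open {u \<in> UNIV - {0}. \<bar>H u b b' - H u0 b b'\<bar> < e}" for b b'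
  proof -
    have "continuous_on (UNIV - {0}) (\<lambda>u. \<bar>H u b b' - H u0 b b'\<bar>)"
      using smooth_on_continuous[OF Hs[of b b']] by (intro continuous_intros)
    from continuous_open_preimage[OF this open_punctured open_lessThan[of e]]
    show ?thesis by (simp add: Int_def vimage_def)
  qed
  have 1: "open N"
    unfolding N_def by (intro open_Int open_punctured open_INT ballI op) simp
  have 2: "u0 \<in> N" using u0(1) e by (simp add: N_def)
  have 3: "z = 0" if u: "u \<in> N" and k: "k > 0" and 0: "\<And>w. fd (\<lambda>x. fd energy x w) (k *\<^sub>R u) z = 0" for u k z
  proof -
    have nz: "u \<noteq> 0" using u by (simp add: N_def)
    have "H u z z = 0" using 0[of z] hessian_scaled[OF nz k] by (simp add: H_def)
    have bnd: "norm (H u z z - H u0 z z) \<le> (\<Sum>(b :: 'a, b' :: 'a)\<in>Basis \<times> Basis. e) * (norm z * norm z)"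
    proof (rule bilinear_norm_le_basis[OF bilinear_diff_family[OF Hb[OF nz] Hb[OF u0(1)]]])
      fix b b' :: 'a assume "b \<in> Basis" "b' \<in> Basis"
      then have "u \<in> {u \<in> UNIV - {0}. \<bar>H u (fst (b, b')) (snd (b, b')) - H u0 (fst (b, b')) (snd (b, b'))\<bar> < e}"
        using u unfolding N_def by blast
      then show "norm (H u b b' - H u0 b b') \<le> e" by simp
    qed
    have "(\<Sum>(b :: 'a, b' :: 'a)\<in>Basis \<times> Basis. e) = real (card (Basis \<times> Basis :: ('a \<times> 'a) set)) * e"
      by (simp only: case_prod_unfold sum_constant)
    also have "\<dots> = m / 2" using card by (simp only: e_def) (simp add: field_simps)
    finally have "norm (H u z z - H u0 z z) \<le> m / 2 * (norm z)\<^sup>2" using bnd by (simp only: power2_eq_square)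
    then have "H u0 z z \<le> m / 2 * (norm z)\<^sup>2" using \<open>H u z z = 0\<close> by (simp add: abs_le_iff)
    moreover have "m * (norm z)\<^sup>2 \<le> H u0 z z" unfolding H_def by (rule u0(3))
    ultimately have "m / 2 * (norm z)\<^sup>2 \<le> 0" by simp
    then show "z = 0" using u0(2) by (simp add: mult_le_0_iff)
  qed
  show thesis
    by (rule that[of N u0, OF 1 2 _ 3]) (simp_all add: N_def)
qed

end

section \<open>Projectively trivial deformations\<close>

text \<open>Polynomials in \<open>t\<close> that agree on an interval agree everywhere, in
  particular at \<open>t = 1\<close>.\<close>

lemma cubic_identity:
  fixes a0 a1 a2 b0 b1 c0 c1 c2 d0 d1 :: real
  assumes "\<delta> > 0" and "\<And>t. \<bar>t\<bar> < \<delta> \<Longrightarrow>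
    (a0 + t * a1 + t\<^sup>2 * a2) * (b0 + t * b1) = (c0 + t * c1 + t\<^sup>2 * c2) * (d0 + t * d1)"
  shows "(a0 + a1 + a2) * (b0 + b1) = (c0 + c1 + c2) * (d0 + d1)"
proof -
  define q where "q = [:a0, a1, a2:] * [:b0, b1:] - [:c0, c1, c2:] * [:d0, d1:]"
  have q: "poly q t = (a0 + t * a1 + t\<^sup>2 * a2) * (b0 + t * b1) - (c0 + t * c1 + t\<^sup>2 * c2) * (d0 + t * d1)" for t
    by (simp add: q_def algebra_simps power2_eq_square)
  have "{-\<delta><..<\<delta>} \<subseteq> {t. poly q t = 0}" unfolding q using assms(2) by (auto simp: abs_less_iff)
  moreover have "infinite {-\<delta><..<\<delta>}" using assms(1) by simp
  ultimately have "infinite {t. poly q t = 0}" using finite_subset by blast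
  then have "q = 0" using poly_roots_finite by blast
  then show ?thesis using q[of 1] by simp
qed

text \<open>Proportionality of \<open>D u u\<close> and \<open>u\<close> is the vanishing of all two
  by two minors, which are cubic in \<open>u\<close>. On the line from \<open>u0\<close> to
  \<open>u\<close> they are polynomials in the parameter that vanish near \<open>0\<close>, hence
  also at the end point.\<close>

lemma quadratic_eigen_everywhere:
  fixes D :: "'a::euclidean_space \<Rightarrow> 'a \<Rightarrow> 'a"
  assumes D: "bilinear D" and N: "open N" "u0 \<in> N" and eig: "\<And>u. u \<in> N \<Longrightarrow> \<exists>c. D u u = c *\<^sub>R u"
  shows "\<exists>c. D u u = c *\<^sub>R u"
proof (cases "u = 0")
  case True then show ?thesis using bilinear_lzero[OF D] by simp
next
  case False
  define d where "d = u - u0"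
  obtain \<epsilon> where \<epsilon>: "\<epsilon> > 0" "ball u0 \<epsilon> \<subseteq> N" using N openE by blast
  define \<delta> where "\<delta> = \<epsilon> / (norm d + 1)"
  have d1: "norm d + 1 > 0" using norm_ge_zero[of d] by linarith
  have \<delta>: "\<delta> > 0" using \<epsilon> d1 by (simp add: \<delta>_def)
  have cross: "(D u u \<bullet> i) * (u \<bullet> j) = (D u u \<bullet> j) * (u \<bullet> i)" for i j
  proof -
    let ?x = "\<lambda>t. u0 + t *\<^sub>R d"
    have Dx: "D (?x t) (?x t) \<bullet> i = D u0 u0 \<bullet> i + t * ((D u0 d + D d u0) \<bullet> i) + t\<^sup>2 * (D d d \<bullet> i)" for t i
      by (simp add: bilinear_ladd[OF D] bilinear_radd[OF D] bilinear_lmul[OF D] bilinear_rmul[OF D]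
          inner_add_left power2_eq_square algebra_simps)
    have xi: "?x t \<bullet> i = u0 \<bullet> i + t * (d \<bullet> i)" for t i by (simp add: inner_add_left)
    have *: "(D (?x t) (?x t) \<bullet> i) * (?x t \<bullet> j) = (D (?x t) (?x t) \<bullet> j) * (?x t \<bullet> i)" if "\<bar>t\<bar> < \<delta>" for t
    proof -
      have "\<bar>t\<bar> * norm d \<le> \<delta> * norm d" using that by (intro mult_right_mono) auto
      also have "\<dots> < \<delta> * (norm d + 1)" using \<delta> by (simp add: algebra_simps)
      also have "\<dots> = \<epsilon>" using d1 by (simp add: \<delta>_def)
      finally have "?x t \<in> N" using \<epsilon>(2) by (auto simp: dist_norm)
      then obtain c where "D (?x t) (?x t) = c *\<^sub>R ?x t" using eig by blast
      then show ?thesis by simp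
    qed
    have "(D u0 u0 \<bullet> i + (D u0 d + D d u0) \<bullet> i + D d d \<bullet> i) * (u0 \<bullet> j + d \<bullet> j)
      = (D u0 u0 \<bullet> j + (D u0 d + D d u0) \<bullet> j + D d d \<bullet> j) * (u0 \<bullet> i + d \<bullet> i)"
      by (rule cubic_identity[OF \<delta>]) (use * in \<open>simp only: Dx xi\<close>)
    then show ?thesis using Dx[of 1] xi[of 1] by (simp add: d_def)
  qed
  obtain j where j: "j \<in> Basis" "u \<bullet> j \<noteq> 0" using False euclidean_all_zero_iff by blast
  have "D u u = ((D u u \<bullet> j) / (u \<bullet> j)) *\<^sub>R u"
    by (rule euclidean_eqI) (use cross[of _ j] j(2) in \<open>simp add: field_simps\<close>)
  then show ?thesis by blast
qed

text \<open>The eigenvector conditions at \<open>i\<close>, \<open>i + j\<close> and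
  \<open>i - j\<close> for orthonormal \<open>i\<close>, \<open>j\<close> determine \<open>D\<close>
  by polarization. An explicit formula for \<open>\<phi>\<close> is carried along because its smooth
  dependence on the base point is used when curvatures are compared.\<close>

lemma projective_deformation:
  fixes D :: "'a::euclidean_space \<Rightarrow> 'a \<Rightarrow> 'a"
  assumes D: "bilinear D" and sym: "\<And>u v. D u v = D v u" and eig: "\<And>u. \<exists>c. D u u = c *\<^sub>R u"
    and \<phi>: "\<And>u. \<phi> u = (\<Sum>i\<in>Basis. (u \<bullet> i) * (D i i \<bullet> i)) / 2"
  shows "D u v = \<phi> u *\<^sub>R v + \<phi> v *\<^sub>R u"
proof -
  note bl = bilinear_ladd[OF D] bilinear_radd[OF D] bilinear_lsub[OF D] bilinear_rsub[OF D]
  have \<phi>i: "\<phi> i = (D i i \<bullet> i) / 2" if "i \<in> Basis" for i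
  proof -
    have "(\<Sum>j\<in>Basis. (i \<bullet> j) * (D j j \<bullet> j)) = (\<Sum>j\<in>Basis. if j = i then D i i \<bullet> i else 0)"
      using that by (intro sum.cong) (auto simp: inner_Basis)
    then show ?thesis using that by (simp add: \<phi>)
  qed
  have diag: "D i i = (2 * \<phi> i) *\<^sub>R i" if i: "i \<in> Basis" for i
  proof -
    obtain c where c: "D i i = c *\<^sub>R i" using eig by blast
    then have "D i i \<bullet> i = c" by (simp add: inner_same_Basis[OF i])
    then have "c = 2 * \<phi> i" using \<phi>i[OF i] by simp
    then show ?thesis using c by simp
  qed
  have basis: "D i j = \<phi> i *\<^sub>R j + \<phi> j *\<^sub>R i" if ij: "i \<in> Basis" "j \<in> Basis" for i j
  proof (cases "i = j")
    case True then show ?thesis using diag[OF ij(1)] by (simp add: scaleR_add_left[symmetric])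
  next
    case False
    have ort: "i \<bullet> j = 0" "j \<bullet> i = 0" "i \<bullet> i = 1" "j \<bullet> j = 1" using ij False by (auto simp: inner_Basis)
    \<comment> \<open>Comparing the components along \<open>i\<close> and \<open>j\<close> in this
      relation and the next gives four linear equations, which force
      \<open>\<mu> = 2 * \<phi> i + 2 * \<phi> j\<close>.\<close>
    obtain \<mu> where \<mu>: "D (i + j) (i + j) = \<mu> *\<^sub>R (i + j)" using eig by blast
    obtain \<nu> where \<nu>: "D (i - j) (i - j) = \<nu> *\<^sub>R (i - j)" using eig by blast
    have p: "D (i + j) (i + j) = D i i + D j j + 2 *\<^sub>R D i j" by (simp add: bl sym[of j i] scaleR_2)
    have m: "D (i - j) (i - j) = D i i + D j j - 2 *\<^sub>R D i j" by (simp add: bl sym[of j i] scaleR_2)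
    have 1: "(2 * \<phi> i) *\<^sub>R i + (2 * \<phi> j) *\<^sub>R j + 2 *\<^sub>R D i j = \<mu> *\<^sub>R (i + j)"
      using \<mu> p diag ij by simp
    have 2: "(2 * \<phi> i) *\<^sub>R i + (2 * \<phi> j) *\<^sub>R j - 2 *\<^sub>R D i j = \<nu> *\<^sub>R (i - j)"
      using \<nu> m diag ij by simp
    have i1: "2 * \<phi> i + 2 * (D i j \<bullet> i) = \<mu>" and j1: "2 * \<phi> j + 2 * (D i j \<bullet> j) = \<mu>"
      using arg_cong[OF 1, of "\<lambda>x. x \<bullet> i"] arg_cong[OF 1, of "\<lambda>x. x \<bullet> j"] by (simp_all add: inner_add_left ort)
    have i2: "2 * \<phi> i - 2 * (D i j \<bullet> i) = \<nu>" and j2: "2 * \<phi> j - 2 * (D i j \<bullet> j) = - \<nu>"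
      using arg_cong[OF 2, of "\<lambda>x. x \<bullet> i"] arg_cong[OF 2, of "\<lambda>x. x \<bullet> j"]
      by (simp_all add: inner_add_left inner_diff_left ort)
    have \<mu>\<nu>: "\<mu> = 2 * \<phi> i + 2 * \<phi> j" using i1 j1 i2 j2 by linarith
    have "2 *\<^sub>R D i j = \<mu> *\<^sub>R (i + j) - (2 * \<phi> i) *\<^sub>R i - (2 * \<phi> j) *\<^sub>R j"
      using 1 by (simp add: algebra_simps)
    also have "\<dots> = 2 *\<^sub>R (\<phi> i *\<^sub>R j + \<phi> j *\<^sub>R i)"
      unfolding \<mu>\<nu> by (simp add: algebra_simps)
    finally show ?thesis by simp
  qed
  have lin\<phi>: "linear \<phi>"
    by (rule linearI) (simp_all add: \<phi> inner_add_left distrib_right sum.distrib add_divide_distrib sum_distrib_left mult.assoc)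
  define D' where "D' u v = \<phi> u *\<^sub>R v + \<phi> v *\<^sub>R u" for u v
  have D': "bilinear D'"
    unfolding bilinear_def D'_def
    by (auto intro!: linearI simp: linear_add[OF lin\<phi>] linear_scale[OF lin\<phi>] algebra_simps)
  have "D u v = (\<Sum>(b, b')\<in>Basis \<times> Basis. ((u \<bullet> b) * (v \<bullet> b')) *\<^sub>R D b b')"
    by (rule bilinear_basis_sum[OF D])
  also have "\<dots> = (\<Sum>(b, b')\<in>Basis \<times> Basis. ((u \<bullet> b) * (v \<bullet> b')) *\<^sub>R D' b b')"
    using basis by (intro sum.cong) (auto simp: D'_def)
  also have "\<dots> = D' u v" by (rule bilinear_basis_sum[OF D', symmetric])
  finally show ?thesis by (simp add: D'_def)
qed

section \<open>Berwald metrics in a chart\<close>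

text \<open>The real factor \<open>s\<close> is a dummy that turns the linear family
  \<open>fd f q\<close> into a bilinear one; with \<open>s = 1\<close> the product rule for bilinear
  families differentiates \<open>fd f\<close> along a moving point and direction.\<close>

lemma smooth_bilinear_fd:
  fixes f :: "'a::euclidean_space \<Rightarrow> 'b::real_normed_vector"
  assumes "open W" "smooth_on W f"
  shows "smooth_bilinear W (\<lambda>q h (s::real). s *\<^sub>R fd f q h)"
  unfolding smooth_bilinear_def
proof (intro conjI ballI allI assms(1))
  show "bilinear (\<lambda>h (s::real). s *\<^sub>R fd f q h)" if "q \<in> W" for q
  proof -
    interpret linear "fd f q" by (rule has_derivative_linear[OF smooth_on_has_derivative[OF assms(2) that]])
    show ?thesis unfolding bilinear_def
      by (auto intro!: linearI simp: add scale scaleR_add_left scaleR_add_right)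
  qed
  show "smooth_on W (\<lambda>q. s *\<^sub>R fd f q h)" for h and s :: real
    by (intro smooth_on_scaleR smooth_on_const smooth_on_fd assms)
qed

lemma has_derivative_fd_along:
  fixes f :: "'a::euclidean_space \<Rightarrow> 'b::real_normed_vector" and p :: "'e::real_normed_vector \<Rightarrow> 'a"
  assumes "open W" "smooth_on W f" "p x \<in> W"
    and "(p has_derivative p') (at x)" "(h has_derivative h') (at x)"
  shows "((\<lambda>x. fd f (p x) (h x)) has_derivative
    (\<lambda>v. fd (\<lambda>q. fd f q (h x)) (p x) (p' v) + fd f (p x) (h' v))) (at x)"
  using has_derivative_bilinear_family[OF smooth_bilinear_fd[OF assms(1,2)] assms(3) UNIV_I assms(4,5),
      of "\<lambda>_. 1" "\<lambda>_. 0"] by simp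

lemma fd_slice:
  fixes f :: "'a::real_normed_vector \<times> 'b::real_normed_vector \<Rightarrow> 'c::real_normed_vector"
  assumes "f differentiable (at (y, u))"
  shows "fd (\<lambda>u. f (y, u)) u z = fd f (y, u) (0, z)"
proof -
  have "((\<lambda>u. f (y, u)) has_derivative (\<lambda>z. fd f (y, u) (0, z))) (at u)"
    by (rule has_derivative_compose[of "\<lambda>u. (y, u)" "\<lambda>z. (0, z)" u UNIV f])
      (use assms in \<open>auto simp: frechet_derivative_works intro!: derivative_eq_intros\<close>)
  from fd_eq[OF this] show ?thesis by simp
qed

lemma fd_eq_0_if_constant:
  assumes "open W" "q \<in> W" "\<And>q. q \<in> W \<Longrightarrow> K q = c" "(K has_derivative K') (at q)"
  shows "K' X = 0"
proof -
  have "((\<lambda>_. c) has_derivative K') (at q)"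
    by (rule has_derivative_transform_within_open[OF assms(4,1,2)]) (rule assms(3))
  from has_derivative_unique[OF this has_derivative_const] show ?thesis by simp
qed

section \<open>Horizontal fields, their brackets and the Euler--Lagrange equations\<close>

definition curv :: "('a::euclidean_space \<Rightarrow> 'a \<Rightarrow> 'a \<Rightarrow> 'a) \<Rightarrow> 'a \<Rightarrow> 'a \<Rightarrow> 'a \<Rightarrow> 'a \<Rightarrow> 'a" where
  "curv \<Gamma> y u v w = fd (\<lambda>z. \<Gamma> z v w) y u - fd (\<lambda>z. \<Gamma> z u w) y v
     + \<Gamma> y u (\<Gamma> y v w) - \<Gamma> y v (\<Gamma> y u w)"

text \<open>Functions on \<open>U \<times> (UNIV - {0})\<close> that are constant along the horizontal vector fields
  \<open>(v, - \<Gamma> v u)\<close>; commutators of these fields are the vertical fields given by the curvature.\<close>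

locale horizontally_constant =
  fixes U :: "'a::euclidean_space set" and \<Gamma> :: "'a \<Rightarrow> 'a \<Rightarrow> 'a \<Rightarrow> 'a" and f :: "'a \<times> 'a \<Rightarrow> real"
  assumes \<Gamma>: "smooth_bilinear U \<Gamma>"
    and sym: "y \<in> U \<Longrightarrow> \<Gamma> y u v = \<Gamma> y v u"
    and smooth_f: "smooth_on (U \<times> (UNIV - {0})) f"
    and horizontal: "y \<in> U \<Longrightarrow> u \<noteq> 0 \<Longrightarrow> fd f (y, u) (v, - \<Gamma> y v u) = 0"
begin

lemma open_U: "open U" by (rule smooth_bilinearD(1)[OF \<Gamma>])

lemma open_W: "open (U \<times> (UNIV - {0::'a}))"
  by (intro open_Times open_U) (simp add: open_Diff)

lemma linear_fd: "y \<in> U \<Longrightarrow> u \<noteq> 0 \<Longrightarrow> linear (fd f (y, u))"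
  by (rule has_derivative_linear[OF smooth_on_has_derivative[OF smooth_f]]) simp

text \<open>The identity \<open>horizontal\<close> is differentiated in an arbitrary direction
  \<open>X\<close>: the first term differentiates \<open>fd f\<close> with the field frozen, the
  second one the field. Horizontal \<open>X\<close> leads to the curvature, vertical
  \<open>X\<close> to the Euler--Lagrange equations.\<close>

lemma horizontal_derivative:
  assumes y: "y \<in> U" "u \<noteq> 0"
  shows "fd (\<lambda>q. fd f q (v, - \<Gamma> y v u)) (y, u) X
    + fd f (y, u) (0, - (fd (\<lambda>z. \<Gamma> z v u) y (fst X) + \<Gamma> y v (snd X))) = 0"
proof -
  have "((\<lambda>q. \<Gamma> (fst q) v (snd q)) has_derivative
     (\<lambda>X. fd (\<lambda>z. \<Gamma> z v (snd (y, u))) (fst (y, u)) (fst X) + \<Gamma> (fst (y, u)) 0 (snd (y, u))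
        + \<Gamma> (fst (y, u)) v (snd X))) (at (y, u))"
  proof (rule has_derivative_bilinear_family[OF \<Gamma>, of fst "(y, u)" UNIV fst "\<lambda>_. v" "\<lambda>_. 0" snd snd])
    show "(fst has_derivative fst) (at (y, u))" "(snd has_derivative snd) (at (y, u))"
      by (intro bounded_linear_imp_has_derivative bounded_linear_fst bounded_linear_snd)+
  qed (use y in auto)
  then have 1: "((\<lambda>q. \<Gamma> (fst q) v (snd q)) has_derivative
     (\<lambda>X. fd (\<lambda>z. \<Gamma> z v u) y (fst X) + \<Gamma> y v (snd X))) (at (y, u))"
    by (simp add: bilinear_lzero[OF smooth_bilinearD(2)[OF \<Gamma> y(1)]])
  have 2: "((\<lambda>q. (v, - \<Gamma> (fst q) v (snd q))) has_derivative
     (\<lambda>X. (0, - (fd (\<lambda>z. \<Gamma> z v u) y (fst X) + \<Gamma> y v (snd X))))) (at (y, u))"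
    by (intro has_derivative_Pair has_derivative_const has_derivative_minus 1)
  have yW: "(y, u) \<in> U \<times> (UNIV - {0})" using y by simp
  have "((\<lambda>q. fd f q (v, - \<Gamma> (fst q) v (snd q))) has_derivative
    (\<lambda>X. fd (\<lambda>q. fd f q (v, - \<Gamma> (fst (y, u)) v (snd (y, u)))) (y, u) X
      + fd f (y, u) (0, - (fd (\<lambda>z. \<Gamma> z v u) y (fst X) + \<Gamma> y v (snd X))))) (at (y, u))"
    by (rule has_derivative_fd_along[OF open_W smooth_f, of "\<lambda>q. q" "(y, u)" "\<lambda>X. X", OF yW has_derivative_ident 2])
  from fd_eq_0_if_constant[OF open_W yW _ this, of 0 X] show ?thesis
    using horizontal by auto
qed

text \<open>Second derivatives of \<open>f\<close> along two frozen fields commute, so the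
  difference of two instances of \<open>horizontal_derivative\<close> leaves \<open>fd f\<close> on
  the bracket of the fields, which is vertical.\<close>

lemma curvature_vertical:
  assumes y: "y \<in> U" "\<xi> \<noteq> 0"
  shows "fd f (y, \<xi>) (0, curv \<Gamma> y u v \<xi>) = 0"
proof -
  interpret L: linear "fd f (y, \<xi>)" by (rule linear_fd[OF y])
  let ?X = "\<lambda>u. (u, - \<Gamma> y u \<xi>)"
  note neg = bilinear_rneg[OF smooth_bilinearD(2)[OF \<Gamma> y(1)]]
  have "fd (\<lambda>q. fd f q (?X v)) (y, \<xi>) (?X u) = fd (\<lambda>q. fd f q (?X u)) (y, \<xi>) (?X v)"
    by (rule fd_fd_commute[OF open_W smooth_f]) (use y in simp)
  moreover have "fd (\<lambda>q. fd f q (?X v)) (y, \<xi>) (?X u)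
    = - fd f (y, \<xi>) (0, - (fd (\<lambda>z. \<Gamma> z v \<xi>) y u - \<Gamma> y v (\<Gamma> y u \<xi>)))" for u v
    using horizontal_derivative[OF y, of v "?X u"] by (simp add: neg)
  ultimately have "fd f (y, \<xi>) (0, - (fd (\<lambda>z. \<Gamma> z u \<xi>) y v - \<Gamma> y u (\<Gamma> y v \<xi>)))
    - fd f (y, \<xi>) (0, - (fd (\<lambda>z. \<Gamma> z v \<xi>) y u - \<Gamma> y v (\<Gamma> y u \<xi>))) = 0" by simp
  then show ?thesis by (simp add: L.diff[symmetric] curv_def algebra_simps)
qed

text \<open>Geodesics of \<open>\<Gamma>\<close> solve the Euler--Lagrange equations of \<open>f\<close>.\<close>

lemma euler_lagrange:
  assumes y: "y \<in> U" "u \<noteq> 0"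
  shows "fd (\<lambda>q. fd f q (0, w)) (y, u) (u, - \<Gamma> y u u) = fd f (y, u) (w, 0)"
proof -
  interpret L: linear "fd f (y, u)" by (rule linear_fd[OF y])
  have 0: "fd (\<lambda>z. \<Gamma> z u u) y 0 = 0"
    by (rule linear_0[OF has_derivative_linear[OF smooth_on_has_derivative[OF smooth_bilinearD(3)[OF \<Gamma>] y(1)]]])
  have "fd (\<lambda>q. fd f q (0, w)) (y, u) (u, - \<Gamma> y u u) = fd (\<lambda>q. fd f q (u, - \<Gamma> y u u)) (y, u) (0, w)"
    by (rule fd_fd_commute[OF open_W smooth_f]) (use y in simp)
  also have "\<dots> = - fd f (y, u) (0, - \<Gamma> y u w)"
    using horizontal_derivative[OF y, of u "(0, w)"] by (simp add: 0)
  \<comment> \<open>Torsion-freeness turns the fibre derivative of the horizontal field of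
    \<open>u\<close> into the vertical part of the horizontal lift of \<open>w\<close>.\<close>
  also have "\<dots> = - fd f (y, u) (0, - \<Gamma> y w u)" by (simp add: sym[OF y(1), of u w])
  also have "\<dots> = fd f (y, u) (w, 0)"
    using horizontal[OF y, of w] L.add[of "(w, 0)" "(0, - \<Gamma> y w u)"] by simp
  finally show ?thesis .
qed

end

section \<open>Projective change of the connection and the curvature alternative in a chart\<close>

locale berwald_chart = horizontally_constant U \<Gamma> \<Phi>
  for U :: "'a::euclidean_space set" and \<Gamma> :: "'a \<Rightarrow> 'a \<Rightarrow> 'a \<Rightarrow> 'a" and \<Phi> :: "'a \<times> 'a \<Rightarrow> real" +
  assumes gauge: "y \<in> U \<Longrightarrow> smooth_gauge (\<lambda>u. \<Phi> (y, u))"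
begin

abbreviation Lag :: "'a \<times> 'a \<Rightarrow> real" where "Lag \<equiv> \<lambda>q. (\<Phi> q)\<^sup>2 / 2"

lemma smooth_Lag: "smooth_on (U \<times> (UNIV - {0})) Lag"
proof -
  have "smooth_on (U \<times> (UNIV - {0})) (\<lambda>q. (1 / 2) * (\<Phi> q * \<Phi> q))"
    by (intro smooth_on_mult smooth_on_const smooth_f open_W)
  then show ?thesis by (simp add: power2_eq_square)
qed

lemma horizontally_constant_Lag: "horizontally_constant U \<Gamma> Lag"
proof (unfold_locales)
  fix y u v assume y: "y \<in> U" "u \<noteq> (0::'a)"
  have "(\<Phi> has_derivative fd \<Phi> (y, u)) (at (y, u))"
    by (rule smooth_on_has_derivative[OF smooth_f]) (use y in simp)
  then have "(Lag has_derivative (\<lambda>X. \<Phi> (y, u) * fd \<Phi> (y, u) X)) (at (y, u))"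
    by (auto intro!: derivative_eq_intros simp: power2_eq_square)
  from fd_eq[OF this] show "fd Lag (y, u) (v, - \<Gamma> y v u) = 0" by (simp add: horizontal[OF y])
qed (use \<Gamma> sym smooth_Lag in auto)

text \<open>At the same position and velocity \<open>k b\<close> both
  \<open>- k\<^sup>2 \<Gamma> b b\<close> and the acceleration in \<open>EL\<close> solve the
  Euler--Lagrange equations, which are affine in the acceleration with the fibre Hessian as linear
  part. Where the Hessian is nondegenerate they coincide; the conclusion then spreads to all
  directions by \<open>quadratic_eigen_everywhere\<close>.\<close>

lemma projective_change:
  fixes \<Gamma>' :: "'a \<Rightarrow> 'a \<Rightarrow> 'a"
  assumes y: "y \<in> U" and \<Gamma>': "bilinear \<Gamma>'" "\<And>u v. \<Gamma>' u v = \<Gamma>' v u"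
    and EL: "\<And>b. b \<noteq> 0 \<Longrightarrow> \<exists>k>0. \<exists>a. \<forall>w.
      fd (\<lambda>q. fd Lag q (0, w)) (y, k *\<^sub>R b) (k *\<^sub>R b, a *\<^sub>R b - k\<^sup>2 *\<^sub>R \<Gamma>' b b) = fd Lag (y, k *\<^sub>R b) (w, 0)"
  shows "\<exists>c. \<Gamma> y u u - \<Gamma>' u u = c *\<^sub>R u"
proof -
  interpret p: smooth_gauge "\<lambda>u. \<Phi> (y, u)" by (rule gauge[OF y])
  interpret L: horizontally_constant U \<Gamma> Lag by (rule horizontally_constant_Lag)
  have bil: "bilinear (\<Gamma> y)" by (rule smooth_bilinearD(2)[OF \<Gamma> y])
  obtain N u0 where N: "open N" "u0 \<in> N" "0 \<notin> N"
    "\<And>u k z. u \<in> N \<Longrightarrow> k > 0 \<Longrightarrow> (\<And>w. fd (\<lambda>x. fd p.energy x w) (k *\<^sub>R u) z = 0) \<Longrightarrow> z = 0"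
    by (rule p.hessian_nondegenerate) blast
  have slice1: "fd p.energy u w = fd Lag (y, u) (0, w)" if "u \<noteq> 0" for u w
    by (rule fd_slice[of Lag]) (rule smooth_on_differentiable[OF smooth_Lag], use y that in simp)
  have slice2: "fd (\<lambda>x. fd p.energy x w) u z = fd (\<lambda>q. fd Lag q (0, w)) (y, u) (0, z)" if u: "u \<noteq> 0" for u w z
  proof -
    have "((\<lambda>x. fd p.energy x w) has_derivative fd (\<lambda>x. fd p.energy x w) u) (at u)"
      by (rule smooth_on_has_derivative[OF smooth_on_fd[OF p.smooth_energy]]) (use u in simp)
    then have "((\<lambda>x. fd Lag (y, x) (0, w)) has_derivative fd (\<lambda>x. fd p.energy x w) u) (at u)"
      by (rule has_derivative_transform_within_open[OF _ p.open_punctured]) (use u slice1 in auto)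
    then have "fd (\<lambda>x. fd p.energy x w) u z = fd (\<lambda>x. fd Lag (y, x) (0, w)) u z" by (simp add: fd_eq)
    also have "\<dots> = fd (\<lambda>q. fd Lag q (0, w)) (y, u) (0, z)"
      by (rule fd_slice[of "\<lambda>q. fd Lag q (0, w)"])
        (rule smooth_on_differentiable[OF smooth_on_fd[OF smooth_Lag]], use y u in simp)
    finally show ?thesis .
  qed
  have "\<exists>c. \<Gamma> y b b - \<Gamma>' b b = c *\<^sub>R b" if b: "b \<in> N" for b
  proof -
    have b0: "b \<noteq> 0" using b N(3) by auto
    obtain k a where k: "k > 0" and ka: "\<And>w. fd (\<lambda>q. fd Lag q (0, w)) (y, k *\<^sub>R b)
        (k *\<^sub>R b, a *\<^sub>R b - k\<^sup>2 *\<^sub>R \<Gamma>' b b) = fd Lag (y, k *\<^sub>R b) (w, 0)"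
      using EL[OF b0] by blast
    have kb: "k *\<^sub>R b \<noteq> 0" using k b0 by simp
    \<comment> \<open>The difference of the two accelerations; \<open>a\<close> and \<open>k\<close>
      stem from the reparametrization.\<close>
    define z where "z = a *\<^sub>R b + k\<^sup>2 *\<^sub>R (\<Gamma> y b b - \<Gamma>' b b)"
    have "z = 0"
    proof (rule N(4)[OF b k])
      fix w
      interpret H: linear "fd (\<lambda>q. fd Lag q (0, w)) (y, k *\<^sub>R b)"
        by (rule has_derivative_linear[OF smooth_on_has_derivative[OF smooth_on_fd[OF smooth_Lag]]])
          (use y kb in simp)
      have "\<Gamma> y (k *\<^sub>R b) (k *\<^sub>R b) = k\<^sup>2 *\<^sub>R \<Gamma> y b b"
        by (simp add: bilinear_lmul[OF bil] bilinear_rmul[OF bil] power2_eq_square)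
      then have "fd (\<lambda>q. fd Lag q (0, w)) (y, k *\<^sub>R b) (k *\<^sub>R b, - (k\<^sup>2 *\<^sub>R \<Gamma> y b b))
          = fd Lag (y, k *\<^sub>R b) (w, 0)"
        using L.euler_lagrange[OF y kb, of w] by simp
      then have "fd (\<lambda>q. fd Lag q (0, w)) (y, k *\<^sub>R b)
        ((k *\<^sub>R b, a *\<^sub>R b - k\<^sup>2 *\<^sub>R \<Gamma>' b b) - (k *\<^sub>R b, - (k\<^sup>2 *\<^sub>R \<Gamma> y b b))) = 0"
        unfolding H.diff ka by simp
      then show "fd (\<lambda>x. fd p.energy x w) (k *\<^sub>R b) z = 0"
        unfolding slice2[OF kb] by (simp add: z_def algebra_simps)
    qed
    have "\<Gamma> y b b - \<Gamma>' b b = (1 / k\<^sup>2) *\<^sub>R (z - a *\<^sub>R b)" using k by (simp add: z_def)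
    also have "\<dots> = (- a / k\<^sup>2) *\<^sub>R b" by (simp add: \<open>z = 0\<close>)
    finally show ?thesis by blast
  qed
  from quadratic_eigen_everywhere[OF bilinear_diff_family[OF bil \<Gamma>'(1)] N(1,2) this] show ?thesis .
qed

text \<open>Polarized, the proportionality says that \<open>\<Gamma>\<close> arises from
  \<open>\<Gamma>'\<close> by a one-form \<open>\<phi>\<close>. As \<open>\<Gamma>'\<close> is flat,
  the curvature of \<open>\<Gamma>\<close> is entirely the term built from \<open>P\<close>, and
  \<open>curvature_vertical\<close> makes it an infinitesimal symmetry of the gauge at
  \<open>y\<close>.\<close>

lemma flat_or_euclidean:
  assumes dim: "2 \<le> DIM('a)" and \<Gamma>': "smooth_bilinear U \<Gamma>'"
    and sym': "\<And>y u v. y \<in> U \<Longrightarrow> \<Gamma>' y u v = \<Gamma>' y v u"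
    and flat: "\<And>y u v w. y \<in> U \<Longrightarrow> curv \<Gamma>' y u v w = 0"
    and proj: "\<And>y u. y \<in> U \<Longrightarrow> \<exists>c. \<Gamma> y u u - \<Gamma>' y u u = c *\<^sub>R u"
    and y: "y \<in> U"
  shows "(\<forall>u v w. curv \<Gamma> y u v w = 0) \<or> (\<exists>B. bilinear B \<and> (\<forall>\<xi>. (\<Phi> (y, \<xi>))\<^sup>2 = B \<xi> \<xi>))"
proof -
  interpret p: smooth_gauge "\<lambda>u. \<Phi> (y, u)" by (rule gauge[OF y])
  define \<phi> where "\<phi> z u = (\<Sum>i\<in>Basis. (u \<bullet> i) * ((\<Gamma> z i i - \<Gamma>' z i i) \<bullet> i)) / 2" for z u
  have bil: "bilinear (\<Gamma> z)" "bilinear (\<Gamma>' z)" if "z \<in> U" for z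
    using smooth_bilinearD(2)[OF \<Gamma> that] smooth_bilinearD(2)[OF \<Gamma>' that] .
  have \<Gamma>\<phi>: "\<Gamma> z u v = \<Gamma>' z u v + \<phi> z u *\<^sub>R v + \<phi> z v *\<^sub>R u" if z: "z \<in> U" for z u v
  proof -
    have "\<Gamma> z u v - \<Gamma>' z u v = \<phi> z u *\<^sub>R v + \<phi> z v *\<^sub>R u"
      by (rule projective_deformation[OF bilinear_diff_family[OF bil[OF z]] _ proj[OF z]])
        (simp_all add: sym[OF z, of _ "_"] sym'[OF z, of _ "_"] \<phi>_def)
    then show ?thesis by (simp add: algebra_simps)
  qed
  have lin\<phi>: "linear (\<phi> z)" for z
    by (rule linearI) (simp_all add: \<phi>_def inner_add_left distrib_right sum.distrib add_divide_distrib
        sum_distrib_left mult.assoc)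
  have s\<phi>: "smooth_on U (\<lambda>z. \<phi> z u)" for u
  proof -
    have "smooth_on U (\<lambda>z. (1 / 2) * (\<Sum>i\<in>Basis. (u \<bullet> i) * ((\<Gamma> z i i - \<Gamma>' z i i) \<bullet> i)))"
      by (intro smooth_on_mult smooth_on_sum smooth_on_const smooth_on_inner smooth_on_diff open_U
          smooth_bilinearD(3)[OF \<Gamma>] smooth_bilinearD(3)[OF \<Gamma>'])
    then show ?thesis by (simp add: \<phi>_def)
  qed
  have D\<phi>: "((\<lambda>z. \<phi> z u) has_derivative fd (\<lambda>z. \<phi> z u) y) (at y)" for u
    by (rule smooth_on_has_derivative[OF s\<phi> y])
  define \<psi> where "\<psi> u w = fd (\<lambda>z. \<phi> z w) y u" for u w
  have \<psi>: "bilinear \<psi>"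
  proof -
    have "\<psi> u (v + w) = \<psi> u v + \<psi> u w" for u v w
      using fd_eq[OF has_derivative_add[OF D\<phi>[of v] D\<phi>[of w]]]
      by (simp add: \<psi>_def linear_add[OF lin\<phi>])
    moreover have "\<psi> u (c *\<^sub>R w) = c * \<psi> u w" for u c w
      using fd_eq[OF has_derivative_mult_right[OF D\<phi>[of w], of c]]
      by (simp add: \<psi>_def linear_scale[OF lin\<phi>])
    moreover have "linear (\<lambda>u. \<psi> u w)" for w
      unfolding \<psi>_def using has_derivative_linear[OF D\<phi>[of w]] .
    ultimately show ?thesis unfolding bilinear_def by (auto intro!: linearI)
  qed
  \<comment> \<open>The covariant derivative of \<open>\<phi>\<close> with respect to
    \<open>\<Gamma>'\<close> minus \<open>\<phi> \<otimes> \<phi>\<close>, the tensor by which a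
    projective change alters the curvature.\<close>
  define P where "P u w = \<psi> u w - \<phi> y (\<Gamma>' y u w) - \<phi> y u * \<phi> y w" for u w
  note b' = bilinear_ladd[OF bil(2)[OF y]] bilinear_radd[OF bil(2)[OF y]]
    bilinear_lmul[OF bil(2)[OF y]] bilinear_rmul[OF bil(2)[OF y]]
  note l\<phi> = linear_add[OF lin\<phi>] linear_scale[OF lin\<phi>]
  have P: "bilinear P"
    unfolding bilinear_def P_def
    by (auto intro!: linearI simp: bilinear_ladd[OF \<psi>] bilinear_radd[OF \<psi>] bilinear_lmul[OF \<psi>]
        bilinear_rmul[OF \<psi>] b' l\<phi> algebra_simps)
  have fd\<Gamma>: "fd (\<lambda>z. \<Gamma> z v w) y u = fd (\<lambda>z. \<Gamma>' z v w) y u + \<psi> u v *\<^sub>R w + \<psi> u w *\<^sub>R v" for u v w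
  proof -
    have "((\<lambda>z. \<Gamma>' z v w + \<phi> z v *\<^sub>R w + \<phi> z w *\<^sub>R v) has_derivative
      (\<lambda>u. fd (\<lambda>z. \<Gamma>' z v w) y u + \<psi> u v *\<^sub>R w + \<psi> u w *\<^sub>R v)) (at y)"
      unfolding \<psi>_def
      by (intro has_derivative_add has_derivative_scaleR_left D\<phi>
          smooth_on_has_derivative[OF smooth_bilinearD(3)[OF \<Gamma>'] y])
    then have "((\<lambda>z. \<Gamma> z v w) has_derivative
      (\<lambda>u. fd (\<lambda>z. \<Gamma>' z v w) y u + \<psi> u v *\<^sub>R w + \<psi> u w *\<^sub>R v)) (at y)"
      by (rule has_derivative_transform_within_open[OF _ open_U y]) (simp add: \<Gamma>\<phi>)
    from fd_eq[OF this] show ?thesis by simp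
  qed
  have \<Gamma>\<Gamma>: "\<Gamma> y u (\<Gamma> y v w) = \<Gamma>' y u (\<Gamma>' y v w)
      + \<phi> y v *\<^sub>R \<Gamma>' y u w + \<phi> y w *\<^sub>R \<Gamma>' y u v + \<phi> y u *\<^sub>R \<Gamma>' y v w
      + (\<phi> y u * \<phi> y v) *\<^sub>R w + (\<phi> y u * \<phi> y w) *\<^sub>R v
      + (\<phi> y (\<Gamma>' y v w) + \<phi> y v * \<phi> y w + \<phi> y v * \<phi> y w) *\<^sub>R u" for u v w
    unfolding \<Gamma>\<phi>[OF y, of v w] \<Gamma>\<phi>[OF y, of u] by (simp add: b' l\<phi> algebra_simps)
  have R: "curv \<Gamma> y u v w = P u w *\<^sub>R v - P v w *\<^sub>R u + (P u v - P v u) *\<^sub>R w" for u v w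
  proof -
    have "curv \<Gamma> y u v w = curv \<Gamma>' y u v w + (P u w *\<^sub>R v - P v w *\<^sub>R u + (P u v - P v u) *\<^sub>R w)"
    proof -
      have two: "(2 * c) *\<^sub>R x = c *\<^sub>R x + c *\<^sub>R x" for c and x :: 'a
        by (simp add: scaleR_add_left[symmetric])
      show ?thesis
        unfolding curv_def fd\<Gamma> \<Gamma>\<Gamma> P_def by (simp add: sym'[OF y, of v u] algebra_simps two)
    qed
    then show ?thesis using flat[OF y] by simp
  qed
  have "p.skew (\<lambda>\<xi>. P u \<xi> *\<^sub>R v - P v \<xi> *\<^sub>R u + (P u v - P v u) *\<^sub>R \<xi>)" for u v
    unfolding p.skew_def
  proof (intro conjI allI impI)
    show "linear (\<lambda>\<xi>. P u \<xi> *\<^sub>R v - P v \<xi> *\<^sub>R u + (P u v - P v u) *\<^sub>R \<xi>)"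
      by (auto intro!: linearI simp: bilinear_radd[OF P] bilinear_rmul[OF P] algebra_simps)
    fix \<xi> :: 'a assume \<xi>: "\<xi> \<noteq> 0"
    have "fd (\<lambda>u. \<Phi> (y, u)) \<xi> (curv \<Gamma> y u v \<xi>) = fd \<Phi> (y, \<xi>) (0, curv \<Gamma> y u v \<xi>)"
      by (rule fd_slice) (rule smooth_on_differentiable[OF smooth_f], use y \<xi> in simp)
    then show "fd (\<lambda>u. \<Phi> (y, u)) \<xi> (P u \<xi> *\<^sub>R v - P v \<xi> *\<^sub>R u + (P u v - P v u) *\<^sub>R \<xi>) = 0"
      using curvature_vertical[OF y \<xi>] by (simp add: R)
  qed
  from p.projective_curvature_alternative[OF dim P this] show ?thesis
    by (auto simp: R)
qed

text \<open>For a parallel field the section \<open>y \<mapsto> (y, G y b)\<close> has horizontal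
  derivatives, along which \<open>\<Phi>\<close> does not change.\<close>

lemma constant_in_parallel_frame:
  assumes B: "convex B" "open B" "B \<subseteq> U" "y \<in> B" "y0 \<in> B"
    and G: "\<And>y. y \<in> B \<Longrightarrow> ((\<lambda>y. G y b) has_derivative (\<lambda>v. - \<Gamma> y v (G y b))) (at y)"
    and nz: "\<And>y. y \<in> B \<Longrightarrow> G y b \<noteq> 0"
  shows "\<Phi> (y, G y b) = \<Phi> (y0, G y0 b)"
proof (rule has_derivative_zero_unique[OF B(1) _ B(4,5)])
  fix z assume z: "z \<in> B"
  have "(\<Phi> has_derivative fd \<Phi> (z, G z b)) (at (z, G z b))"
    by (rule smooth_on_has_derivative[OF smooth_f]) (use z B(3) nz in auto)
  from has_derivative_compose[OF has_derivative_Pair[OF has_derivative_ident G[OF z]] this]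
  have "((\<lambda>y. \<Phi> (y, G y b)) has_derivative (\<lambda>v. 0)) (at z)"
    using horizontal[of z "G z b"] z B(3) nz by auto
  then show "((\<lambda>y. \<Phi> (y, G y b)) has_derivative (\<lambda>v. 0)) (at z within B)"
    by (rule has_derivative_at_withinI)
qed

end

section \<open>Charts, tangent vectors and curves\<close>

locale atlas =
  fixes A :: "('m::{t2_space, second_countable_topology}, 'n::finite) chart set"
  assumes atlas: "smooth_atlas A"
begin

definition overlap :: "('m, 'n) chart \<Rightarrow> ('m, 'n) chart \<Rightarrow> (real ^ 'n) set" where
  "overlap c d = cmap c ` (cdom c \<inter> cdom d)"

lemma chart:
  assumes "c \<in> A"
  shows open_cdom: "open (cdom c)" and open_cimg: "open (cimg c)"
    and homeomorphism_chart: "homeomorphism (cdom c) (cimg c) (cmap c) (cinv c)"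
  using atlas assms by (auto simp: smooth_atlas_def is_chart_def)

lemma cmap_in: "x \<in> cdom c \<Longrightarrow> cmap c x \<in> cimg c"
  by (simp add: cimg_def)

lemma cinv_cmap: "c \<in> A \<Longrightarrow> x \<in> cdom c \<Longrightarrow> cinv c (cmap c x) = x"
  by (rule homeomorphism_apply1[OF homeomorphism_chart])

lemma cmap_cinv: "c \<in> A \<Longrightarrow> y \<in> cimg c \<Longrightarrow> cmap c (cinv c y) = y"
  by (rule homeomorphism_apply2[OF homeomorphism_chart])

lemma cinv_in: "c \<in> A \<Longrightarrow> y \<in> cimg c \<Longrightarrow> cinv c y \<in> cdom c"
  using homeomorphism_image2[OF homeomorphism_chart, of c] by blast

lemma continuous_cmap: "c \<in> A \<Longrightarrow> continuous_on (cdom c) (cmap c)"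
  and continuous_cinv: "c \<in> A \<Longrightarrow> continuous_on (cimg c) (cinv c)"
  using homeomorphism_cont1[OF homeomorphism_chart, of c] homeomorphism_cont2[OF homeomorphism_chart, of c]
  by blast+

lemma overlap_iff:
  assumes c: "c \<in> A" shows "y \<in> overlap c d \<longleftrightarrow> y \<in> cimg c \<and> cinv c y \<in> cdom d"
proof
  assume "y \<in> overlap c d"
  then obtain x where "x \<in> cdom c" "x \<in> cdom d" "y = cmap c x" by (auto simp: overlap_def)
  then show "y \<in> cimg c \<and> cinv c y \<in> cdom d" using cinv_cmap[OF c] cmap_in by simp
next
  assume y: "y \<in> cimg c \<and> cinv c y \<in> cdom d"
  then have "y = cmap c (cinv c y)" "cinv c y \<in> cdom c \<inter> cdom d"
    using cmap_cinv[OF c] cinv_in[OF c] by simp_all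
  then show "y \<in> overlap c d" unfolding overlap_def by (rule image_eqI)
qed

lemma overlapI: "x \<in> cdom c \<Longrightarrow> x \<in> cdom d \<Longrightarrow> cmap c x \<in> overlap c d"
  by (auto simp: overlap_def)

lemma open_overlap:
  assumes "c \<in> A" "d \<in> A" shows "open (overlap c d)"
proof -
  have "overlap c d = cimg c \<inter> cinv c -` cdom d" using overlap_iff[OF assms(1), where d = d] by auto
  then show ?thesis
    using continuous_open_preimage[OF continuous_cinv[OF assms(1)] open_cimg[OF assms(1)] open_cdom[OF assms(2)]]
    by simp
qed

lemma smooth_transition: "c \<in> A \<Longrightarrow> d \<in> A \<Longrightarrow> smooth_on (overlap c d) (transition c d)"
  using atlas by (simp add: smooth_atlas_def overlap_def)

lemma transition_cmap: "c \<in> A \<Longrightarrow> x \<in> cdom c \<Longrightarrow> transition c d (cmap c x) = cmap d x"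
  by (simp add: transition_def cinv_cmap)

lemma transition_derivative:
  "c \<in> A \<Longrightarrow> d \<in> A \<Longrightarrow> y \<in> overlap c d \<Longrightarrow> (transition c d has_derivative fd (transition c d) y) (at y)"
  by (rule smooth_on_has_derivative[OF smooth_transition])

lemma charts_at_iff: "c \<in> charts_at A x \<longleftrightarrow> c \<in> A \<and> x \<in> cdom c"
  by (simp add: charts_at_def)

lemma transition_derivative_at:
  "c \<in> charts_at A x \<Longrightarrow> d \<in> charts_at A x \<Longrightarrow>
    (transition c d has_derivative fd (transition c d) (cmap c x)) (at (cmap c x))"
  by (rule transition_derivative) (auto simp: charts_at_iff overlapI)

lemma linear_transition:
  "c \<in> charts_at A x \<Longrightarrow> d \<in> charts_at A x \<Longrightarrow> linear (fd (transition c d) (cmap c x))"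
  using transition_derivative_at has_derivative_linear by blast

lemma transition_cocycle:
  assumes c: "c \<in> charts_at A x" and d: "d \<in> charts_at A x" and e: "e \<in> charts_at A x"
  shows "fd (transition d e) (cmap d x) (fd (transition c d) (cmap c x) u) = fd (transition c e) (cmap c x) u"
proof -
  have A: "c \<in> A" "d \<in> A" "e \<in> A" and x: "x \<in> cdom c" "x \<in> cdom d" "x \<in> cdom e"
    using assms by (auto simp: charts_at_iff)
  have "(transition d e has_derivative fd (transition d e) (cmap d x)) (at (transition c d (cmap c x)))"
    using transition_derivative_at[OF d e] by (simp add: transition_cmap A x)
  from has_derivative_compose[OF transition_derivative_at[OF c d] this]
  have "((\<lambda>y. transition d e (transition c d y)) has_derivative
    (\<lambda>u. fd (transition d e) (cmap d x) (fd (transition c d) (cmap c x) u))) (at (cmap c x))" .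
  then have "(transition c e has_derivative
    (\<lambda>u. fd (transition d e) (cmap d x) (fd (transition c d) (cmap c x) u))) (at (cmap c x))"
  proof (rule has_derivative_transform_within_open[OF _ open_overlap[OF A(1,2)]])
    show "cmap c x \<in> overlap c d" by (rule overlapI[OF x(1,2)])
    show "transition d e (transition c d y) = transition c e y" if "y \<in> overlap c d" for y
      using that overlap_iff[OF A(1), where d = d] cinv_cmap[OF A(2)] by (simp add: transition_def)
  qed
  from fd_eq[OF this] show ?thesis by simp
qed

lemma transition_self:
  assumes "c \<in> charts_at A x" shows "fd (transition c c) (cmap c x) u = u"
proof -
  have A: "c \<in> A" "x \<in> cdom c" using assms by (auto simp: charts_at_iff)
  have "((\<lambda>y. y) has_derivative (\<lambda>u. u)) (at (cmap c x))" by simp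
  then have "(transition c c has_derivative (\<lambda>u. u)) (at (cmap c x))"
    by (rule has_derivative_transform_within_open[OF _ open_cimg[OF A(1)] cmap_in[OF A(2)]])
      (simp add: transition_def cmap_cinv A)
  from fd_eq[OF this] show ?thesis by simp
qed

lemma tvec_of_at: "d \<in> charts_at A x \<Longrightarrow> tvec_of A c x u d = fd (transition c d) (cmap c x) u"
  by (simp add: tvec_of_def)

lemma tvec_of_self: "c \<in> charts_at A x \<Longrightarrow> tvec_of A c x u c = u"
  by (simp add: tvec_of_at transition_self)

lemma tvec_of_in: "c \<in> charts_at A x \<Longrightarrow> tvec_of A c x u \<in> tangent_space A x"
  unfolding tangent_space_def mem_Collect_eq
proof (intro conjI allI impI ballI)
  fix d e assume "c \<in> charts_at A x" "d \<in> charts_at A x" "e \<in> charts_at A x"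
  then show "tvec_of A c x u e = fd (transition d e) (cmap d x) (tvec_of A c x u d)"
    by (simp only: tvec_of_at transition_cocycle)
qed (simp add: tvec_of_def)

lemma tvec_of_component:
  assumes "\<xi> \<in> tangent_space A x" "c \<in> charts_at A x" shows "tvec_of A c x (\<xi> c) = \<xi>"
proof
  fix d show "tvec_of A c x (\<xi> c) d = \<xi> d"
    using assms unfolding tangent_space_def mem_Collect_eq tvec_of_def by (cases "d \<in> charts_at A x") metis+
qed

lemma tvec_of_change:
  assumes "c \<in> charts_at A x" "d \<in> charts_at A x"
  shows "tvec_of A d x (fd (transition c d) (cmap c x) u) = tvec_of A c x u"
  using tvec_of_component[OF tvec_of_in[OF assms(1), of u] assms(2)] tvec_of_at[OF assms(2), of c u] by simp

lemma tvec_of_add: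
  "c \<in> charts_at A x \<Longrightarrow> tvec_of A c x (u + v) = (\<lambda>d. tvec_of A c x u d + tvec_of A c x v d)"
  unfolding tvec_of_def by (rule ext) (simp add: linear_add[OF linear_transition])

lemma tvec_of_scale:
  "c \<in> charts_at A x \<Longrightarrow> tvec_of A c x (l *\<^sub>R u) = (\<lambda>d. l *\<^sub>R tvec_of A c x u d)"
  unfolding tvec_of_def by (rule ext) (simp add: linear_scale[OF linear_transition])

lemma tvec_of_eq_0_iff:
  assumes "c \<in> charts_at A x" shows "tvec_of A c x u = (\<lambda>d. 0) \<longleftrightarrow> u = 0"
proof
  assume "tvec_of A c x u = (\<lambda>d. 0)"
  then show "u = 0" using tvec_of_self[OF assms, of u] by simp
next
  assume "u = 0"
  then show "tvec_of A c x u = (\<lambda>d. 0)"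
    unfolding tvec_of_def by (intro ext) (simp add: linear_0[OF linear_transition[OF assms]])
qed

lemma local_rep_cmap: "c \<in> charts_at A x \<Longrightarrow> local_rep A F c (cmap c x, u) = F x (tvec_of A c x u)"
  by (simp add: local_rep_def cinv_cmap charts_at_iff)

lemma local_rep_change:
  assumes "c \<in> charts_at A x" "d \<in> charts_at A x"
  shows "local_rep A F d (cmap d x, fd (transition c d) (cmap c x) u) = local_rep A F c (cmap c x, u)"
  by (simp add: local_rep_cmap assms tvec_of_change[OF assms])

lemma eq_local_rep:
  assumes "\<xi> \<in> tangent_space A x" "c \<in> charts_at A x"
  shows "F x \<xi> = local_rep A F c (cmap c x, \<xi> c)"
  by (simp add: local_rep_cmap assms tvec_of_component[OF assms])

lemma chart_at_cinv: "c \<in> A \<Longrightarrow> y \<in> cimg c \<Longrightarrow> c \<in> charts_at A (cinv c y)"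
  by (simp add: charts_at_iff cinv_in)

lemma points_cinv: "c \<in> A \<Longrightarrow> y \<in> cimg c \<Longrightarrow> cinv c y \<in> points A"
  unfolding points_def using cinv_in[of c y] by blast

lemma smooth_gauge_local_rep:
  assumes F: "finsler_metric A F" and c: "c \<in> A" and y: "y \<in> cimg c"
  shows "smooth_gauge (\<lambda>u. local_rep A F c (y, u))"
proof
  let ?x = "cinv c y"
  have cx: "c \<in> charts_at A ?x" by (rule chart_at_cinv[OF c y])
  have rep: "local_rep A F c (y, u) = F ?x (tvec_of A c ?x u)" for u by (simp add: local_rep_def)
  have Fx: "\<forall>\<xi>\<in>tangent_space A ?x.
        0 \<le> F ?x \<xi> \<and> (\<forall>l\<ge>0. F ?x (\<lambda>c. l *\<^sub>R \<xi> c) = l * F ?x \<xi>) \<and>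
        (\<forall>\<eta>\<in>tangent_space A ?x. F ?x (\<lambda>c. \<xi> c + \<eta> c) \<le> F ?x \<xi> + F ?x \<eta>) \<and>
        (F ?x \<xi> = 0 \<longrightarrow> \<xi> = (\<lambda>c. 0))"
    using F points_cinv[OF c y] unfolding finsler_metric_def by blast
  have s: "smooth_on (cimg c \<times> (UNIV - {0})) (local_rep A F c)"
    using F c by (simp add: finsler_metric_def)
  show "smooth_on (UNIV - {0}) (\<lambda>u. local_rep A F c (y, u))"
    by (rule smooth_on_compose[OF _ _ _ _ s, where f = "\<lambda>u. (y, u)"])
      (use y in \<open>auto intro!: open_Times open_cimg[OF c] smooth_on_Pair smooth_on_const smooth_on_id open_Diff\<close>)
  show "0 < local_rep A F c (y, \<xi>)" if "\<xi> \<noteq> 0" for \<xi>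
  proof -
    have "F ?x (tvec_of A c ?x \<xi>) \<noteq> 0" "0 \<le> F ?x (tvec_of A c ?x \<xi>)"
      using Fx tvec_of_in[OF cx, of \<xi>] that tvec_of_eq_0_iff[OF cx, of \<xi>] by blast+
    then show ?thesis by (simp add: rep)
  qed
  show "local_rep A F c (y, l *\<^sub>R \<xi>) = l * local_rep A F c (y, \<xi>)" if "0 \<le> l" for l \<xi>
    unfolding rep tvec_of_scale[OF cx] using Fx tvec_of_in[OF cx] that by blast
  show "local_rep A F c (y, \<xi> + \<eta>) \<le> local_rep A F c (y, \<xi>) + local_rep A F c (y, \<eta>)" for \<xi> \<eta>
    unfolding rep tvec_of_add[OF cx] using Fx tvec_of_in[OF cx] by blast
qed

section \<open>Curves given in one chart\<close>

lemma open_curve_overlap: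
  fixes y :: "real \<Rightarrow> real ^ 'n"
  assumes "c \<in> A" "d \<in> A" "open I" "continuous_on I y" "y ` I \<subseteq> cimg c"
  shows "open {t \<in> I. cinv c (y t) \<in> cdom d}"
proof -
  have "{t \<in> I. cinv c (y t) \<in> cdom d} = I \<inter> y -` overlap c d"
    using assms(5) overlap_iff[OF assms(1), where d = d] by auto
  then show ?thesis using continuous_open_preimage[OF assms(4,3) open_overlap[OF assms(1,2)]] by simp
qed

lemma smooth_chart_curve:
  assumes c: "c \<in> A" and I: "open_interval I" and y: "smooth_on I y" "y ` I \<subseteq> cimg c"
  shows "smooth_curve A I (cinv c \<circ> y)"
  unfolding smooth_curve_def
proof (intro conjI ballI I)
  have oI: "open I" using I by (simp add: open_interval_def)
  note cont = smooth_on_continuous[OF y(1)]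
  show "(cinv c \<circ> y) ` I \<subseteq> points A" using y(2) points_cinv[OF c] by auto
  show "continuous_on I (cinv c \<circ> y)"
    unfolding o_def by (rule continuous_on_compose2[OF continuous_cinv[OF c] cont y(2)])
  fix d assume d: "d \<in> A"
  let ?S = "{t \<in> I. cinv c (y t) \<in> cdom d}"
  have "smooth_on ?S (\<lambda>t. transition c d (y t))"
  proof (rule smooth_on_compose[OF open_curve_overlap[OF c d oI cont y(2)] open_overlap[OF c d] _ _ smooth_transition[OF c d]])
    show "y ` ?S \<subseteq> overlap c d" using y(2) overlap_iff[OF c, where d = d] by auto
    show "smooth_on ?S y" by (rule smooth_on_subset[OF y(1)]) auto
  qed
  then show "smooth_on {t \<in> I. (cinv c \<circ> y) t \<in> cdom d} (cmap d \<circ> (cinv c \<circ> y))"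
    by (simp add: transition_def o_def)
qed

lemma chart_curve_derivative:
  assumes c: "c \<in> A" and yt: "y t \<in> cimg c" and y: "(y has_vector_derivative y') (at t)"
    and d: "d \<in> charts_at A (cinv c (y t))"
  shows "((cmap d \<circ> (cinv c \<circ> y)) has_vector_derivative fd (transition c d) (y t) y') (at t)"
proof -
  have yo: "y t \<in> overlap c d" and dA: "d \<in> A" using d yt overlap_iff[OF c, where d = d] by (auto simp: charts_at_iff)
  have D: "(transition c d has_derivative fd (transition c d) (y t)) (at (y t))"
    by (rule transition_derivative[OF c dA yo])
  have "((\<lambda>t. transition c d (y t)) has_derivative (\<lambda>a. fd (transition c d) (y t) (a *\<^sub>R y'))) (at t)"
    by (rule has_derivative_compose[OF y[unfolded has_vector_derivative_def] D])
  then show ?thesis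
    unfolding has_vector_derivative_def linear_scale[OF has_derivative_linear[OF D]]
    by (simp add: transition_def o_def)
qed

lemma velocity_chart_curve:
  assumes c: "c \<in> A" and yt: "y t \<in> cimg c" and y: "(y has_vector_derivative y') (at t)"
  shows "velocity A (cinv c \<circ> y) t = tvec_of A c (cinv c (y t)) y'"
proof
  fix d
  show "velocity A (cinv c \<circ> y) t d = tvec_of A c (cinv c (y t)) y' d"
  proof (cases "d \<in> charts_at A (cinv c (y t))")
    case True
    from vector_derivative_at[OF chart_curve_derivative[OF c yt y True]] True
    show ?thesis by (simp add: velocity_def tvec_of_at cmap_cinv[OF c yt])
  qed (simp add: velocity_def tvec_of_def)
qed

section \<open>Symmetric connections and parallel fields in a chart\<close>

lemma connection_bilinear:
  "symmetric_connection A \<Gamma> \<Longrightarrow> c \<in> A \<Longrightarrow> y \<in> cimg c \<Longrightarrow> bilinear (\<Gamma> c y)"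
  unfolding symmetric_connection_def by (elim conjE) (drule bspec, assumption, drule bspec, assumption, erule conjunct1)

lemma connection_sym:
  "symmetric_connection A \<Gamma> \<Longrightarrow> c \<in> A \<Longrightarrow> y \<in> cimg c \<Longrightarrow> \<Gamma> c y u v = \<Gamma> c y v u"
  unfolding symmetric_connection_def
  by (elim conjE) (drule bspec, assumption, drule bspec, assumption, drule conjunct2, erule spec2)

lemma connection_smooth:
  "symmetric_connection A \<Gamma> \<Longrightarrow> c \<in> A \<Longrightarrow> smooth_on (cimg c) (\<lambda>y. \<Gamma> c y u v)"
  unfolding symmetric_connection_def by (elim conjE) (drule(1) bspec, drule(1) bspec, erule spec2)

lemma smooth_bilinear_connection:
  assumes "symmetric_connection A \<Gamma>" "c \<in> A" shows "smooth_bilinear (cimg c) (\<Gamma> c)"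
  unfolding smooth_bilinear_def
  using open_cimg[OF assms(2)] connection_bilinear[OF assms] connection_smooth[OF assms] by simp

lemma connection_change:
  assumes \<Gamma>: "symmetric_connection A \<Gamma>" and c: "c \<in> charts_at A x" and d: "d \<in> charts_at A x"
  shows "fd (transition c d) (cmap c x) (\<Gamma> c (cmap c x) u v) =
    \<Gamma> d (cmap d x) (fd (transition c d) (cmap c x) u) (fd (transition c d) (cmap c x) v)
    + fd (\<lambda>z. fd (transition c d) z u) (cmap c x) v"
proof -
  have "\<forall>c\<in>A. \<forall>d\<in>A. \<forall>x\<in>cdom c \<inter> cdom d. \<forall>u v.
        let y = cmap c x; D = (\<lambda>z. frechet_derivative (transition c d) (at z)) in
        D y (\<Gamma> c y u v) =
          \<Gamma> d (cmap d x) (D y u) (D y v) + frechet_derivative (\<lambda>z. D z u) (at y) v"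
    using \<Gamma> unfolding symmetric_connection_def by (elim conjE)
  moreover have "c \<in> A" "d \<in> A" "x \<in> cdom c \<inter> cdom d" using c d by (simp_all add: charts_at_iff)
  ultimately show ?thesis unfolding Let_def by blast
qed

text \<open>Parallelism is demanded in every chart that meets the curve, while the equation is known
  in \<open>c\<close> only. The transformation law of the Christoffel symbols absorbs the derivative
  of the differential of the coordinate change.\<close>

lemma parallel_chart_curve:
  assumes \<Gamma>: "symmetric_connection A \<Gamma>" and c: "c \<in> A" and I: "open I" and yI: "y ` I \<subseteq> cimg c"
    and y: "\<And>t. t \<in> I \<Longrightarrow> (y has_vector_derivative y' t) (at t)"
    and s: "\<And>t. t \<in> I \<Longrightarrow> (s has_vector_derivative - \<Gamma> c (y t) (y' t) (s t)) (at t)"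
  shows "parallel_along A \<Gamma> I (cinv c \<circ> y) (\<lambda>t. tvec_of A c (cinv c (y t)) (s t))"
  unfolding parallel_along_def
proof (intro ballI conjI)
  fix t assume t: "t \<in> I"
  have yt: "y t \<in> cimg c" using t yI by auto
  have cx: "c \<in> charts_at A (cinv c (y t))" by (rule chart_at_cinv[OF c yt])
  show "tvec_of A c (cinv c (y t)) (s t) \<in> tangent_space A ((cinv c \<circ> y) t)"
    using tvec_of_in[OF cx] by simp
  fix d assume "d \<in> charts_at A ((cinv c \<circ> y) t)"
  then have d: "d \<in> charts_at A (cinv c (y t))" and dA: "d \<in> A" by (simp_all add: charts_at_iff)
  let ?D = "\<lambda>z. fd (transition c d) z"
  have yo: "y t \<in> overlap c d" using d yt overlap_iff[OF c, where d = d] by (simp add: charts_at_iff)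
  note symc = connection_sym[OF \<Gamma> c yt]
  have symd: "\<And>u v. \<Gamma> d (cmap d (cinv c (y t))) u v = \<Gamma> d (cmap d (cinv c (y t))) v u"
    by (rule connection_sym[OF \<Gamma> dA cmap_in]) (use d in \<open>simp add: charts_at_iff\<close>)
  note law = connection_change[OF \<Gamma> cx d, unfolded cmap_cinv[OF c yt]]
  interpret D: linear "?D (y t)" by (rule has_derivative_linear[OF transition_derivative[OF c dA yo]])
  interpret D2: linear "fd (\<lambda>z. ?D z (s t)) (y t)"
    by (rule has_derivative_linear[OF smooth_on_has_derivative[OF smooth_on_fd[OF smooth_transition[OF c dA]] yo]])
  have "((\<lambda>r. ?D (y r) (s r)) has_derivative
     (\<lambda>a. fd (\<lambda>q. ?D q (s t)) (y t) (a *\<^sub>R y' t) + ?D (y t) (a *\<^sub>R - \<Gamma> c (y t) (y' t) (s t)))) (at t)"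
    by (rule has_derivative_fd_along[OF open_overlap[OF c dA] smooth_transition[OF c dA], of y t])
      (use yo y[OF t] s[OF t] in \<open>auto simp: has_vector_derivative_def\<close>)
  moreover have "fd (\<lambda>q. ?D q (s t)) (y t) (a *\<^sub>R y' t) + ?D (y t) (a *\<^sub>R - \<Gamma> c (y t) (y' t) (s t))
     = a *\<^sub>R - \<Gamma> d (cmap d (cinv c (y t))) (?D (y t) (y' t)) (?D (y t) (s t))" for a
  proof -
    \<comment> \<open>The law differentiates the coordinate change applied to its first argument
      along the second, so it is used for the pair \<open>s t\<close>, \<open>y' t\<close> and both
      symbols are then swapped by symmetry.\<close>
    have "fd (\<lambda>q. ?D q (s t)) (y t) (y' t) - ?D (y t) (\<Gamma> c (y t) (y' t) (s t))
       = - \<Gamma> d (cmap d (cinv c (y t))) (?D (y t) (y' t)) (?D (y t) (s t))"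
      using law[of "s t" "y' t"] symc[of "s t" "y' t"] symd[of "?D (y t) (s t)" "?D (y t) (y' t)"] by simp
    then show ?thesis
      unfolding D.scale D2.scale D.neg scaleR_add_right[symmetric] by simp
  qed
  ultimately have "((\<lambda>r. ?D (y r) (s r)) has_vector_derivative
      - \<Gamma> d (cmap d (cinv c (y t))) (?D (y t) (y' t)) (?D (y t) (s t))) (at t)"
    by (simp only: has_vector_derivative_def)
  then have "((\<lambda>r. tvec_of A c (cinv c (y r)) (s r) d) has_vector_derivative
      - \<Gamma> d (cmap d (cinv c (y t))) (?D (y t) (y' t)) (?D (y t) (s t))) (at t)"
  proof (rule has_vector_derivative_transform_within_open)
    have "continuous_on I y"
      using y has_vector_derivative_continuous continuous_at_imp_continuous_on by blast
    then show "open {r \<in> I. cinv c (y r) \<in> cdom d}" by (rule open_curve_overlap[OF c dA I _ yI])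
    show "t \<in> {r \<in> I. cinv c (y r) \<in> cdom d}" using t d by (simp add: charts_at_iff)
    fix r assume "r \<in> {r \<in> I. cinv c (y r) \<in> cdom d}"
    then have "d \<in> charts_at A (cinv c (y r))" "y r \<in> cimg c" using dA yI by (auto simp: charts_at_iff)
    then show "?D (y r) (s r) = tvec_of A c (cinv c (y r)) (s r) d"
      by (simp add: tvec_of_at cmap_cinv[OF c])
  qed
  then show "((\<lambda>r. tvec_of A c (cinv c (y r)) (s r) d) has_vector_derivative
      - \<Gamma> d (cmap d ((cinv c \<circ> y) t)) (velocity A (cinv c \<circ> y) t d) (tvec_of A c (cinv c (y t)) (s t) d)) (at t)"
    unfolding velocity_chart_curve[where c = c, OF c yt y[OF t]] tvec_of_at[OF d] cmap_cinv[OF c yt] by simp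
qed

lemma curvature_eq_curv: "curvature \<Gamma> c y u v w = curv (\<Gamma> c) y u v w"
  by (simp add: curvature_def curv_def)

end

section \<open>Berwald metrics\<close>

locale berwald_atlas = atlas A
  for A :: "('m::{t2_space, second_countable_topology}, 'n::finite) chart set" +
  fixes F :: "'m \<Rightarrow> ('m, 'n) tvec \<Rightarrow> real" and \<Gamma> :: "('m, 'n) christoffel"
  assumes finsler: "finsler_metric A F" and connection: "symmetric_connection A \<Gamma>"
    and preserves: "parallel_transport_preserves A \<Gamma> F"
begin

abbreviation \<Phi> :: "('m, 'n) chart \<Rightarrow> (real ^ 'n) \<times> (real ^ 'n) \<Rightarrow> real" where
  "\<Phi> \<equiv> local_rep A F"

text \<open>The hypothesis on parallel transport enters here, on rays of a chart. It yields both the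
  infinitesimal invariance of \<open>F\<close> and linear isometries between neighbouring tangent
  spaces.\<close>

lemma radial_isometry:
  assumes c: "c \<in> A" and y: "y \<in> cimg c"
  obtains r T where "0 < r" "cball y r \<subseteq> cimg c" "\<And>z. linear (T z)" "\<And>u. T y u = u"
    "\<And>v t u. norm (t *\<^sub>R v) < r \<Longrightarrow>
      ((\<lambda>t. T (y + t *\<^sub>R v) u) has_vector_derivative - \<Gamma> c (y + t *\<^sub>R v) v (T (y + t *\<^sub>R v) u)) (at t)"
    "\<And>v t u. norm (t *\<^sub>R v) < r \<Longrightarrow> \<Phi> c (y + t *\<^sub>R v, T (y + t *\<^sub>R v) u) = \<Phi> c (y, u)"
proof -
  have sb: "smooth_bilinear (cimg c) (\<lambda>y h s. - \<Gamma> c y h s)"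
    unfolding smooth_bilinear_def
    using open_cimg[OF c] connection_bilinear[OF connection c] connection_smooth[OF connection c]
    by (auto simp: bilinear_def intro!: linear_compose_neg smooth_on_minus)
  obtain r T where T: "0 < r" "cball y r \<subseteq> cimg c" "\<And>z. linear (T z)" "\<And>u. T y u = u"
    "\<And>v t u. norm (t *\<^sub>R v) < r \<Longrightarrow>
      ((\<lambda>t. T (y + t *\<^sub>R v) u) has_vector_derivative - \<Gamma> c (y + t *\<^sub>R v) v (T (y + t *\<^sub>R v) u)) (at t)"
    by (rule radial_transport[OF sb y]) (rule that)
  have "\<Phi> c (y + t *\<^sub>R v, T (y + t *\<^sub>R v) u) = \<Phi> c (y, u)" if t: "norm (t *\<^sub>R v) < r" for v t u
  proof -
    \<comment> \<open>All parameters for which the ray remains in the ball, an open interval since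
      it is the preimage of an open convex set; for \<open>v = 0\<close> it is the whole
      line.\<close>
    define I where "I = (\<lambda>t. t *\<^sub>R v) -` ball 0 r"
    have I: "s \<in> I \<longleftrightarrow> norm (s *\<^sub>R v) < r" for s by (simp add: I_def)
    have "open I" unfolding I_def by (intro open_vimage open_ball continuous_intros)
    moreover have "convex I"
      unfolding I_def by (intro convex_linear_vimage linearI convex_ball) (simp_all add: scaleR_add_left)
    moreover have "0 \<in> I" using T(1) by (simp add: I)
    ultimately have oi: "open_interval I" by (auto simp: open_interval_def is_interval_convex_1)
    have in_c: "y + s *\<^sub>R v \<in> cimg c" if "s \<in> I" for s
      using that T(2) by (auto simp: I dist_norm)
    let ?\<gamma> = "cinv c \<circ> (\<lambda>t. y + t *\<^sub>R v)"
    let ?V = "\<lambda>t. tvec_of A c (cinv c (y + t *\<^sub>R v)) (T (y + t *\<^sub>R v) u)"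
    have "smooth_on I (\<lambda>t. y + t *\<^sub>R v)"
      by (intro smooth_on_add smooth_on_scaleR smooth_on_const smooth_on_id \<open>open I\<close>)
    then have "smooth_curve A I ?\<gamma>"
      by (rule smooth_chart_curve[OF c oi]) (use in_c in auto)
    moreover have "parallel_along A \<Gamma> I ?\<gamma> ?V"
    proof (rule parallel_chart_curve[OF connection c \<open>open I\<close>, of "\<lambda>t. y + t *\<^sub>R v" "\<lambda>_. v" "\<lambda>t. T (y + t *\<^sub>R v) u"])
      show "((\<lambda>t. y + t *\<^sub>R v) has_vector_derivative v) (at s)" for s
        by (auto intro!: derivative_eq_intros)
    qed (use in_c T(5) I in auto)
    ultimately have "F (?\<gamma> t) (?V t) = F (?\<gamma> 0) (?V 0)"
      using preserves \<open>0 \<in> I\<close> t I unfolding parallel_transport_preserves_def by blast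
    then show ?thesis by (simp add: local_rep_def T(4))
  qed
  with T show thesis by (rule that)
qed

text \<open>Differentiating the constancy of \<open>F\<close> along a parallel field at the start of
  a ray gives exactly the vanishing of \<open>F\<close> along the horizontal fields.\<close>

lemma berwald_chart:
  assumes c: "c \<in> A" shows "berwald_chart (cimg c) (\<Gamma> c) (\<Phi> c)"
proof (intro berwald_chart.intro horizontally_constant.intro berwald_chart_axioms.intro)
  show "smooth_bilinear (cimg c) (\<Gamma> c)" by (rule smooth_bilinear_connection[OF connection c])
  show "\<Gamma> c y u v = \<Gamma> c y v u" if "y \<in> cimg c" for y u v by (rule connection_sym[OF connection c that])
  show smooth: "smooth_on (cimg c \<times> (UNIV - {0})) (\<Phi> c)" using finsler c by (simp add: finsler_metric_def)
  show "smooth_gauge (\<lambda>u. \<Phi> c (y, u))" if "y \<in> cimg c" for y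
    by (rule smooth_gauge_local_rep[OF finsler c that])
  fix y u v :: "real ^ 'n" assume y: "y \<in> cimg c" and u: "u \<noteq> 0"
  obtain r T where T: "0 < r" "\<And>u. T y u = u"
    "\<And>v t u. norm (t *\<^sub>R v) < r \<Longrightarrow>
      ((\<lambda>t. T (y + t *\<^sub>R v) u) has_vector_derivative - \<Gamma> c (y + t *\<^sub>R v) v (T (y + t *\<^sub>R v) u)) (at t)"
    "\<And>v t u. norm (t *\<^sub>R v) < r \<Longrightarrow> \<Phi> c (y + t *\<^sub>R v, T (y + t *\<^sub>R v) u) = \<Phi> c (y, u)"
    by (rule radial_isometry[OF c y]) (rule that)
  have "((\<lambda>t. T (y + t *\<^sub>R v) u) has_vector_derivative - \<Gamma> c y v u) (at 0)"
    using T(3)[of 0 v u] T(1,2) by simp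
  then have "((\<lambda>t. (y + t *\<^sub>R v, T (y + t *\<^sub>R v) u)) has_derivative (\<lambda>a. (a *\<^sub>R v, a *\<^sub>R (- \<Gamma> c y v u)))) (at 0)"
    unfolding has_vector_derivative_def
    by (intro has_derivative_Pair) (auto intro!: derivative_eq_intros)
  moreover have "(\<Phi> c has_derivative fd (\<Phi> c) (y, u)) (at (y + 0 *\<^sub>R v, T (y + 0 *\<^sub>R v) u))"
    using smooth_on_has_derivative[OF smooth, of "(y, u)"] y u T(2) by simp
  ultimately have D: "((\<lambda>t. \<Phi> c (y + t *\<^sub>R v, T (y + t *\<^sub>R v) u)) has_derivative
      (\<lambda>a. fd (\<Phi> c) (y, u) (a *\<^sub>R v, a *\<^sub>R (- \<Gamma> c y v u)))) (at 0)"
    by (rule has_derivative_compose)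
  have "open ((\<lambda>t. t *\<^sub>R v) -` ball 0 r)" by (intro open_vimage open_ball continuous_intros)
  from fd_eq_0_if_constant[OF this _ _ D, of "\<Phi> c (y, u)" 1] T(1,4)
  show "fd (\<Phi> c) (y, u) (v, - \<Gamma> c y v u) = 0" by simp
qed

section \<open>Linear isometries between the tangent spaces\<close>

text \<open>A linear isometry of tangent spaces expressed in components; the charts are part of the
  relation so that it becomes a statement about linear maps of \<open>real ^ 'n\<close>.\<close>

definition isometric_at :: "'m \<Rightarrow> ('m, 'n) chart \<Rightarrow> 'm \<Rightarrow> ('m, 'n) chart \<Rightarrow> bool" where
  "isometric_at x c x' d \<longleftrightarrow> (\<exists>L. linear L \<and> bij L \<and> (\<forall>u. \<Phi> d (cmap d x', L u) = \<Phi> c (cmap c x, u)))"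

lemma isometric_at_sym: "isometric_at x c x' d \<Longrightarrow> isometric_at x' d x c"
  unfolding isometric_at_def
proof (elim exE conjE)
  fix L assume L: "linear L" "bij L" "\<forall>u. \<Phi> d (cmap d x', L u) = \<Phi> c (cmap c x, u)"
  have "\<Phi> c (cmap c x, inv L u) = \<Phi> d (cmap d x', u)" for u
    using L(3)[rule_format, of "inv L u"] L(2) by (simp add: bij_is_surj surj_f_inv_f)
  moreover have "linear (inv L)"
    using inj_linear_imp_inv_linear[OF L(1)] L(2) by (simp add: bij_is_inj)
  ultimately show "\<exists>L. linear L \<and> bij L \<and> (\<forall>u. \<Phi> c (cmap c x, L u) = \<Phi> d (cmap d x', u))"
    using bij_imp_bij_inv[OF L(2)] by blast
qed

lemma isometric_at_trans: "isometric_at x c x' d \<Longrightarrow> isometric_at x' d x'' e \<Longrightarrow> isometric_at x c x'' e"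
  unfolding isometric_at_def
proof (elim exE conjE)
  fix L M assume L: "linear L" "bij L" "\<forall>u. \<Phi> d (cmap d x', L u) = \<Phi> c (cmap c x, u)"
    and M: "linear M" "bij M" "\<forall>u. \<Phi> e (cmap e x'', M u) = \<Phi> d (cmap d x', u)"
  show "\<exists>L. linear L \<and> bij L \<and> (\<forall>u. \<Phi> e (cmap e x'', L u) = \<Phi> c (cmap c x, u))"
    using linear_compose[OF L(1) M(1)] bij_comp[OF L(2) M(2)] L(3) M(3)
    by (intro exI[of _ "M \<circ> L"]) simp
qed

lemma isometric_at_change:
  assumes "c \<in> charts_at A x" "d \<in> charts_at A x" shows "isometric_at x c x d"
proof -
  let ?L = "fd (transition c d) (cmap c x)" and ?M = "fd (transition d c) (cmap d x)"
  have "?M (?L u) = u" "?L (?M u) = u" for u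
    using transition_cocycle[OF assms assms(1)] transition_cocycle[OF assms(2,1,2)] transition_self assms by simp_all
  then have "bij ?L" by (intro o_bij[of ?M]) auto
  then show ?thesis
    unfolding isometric_at_def using linear_transition[OF assms] local_rep_change[OF assms] by blast
qed

text \<open>Being linearly isometric is an equivalence relation on points, independent of the
  charts, and its classes are open by radial parallel transport; connectedness leaves one
  class.\<close>

lemma isometric_everywhere:
  assumes conn: "connected (points A)" and c: "c \<in> charts_at A x" and d: "d \<in> charts_at A x'"
  shows "isometric_at x c x' d"
proof -
  define R where "R x x' \<longleftrightarrow> (\<exists>c\<in>charts_at A x. \<exists>d\<in>charts_at A x'. isometric_at x c x' d)" for x x'
  have "R x x'"
  proof (rule connected_equivalence_relation[OF conn])
    show "x \<in> points A" "x' \<in> points A" using c d by (auto simp: points_def charts_at_iff)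
    show "R x' x" if "R x x'" for x x' using that isometric_at_sym unfolding R_def by blast
    show "R x x''" if "R x x'" "R x' x''" for x x' x''
      using that isometric_at_trans isometric_at_change unfolding R_def by meson
    fix x assume "x \<in> points A"
    then obtain c where c: "c \<in> A" "x \<in> cdom c" by (auto simp: points_def)
    let ?y = "cmap c x"
    have y: "?y \<in> cimg c" by (rule cmap_in[OF c(2)])
    obtain r T where T: "0 < r" "cball ?y r \<subseteq> cimg c" "\<And>z. linear (T z)"
      "\<And>v t u. norm (t *\<^sub>R v) < r \<Longrightarrow> \<Phi> c (?y + t *\<^sub>R v, T (?y + t *\<^sub>R v) u) = \<Phi> c (?y, u)"
      by (rule radial_isometry[OF c(1) y]) (rule that)
    define N where "N = cdom c \<inter> cmap c -` ball ?y r"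
    have "open N"
      unfolding N_def by (rule continuous_open_preimage[OF continuous_cmap[OF c(1)] open_cdom[OF c(1)] open_ball])
    moreover have "N \<subseteq> points A" using c(1) by (auto simp: N_def points_def)
    ultimately have "openin (top_of_set (points A)) N" by (simp add: open_subset)
    moreover have "x \<in> N" using c T(1) by (simp add: N_def)
    moreover have "R x x'" if x': "x' \<in> N" for x'
    proof -
      let ?z = "cmap c x'"
      have z: "?z \<in> cimg c" using x' by (simp add: cmap_in N_def)
      interpret p: smooth_gauge "\<lambda>u. \<Phi> c (?y, u)" by (rule smooth_gauge_local_rep[OF finsler c(1) y])
      interpret q: smooth_gauge "\<lambda>u. \<Phi> c (?z, u)" by (rule smooth_gauge_local_rep[OF finsler c(1) z])
      have iso: "\<Phi> c (?z, T ?z u) = \<Phi> c (?y, u)" for u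
        using T(4)[of 1 "?z - ?y" u] x' by (simp add: N_def dist_norm norm_minus_commute)
      \<comment> \<open>Transport is so far only linear; it is injective because it preserves the
        value of the gauge, which is positive off zero.\<close>
      have "u = 0" if "T ?z u = 0" for u
        using iso[of u] that q.zero p.pos[of u] by (cases "u = 0") auto
      then have "inj (T ?z)" using linear_injective_0[OF T(3)] by blast
      then have "bij (T ?z)" using linear_inj_imp_surj[OF T(3)] by (simp add: bij_def)
      then have "isometric_at x c x' c"
        unfolding isometric_at_def using T(3) iso by blast
      moreover have "c \<in> charts_at A x" "c \<in> charts_at A x'" using c x' by (auto simp: charts_at_iff N_def)
      ultimately show "R x x'" unfolding R_def by blast
    qed
    ultimately show "\<exists>T. openin (top_of_set (points A)) T \<and> x \<in> T \<and> (\<forall>x'\<in>T. R x x')" by blast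
  qed
  then obtain c' d' where cd: "c' \<in> charts_at A x" "d' \<in> charts_at A x'" "isometric_at x c' x' d'"
    unfolding R_def by blast
  show ?thesis
    by (rule isometric_at_trans[OF isometric_at_change[OF c cd(1)]
        isometric_at_trans[OF cd(3) isometric_at_change[OF cd(2) d]]])
qed

text \<open>The candidate metric is the polarization of the square of \<open>F\<close>, hence
  chart-free and smooth. That it is bilinear at each point is carried over from \<open>x\<close> by
  a linear isometry of tangent spaces.\<close>

lemma riemannian_if_euclidean_somewhere:
  assumes conn: "connected (points A)" and c: "c \<in> charts_at A x"
    and B: "bilinear B" "\<And>u. (\<Phi> c (cmap c x, u))\<^sup>2 = B u u"
  shows "is_riemannian A F"
proof -
  define g where "g x \<xi> \<eta> = ((F x (\<lambda>c. \<xi> c + \<eta> c))\<^sup>2 - (F x (\<lambda>c. \<xi> c + (- 1) *\<^sub>R \<eta> c))\<^sup>2) / 4" for x \<xi> \<eta>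
  have g_rep: "g x' (tvec_of A d x' u) (tvec_of A d x' v) =
      ((\<Phi> d (cmap d x', u + v))\<^sup>2 - (\<Phi> d (cmap d x', u - v))\<^sup>2) / 4"
    if d: "d \<in> charts_at A x'" for x' d u v
  proof -
    have "(\<lambda>e. tvec_of A d x' u e + tvec_of A d x' v e) = tvec_of A d x' (u + v)"
      by (rule tvec_of_add[OF d, symmetric])
    moreover have "(\<lambda>e. tvec_of A d x' u e + (- 1) *\<^sub>R tvec_of A d x' v e) = tvec_of A d x' (u - v)"
      using tvec_of_add[OF d, of u "(- 1) *\<^sub>R v"] unfolding tvec_of_scale[OF d] by simp
    ultimately show ?thesis unfolding g_def local_rep_cmap[OF d] by (simp only:)
  qed
  have quad: "\<exists>S. bilinear S \<and> (\<forall>u v. S u v = S v u) \<and> (\<forall>u. (\<Phi> d (cmap d x', u))\<^sup>2 = S u u)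
      \<and> (\<forall>u v. g x' (tvec_of A d x' u) (tvec_of A d x' v) = S u v)"
    if d: "d \<in> charts_at A x'" for x' d
  proof -
    from isometric_everywhere[OF conn d c] obtain L where L: "linear L"
      "\<And>u. \<Phi> c (cmap c x, L u) = \<Phi> d (cmap d x', u)" unfolding isometric_at_def by blast
    \<comment> \<open>Symmetrized because \<open>B\<close> is only known on the diagonal;
      \<open>B\<close> itself may fail to be symmetric.\<close>
    define S where "S u v = (B (L u) (L v) + B (L v) (L u)) / 2" for u v
    note bl = bilinear_ladd[OF B(1)] bilinear_radd[OF B(1)] bilinear_lmul[OF B(1)] bilinear_rmul[OF B(1)]
      linear_add[OF L(1)] linear_scale[OF L(1)]
    have S: "bilinear S" unfolding bilinear_def S_def
      by (auto intro!: linearI simp: bl algebra_simps add_divide_distrib)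
    have sq: "(\<Phi> d (cmap d x', u))\<^sup>2 = S u u" for u
      using B(2)[of "L u"] by (simp add: L(2) S_def)
    have sym: "S u v = S v u" for u v by (simp add: S_def)
    have "g x' (tvec_of A d x' u) (tvec_of A d x' v) = S u v" for u v
      unfolding g_rep[OF d] sq
      by (simp add: bilinear_ladd[OF S] bilinear_radd[OF S] bilinear_lsub[OF S] bilinear_rsub[OF S] sym[of v u])
    then show ?thesis using S sq sym by blast
  qed
  have main: "g x' \<xi> \<eta> = g x' \<eta> \<xi> \<and> (\<forall>l. g x' (\<lambda>c. l *\<^sub>R \<xi> c) \<eta> = l * g x' \<xi> \<eta>) \<and>
      (\<forall>\<zeta>\<in>tangent_space A x'. g x' (\<lambda>c. \<xi> c + \<zeta> c) \<eta> = g x' \<xi> \<eta> + g x' \<zeta> \<eta>) \<and>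
      (\<xi> \<noteq> (\<lambda>c. 0) \<longrightarrow> 0 < g x' \<xi> \<xi>) \<and> F x' \<xi> = riem_norm g x' \<xi>"
    if x': "x' \<in> points A" and \<xi>: "\<xi> \<in> tangent_space A x'" and \<eta>: "\<eta> \<in> tangent_space A x'" for x' \<xi> \<eta>
  proof -
    obtain d where dA: "d \<in> A" "x' \<in> cdom d" using x' by (auto simp: points_def)
    then have d: "d \<in> charts_at A x'" by (simp add: charts_at_iff)
    interpret p: smooth_gauge "\<lambda>u. \<Phi> d (cmap d x', u)"
      by (rule smooth_gauge_local_rep[OF finsler dA(1) cmap_in[OF dA(2)]])
    obtain S where S: "bilinear S" "\<And>u v. S u v = S v u" "\<And>u. (\<Phi> d (cmap d x', u))\<^sup>2 = S u u"
      "\<And>u v. g x' (tvec_of A d x' u) (tvec_of A d x' v) = S u v" using quad[OF d] by blast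
    have gS: "g x' \<xi> \<eta> = S (\<xi> d) (\<eta> d)" if "\<xi> \<in> tangent_space A x'" "\<eta> \<in> tangent_space A x'" for \<xi> \<eta>
      using S(4)[of "\<xi> d" "\<eta> d"] tvec_of_component[OF that(1) d] tvec_of_component[OF that(2) d] by simp
    have add: "(\<lambda>c. \<xi> c + \<zeta> c) \<in> tangent_space A x'" if "\<zeta> \<in> tangent_space A x'" for \<zeta>
      using tvec_of_in[OF d, of "\<xi> d + \<zeta> d"]
      unfolding tvec_of_add[OF d] tvec_of_component[OF \<xi> d] tvec_of_component[OF that d] .
    have scale: "(\<lambda>c. l *\<^sub>R \<xi> c) \<in> tangent_space A x'" for l
      using tvec_of_in[OF d, of "l *\<^sub>R \<xi> d"] unfolding tvec_of_scale[OF d] tvec_of_component[OF \<xi> d] .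
    have F: "F x' \<xi> = \<Phi> d (cmap d x', \<xi> d)" by (rule eq_local_rep[OF \<xi> d])
    have nn: "\<Phi> d (cmap d x', u) \<ge> 0" for u using p.pos[of u] p.zero by (cases "u = 0") auto
    have "0 < S (\<xi> d) (\<xi> d)" if "\<xi> \<noteq> (\<lambda>c. 0)"
    proof -
      have "\<xi> d \<noteq> 0" using that tvec_of_component[OF \<xi> d] tvec_of_eq_0_iff[OF d] by metis
      then show ?thesis using p.pos[of "\<xi> d"] by (simp add: S(3)[symmetric])
    qed
    moreover have "riem_norm g x' \<xi> = F x' \<xi>"
      unfolding riem_norm_def gS[OF \<xi> \<xi>] S(3)[symmetric] F using nn by simp
    ultimately show ?thesis
      using \<xi> \<eta> add scale
      by (auto simp: gS bilinear_ladd[OF S(1)] bilinear_lmul[OF S(1)] S(2)[of "\<eta> d" "\<xi> d"])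
  qed
  have "smooth_on (cimg d) (\<lambda>y. metric_rep A g d y u v)" if d: "d \<in> A" for d u v
  proof -
    \<comment> \<open>The zero vector is separate, as \<open>F\<close> is smooth only off the zero
      section; there the square vanishes identically.\<close>
    have sm: "smooth_on (cimg d) (\<lambda>y. \<Phi> d (y, a) * \<Phi> d (y, a))" for a
    proof (cases "a = 0")
      case True
      have "smooth_on (cimg d) (\<lambda>y. 0 :: real)" by (rule smooth_on_const)
      moreover have "\<Phi> d (y, a) * \<Phi> d (y, a) = 0" if "y \<in> cimg d" for y
        using smooth_gauge.zero[OF smooth_gauge_local_rep[OF finsler d that]] True by simp
      ultimately show ?thesis
        using smooth_on_cong[OF open_cimg[OF d], of "\<lambda>y. \<Phi> d (y, a) * \<Phi> d (y, a)" "\<lambda>_. 0"] by simp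
    next
      case False
      have s: "smooth_on (cimg d \<times> (UNIV - {0})) (\<Phi> d)" using finsler d by (simp add: finsler_metric_def)
      have "smooth_on (cimg d) (\<lambda>y. \<Phi> d (y, a))"
        by (rule smooth_on_compose[OF open_cimg[OF d] _ _ _ s, where f = "\<lambda>y. (y, a)"])
          (use False in \<open>auto intro!: open_Times open_cimg[OF d] smooth_on_Pair smooth_on_const smooth_on_id open_Diff\<close>)
      then show ?thesis by (intro smooth_on_mult open_cimg d)
    qed
    have "smooth_on (cimg d) (\<lambda>y. (1/4) * (\<Phi> d (y, u + v) * \<Phi> d (y, u + v) - \<Phi> d (y, u - v) * \<Phi> d (y, u - v)))"
      by (intro smooth_on_mult[OF open_cimg[OF d]] smooth_on_const smooth_on_diff sm open_cimg d)
    moreover have "(1/4) * (\<Phi> d (y, u + v) * \<Phi> d (y, u + v) - \<Phi> d (y, u - v) * \<Phi> d (y, u - v)) = metric_rep A g d y u v"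
      if "y \<in> cimg d" for y
      unfolding metric_rep_def g_rep[OF chart_at_cinv[OF d that]] cmap_cinv[OF d that] by (simp add: power2_eq_square)
    ultimately show ?thesis
      using smooth_on_cong[OF open_cimg[OF d], of _ "\<lambda>y. metric_rep A g d y u v"] by (metis (no_types, lifting))
  qed
  then have "riemannian_metric A g"
    unfolding riemannian_metric_def using main by blast
  then show ?thesis unfolding is_riemannian_def using main by blast
qed

end

section \<open>Geodesics of the flat metric\<close>

context atlas
begin

lemma riemannian_chart:
  assumes g: "riemannian_metric A g" and d: "d \<in> A" and z: "z \<in> cimg d"
  shows metric_rep_bilinear: "bilinear (metric_rep A g d z)"
    and metric_rep_sym: "metric_rep A g d z u v = metric_rep A g d z v u"
    and metric_rep_pos: "u \<noteq> 0 \<Longrightarrow> 0 < metric_rep A g d z u u"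
proof -
  let ?x = "cinv d z"
  have dx: "d \<in> charts_at A ?x" by (rule chart_at_cinv[OF d z])
  note tin = tvec_of_in[OF dx]
  have G: "\<forall>\<xi>\<in>tangent_space A ?x.
        (\<forall>\<eta>\<in>tangent_space A ?x.
           g ?x \<xi> \<eta> = g ?x \<eta> \<xi> \<and>
           (\<forall>l. g ?x (\<lambda>c. l *\<^sub>R \<xi> c) \<eta> = l * g ?x \<xi> \<eta>) \<and>
           (\<forall>\<zeta>\<in>tangent_space A ?x. g ?x (\<lambda>c. \<xi> c + \<zeta> c) \<eta> = g ?x \<xi> \<eta> + g ?x \<zeta> \<eta>)) \<and>
        (\<xi> \<noteq> (\<lambda>c. 0) \<longrightarrow> 0 < g ?x \<xi> \<xi>)"
    using g points_cinv[OF d z] unfolding riemannian_metric_def by blast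
  have s: "metric_rep A g d z u v = metric_rep A g d z v u" for u v
    unfolding metric_rep_def using G tin by blast
  have a: "metric_rep A g d z (u + u') v = metric_rep A g d z u v + metric_rep A g d z u' v" for u u' v
    unfolding metric_rep_def tvec_of_add[OF dx] using G tin by blast
  have m: "metric_rep A g d z (l *\<^sub>R u) v = l * metric_rep A g d z u v" for l u v
    unfolding metric_rep_def tvec_of_scale[OF dx] using G tin by blast
  show "bilinear (metric_rep A g d z)"
    unfolding bilinear_def
    by (auto intro!: linearI simp: a m s[of _ "_ + _"] s[of _ "_ *\<^sub>R _"]) (simp_all add: s)
  show "metric_rep A g d z u v = metric_rep A g d z v u" by (rule s)
  show "0 < metric_rep A g d z u u" if "u \<noteq> 0"
    unfolding metric_rep_def using G tin that tvec_of_eq_0_iff[OF dx] by blast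
qed

lemma smooth_bilinear_metric_rep:
  assumes "riemannian_metric A g" "d \<in> A" shows "smooth_bilinear (cimg d) (metric_rep A g d)"
  unfolding smooth_bilinear_def
proof (intro conjI ballI allI open_cimg assms metric_rep_bilinear)
  show "smooth_on (cimg d) (\<lambda>y. metric_rep A g d y h s)" for h s
    using assms unfolding riemannian_metric_def by blast
qed

lemma fd_metric_rep:
  assumes "levi_civita A g \<Gamma>" "d \<in> A" "z \<in> cimg d"
  shows "fd (\<lambda>z. metric_rep A g d z u v) z w
    = metric_rep A g d z (\<Gamma> d z w u) v + metric_rep A g d z u (\<Gamma> d z w v)"
proof -
  have "((\<lambda>z. metric_rep A g d z u v) has_derivative
         (\<lambda>w. metric_rep A g d z (\<Gamma> d z w u) v + metric_rep A g d z u (\<Gamma> d z w v))) (at z)"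
    using assms unfolding levi_civita_def by blast
  from fd_eq[OF this] show ?thesis by simp
qed

text \<open>Squaring removes the root, so this Lagrangian is quadratic in the velocity and
  differentiable at zero velocity too.\<close>

lemma fd_riemannian_lagrangian:
  assumes g: "riemannian_metric A g" and d: "d \<in> A" and z: "z \<in> cimg d"
  shows "fd (lagrangian A (riem_norm g) d) (z, u) X
    = (fd (\<lambda>z. metric_rep A g d z u u) z (fst X)) / 2 + metric_rep A g d z u (snd X)"
proof -
  have L: "lagrangian A (riem_norm g) d q = metric_rep A g d (fst q) (snd q) (snd q) / 2"
    if "q \<in> cimg d \<times> UNIV" for q
  proof -
    have q1: "fst q \<in> cimg d" using that by auto
    have "0 \<le> metric_rep A g d (fst q) (snd q) (snd q)"
      using metric_rep_pos[OF g d q1, of "snd q"] bilinear_lzero[OF metric_rep_bilinear[OF g d q1]]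
      by (cases "snd q = 0") auto
    then show ?thesis
      by (simp add: lagrangian_def local_rep_def riem_norm_def metric_rep_def case_prod_unfold)
  qed
  note bil = metric_rep_bilinear[OF g d z]
  have "((\<lambda>q. metric_rep A g d (fst q) (snd q) (snd q)) has_derivative
    (\<lambda>X. fd (\<lambda>z'. metric_rep A g d z' (snd (z, u)) (snd (z, u))) (fst (z, u)) (fst X)
      + metric_rep A g d (fst (z, u)) (snd X) (snd (z, u)) + metric_rep A g d (fst (z, u)) (snd (z, u)) (snd X))) (at (z, u))"
  proof (rule has_derivative_bilinear_family[OF smooth_bilinear_metric_rep[OF g d], of fst "(z, u)" UNIV fst snd snd snd snd])
    show "(fst has_derivative fst) (at (z, u))" "(snd has_derivative snd) (at (z, u))"
      "(snd has_derivative snd) (at (z, u))"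
      by (intro bounded_linear_imp_has_derivative bounded_linear_fst bounded_linear_snd)+
  qed (use z in auto)
  then have "((\<lambda>q. metric_rep A g d (fst q) (snd q) (snd q) / 2) has_derivative
    (\<lambda>X. (fd (\<lambda>z. metric_rep A g d z u u) z (fst X)) / 2 + metric_rep A g d z u (snd X))) (at (z, u))"
    by (auto intro!: derivative_eq_intros simp: metric_rep_sym[OF g d z, of "snd _" u])
  then have "(lagrangian A (riem_norm g) d has_derivative
    (\<lambda>X. (fd (\<lambda>z. metric_rep A g d z u u) z (fst X)) / 2 + metric_rep A g d z u (snd X))) (at (z, u))"
    by (rule has_derivative_transform_within_open[where s = "cimg d \<times> UNIV"])
      (use z L in \<open>auto intro!: open_Times open_cimg[OF d]\<close>)
  from fd_eq[OF this] show ?thesis by simp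
qed

text \<open>The velocity is parallel, so the geodesic equation holds in every chart. There metric
  compatibility turns both sides of the Euler--Lagrange equation into the product of the velocity
  \<open>V\<close> with \<open>\<Gamma> w V\<close>.\<close>

lemma riemannian_geodesicI:
  assumes g: "riemannian_metric A g" and \<Gamma>: "levi_civita A g \<Gamma>" and c: "c \<in> A"
    and I: "open_interval I" and \<eta>: "smooth_on I \<eta>" "\<eta> ` I \<subseteq> cimg c"
    and d\<eta>: "\<And>t. t \<in> I \<Longrightarrow> (\<eta> has_vector_derivative \<eta>' t) (at t)"
    and dd\<eta>: "\<And>t. t \<in> I \<Longrightarrow> (\<eta>' has_vector_derivative - \<Gamma> c (\<eta> t) (\<eta>' t) (\<eta>' t)) (at t)"
    and nz: "\<And>t. t \<in> I \<Longrightarrow> \<eta>' t \<noteq> 0"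
  shows "geodesic A (riem_norm g) I (cinv c \<circ> \<eta>)"
  unfolding geodesic_def Let_def
proof (intro conjI ballI allI)
  let ?\<gamma> = "cinv c \<circ> \<eta>"
  have conn: "symmetric_connection A \<Gamma>" using \<Gamma> by (simp add: levi_civita_def)
  have oI: "open I" using I by (simp add: open_interval_def)
  have \<eta>t: "\<eta> t \<in> cimg c" if "t \<in> I" for t using that \<eta>(2) by auto
  show curve: "smooth_curve A I ?\<gamma>" by (rule smooth_chart_curve[OF c I \<eta>])
  have vel: "velocity A ?\<gamma> t = tvec_of A c (cinv c (\<eta> t)) (\<eta>' t)" if "t \<in> I" for t
    by (rule velocity_chart_curve[OF c \<eta>t[OF that] d\<eta>[OF that]])
  show "velocity A ?\<gamma> t \<noteq> (\<lambda>c. 0)" if "t \<in> I" for t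
    unfolding vel[OF that] tvec_of_eq_0_iff[OF chart_at_cinv[OF c \<eta>t[OF that]]] by (rule nz[OF that])
  fix t d w assume t: "t \<in> I" and "d \<in> charts_at A (?\<gamma> t)"
  then have d: "d \<in> charts_at A (cinv c (\<eta> t))" and dA: "d \<in> A" by (simp_all add: charts_at_iff)
  define Z where "Z s = cmap d (?\<gamma> s)" for s
  define V where "V s = velocity A ?\<gamma> s d" for s
  let ?S = "{s \<in> I. cinv c (\<eta> s) \<in> cdom d}"
  have oS: "open ?S"
    by (rule open_curve_overlap[OF c dA oI smooth_on_continuous[OF \<eta>(1)] \<eta>(2)])
  have tS: "t \<in> ?S" using t d by (simp add: charts_at_iff)
  have ZS: "Z s \<in> cimg d" if "s \<in> ?S" for s using that by (simp add: Z_def cmap_in)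
  let ?L = "lagrangian A (riem_norm g) d"
  let ?m = "metric_rep A g d"
  note zt = ZS[OF tS]
  note bil = metric_rep_bilinear[OF g dA zt] and sym = metric_rep_sym[OF g dA zt]
  have Zd: "(Z has_vector_derivative V t) (at t)"
  proof -
    have D: "((cmap d \<circ> ?\<gamma>) has_vector_derivative fd (transition c d) (\<eta> t) (\<eta>' t)) (at t)"
      by (rule chart_curve_derivative[OF c \<eta>t[OF t] d\<eta>[OF t] d])
    have "V t = fd (transition c d) (\<eta> t) (\<eta>' t)"
      unfolding V_def vel[OF t] tvec_of_at[OF d] cmap_cinv[OF c \<eta>t[OF t]] ..
    moreover have "Z = cmap d \<circ> ?\<gamma>" by (auto simp: Z_def)
    ultimately show ?thesis using D by simp
  qed
  have "parallel_along A \<Gamma> I ?\<gamma> (\<lambda>t. tvec_of A c (cinv c (\<eta> t)) (\<eta>' t))"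
    by (rule parallel_chart_curve[OF conn c oI \<eta>(2) d\<eta> dd\<eta>])
  then have "((\<lambda>s. tvec_of A c (cinv c (\<eta> s)) (\<eta>' s) d) has_vector_derivative
     - \<Gamma> d (cmap d (?\<gamma> t)) (velocity A ?\<gamma> t d) (tvec_of A c (cinv c (\<eta> t)) (\<eta>' t) d)) (at t)"
    using t d unfolding parallel_along_def by auto
  then have "((\<lambda>s. tvec_of A c (cinv c (\<eta> s)) (\<eta>' s) d) has_vector_derivative - \<Gamma> d (Z t) (V t) (V t)) (at t)"
    by (simp add: Z_def V_def vel[OF t])
  then have Vd: "(V has_vector_derivative - \<Gamma> d (Z t) (V t) (V t)) (at t)"
    by (rule has_vector_derivative_transform_within_open[OF _ oI t]) (simp add: V_def vel)
  have "((\<lambda>s. ?m (Z s) (V s) w) has_derivative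
    (\<lambda>a. fd (\<lambda>z. ?m z (V t) w) (Z t) (a *\<^sub>R V t) + ?m (Z t) (a *\<^sub>R - \<Gamma> d (Z t) (V t) (V t)) w + ?m (Z t) (V t) 0)) (at t)"
    by (rule has_derivative_bilinear_family[OF smooth_bilinear_metric_rep[OF g dA], of Z t UNIV _ V _ "\<lambda>_. w" "\<lambda>_. 0"])
      (use zt Zd Vd in \<open>auto simp: has_vector_derivative_def\<close>)
  moreover have "fd (\<lambda>z. ?m z (V t) w) (Z t) (a *\<^sub>R V t) + ?m (Z t) (a *\<^sub>R - \<Gamma> d (Z t) (V t) (V t)) w + ?m (Z t) (V t) 0
      = ?m (Z t) (V t) (\<Gamma> d (Z t) w (V t)) * a" for a
  proof -
    have "fd (\<lambda>z. ?m z (V t) w) (Z t) (a *\<^sub>R V t) = a * fd (\<lambda>z. ?m z (V t) w) (Z t) (V t)"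
      using linear_scale[OF has_derivative_linear[OF smooth_on_has_derivative[OF
        smooth_bilinearD(3)[OF smooth_bilinear_metric_rep[OF g dA]] zt]]] by simp
    then show ?thesis
      by (simp add: fd_metric_rep[OF \<Gamma> dA zt] bilinear_lmul[OF bil] bilinear_lneg[OF bil] bilinear_rzero[OF bil]
          connection_sym[OF conn dA zt, of "V t" w] algebra_simps)
  qed
  ultimately have D: "((\<lambda>s. ?m (Z s) (V s) w) has_real_derivative ?m (Z t) (V t) (\<Gamma> d (Z t) w (V t))) (at t)"
    by (simp add: has_field_derivative_def mult_commute_abs)
  have rhs: "fd ?L (Z t, V t) (w, 0) = ?m (Z t) (V t) (\<Gamma> d (Z t) w (V t))"
    by (simp add: fd_riemannian_lagrangian[OF g dA zt] fd_metric_rep[OF \<Gamma> dA zt] bilinear_rzero[OF bil]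
        sym[of "\<Gamma> d (Z t) w (V t)" "V t"])
  have "((\<lambda>s. fd ?L (Z s, V s) (0, w)) has_real_derivative ?m (Z t) (V t) (\<Gamma> d (Z t) w (V t))) (at t)"
  proof (rule has_field_derivative_transform_within_open[OF D oS tS])
    fix s assume "s \<in> ?S"
    note zs = ZS[OF this]
    have "fd (\<lambda>z. ?m z (V s) (V s)) (Z s) 0 = 0"
      using fd_metric_rep[OF \<Gamma> dA zs, of "V s" "V s" 0]
        bilinear_lzero[OF connection_bilinear[OF conn dA zs]]
        bilinear_lzero[OF metric_rep_bilinear[OF g dA zs]] bilinear_rzero[OF metric_rep_bilinear[OF g dA zs]] by simp
    then show "?m (Z s) (V s) w = fd ?L (Z s, V s) (0, w)"
      by (simp add: fd_riemannian_lagrangian[OF g dA zs])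
  qed
  then show "((\<lambda>s. fd ?L (cmap d (?\<gamma> s), velocity A ?\<gamma> s d) (0, w)) has_real_derivative
      fd ?L (cmap d (?\<gamma> t), velocity A ?\<gamma> t d) (w, 0)) (at t)"
    using rhs by (simp add: Z_def V_def)
qed

text \<open>In affine coordinates geodesics are straight lines: \<open>\<eta>\<close> is the image
  of \<open>t b\<close> under the inverse coordinate map, and its velocity is the value of a
  parallel field along it.\<close>

lemma flat_geodesic:
  assumes g: "riemannian_metric A g" and \<Gamma>: "levi_civita A g \<Gamma>"
    and flat: "\<And>y u v w. y \<in> cimg c \<Longrightarrow> curv (\<Gamma> c) y u v w = 0"
    and c: "c \<in> A" and y: "y \<in> cimg c" and b: "b \<noteq> 0"
  obtains I \<eta> \<eta>' where "0 \<in> I" "\<eta> 0 = y" "\<eta>' 0 = b" "\<eta> ` I \<subseteq> cimg c" "open_interval I"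
    "\<And>t. t \<in> I \<Longrightarrow> (\<eta> has_vector_derivative \<eta>' t) (at t)"
    "\<And>t. t \<in> I \<Longrightarrow> (\<eta>' has_vector_derivative - \<Gamma> c (\<eta> t) (\<eta>' t) (\<eta>' t)) (at t)"
    "geodesic A (riem_norm g) I (cinv c \<circ> \<eta>)"
proof -
  have conn: "symmetric_connection A \<Gamma>" using \<Gamma> by (simp add: levi_civita_def)
  obtain r f h E G where fl: "0 < r" "ball y r \<subseteq> cimg c" "f y = 0" "open (f ` ball y r)"
    "homeomorphism (ball y r) (f ` ball y r) f h"
    "smooth_on (ball y r) f" "smooth_on (f ` ball y r) h"
    "\<And>z. linear (E z)" "\<And>z. linear (G z)" "\<And>b. G y b = b"
    "\<And>z b. z \<in> ball y r \<Longrightarrow> E z (G z b) = b" "\<And>z b. z \<in> ball y r \<Longrightarrow> G z (E z b) = b"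
    "\<And>z. z \<in> ball y r \<Longrightarrow> (f has_derivative E z) (at z)"
    "\<And>z. z \<in> f ` ball y r \<Longrightarrow> (h has_derivative G (h z)) (at z)"
    "\<And>z b. z \<in> ball y r \<Longrightarrow> ((\<lambda>z. G z b) has_derivative (\<lambda>v. - \<Gamma> c z v (G z b))) (at z)"
  proof (rule flat_coordinates[OF smooth_bilinear_connection[OF conn c] y connection_sym[OF conn c]
        flat[unfolded curv_def]], assumption, assumption)
  qed (rule that)
  have "0 \<in> f ` ball y r" using fl(1,3) by (metis centre_in_ball imageI)
  then obtain \<epsilon> where \<epsilon>: "\<epsilon> > 0" "ball 0 \<epsilon> \<subseteq> f ` ball y r" using fl(4) openE by blast
  \<comment> \<open>Keeps \<open>t b\<close> in the ball of radius \<open>\<epsilon>\<close> on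
    which the inverse coordinate map is defined.\<close>
  define I where "I = {-(\<epsilon> / norm b)<..<\<epsilon> / norm b}"
  have "0 < \<epsilon> / norm b" using \<epsilon>(1) b by simp
  then have I: "open_interval I" "open I" "0 \<in> I"
    unfolding I_def open_interval_def is_interval_convex_1 by auto
  have tb: "t *\<^sub>R b \<in> f ` ball y r" if "t \<in> I" for t
  proof -
    have "\<bar>t\<bar> < \<epsilon> / norm b" using that by (auto simp: I_def)
    then have "norm (t *\<^sub>R b) < \<epsilon>" using b by (simp add: field_simps)
    then show ?thesis using \<epsilon>(2) by auto
  qed
  define \<eta> where "\<eta> t = h (t *\<^sub>R b)" for t
  define \<eta>' where "\<eta>' t = G (\<eta> t) b" for t
  have hB: "h z \<in> ball y r" if "z \<in> f ` ball y r" for z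
    using fl(5) that by (auto simp: homeomorphism_def)
  have \<eta>B: "\<eta> t \<in> ball y r" if "t \<in> I" for t unfolding \<eta>_def by (rule hB[OF tb[OF that]])
  have \<eta>s: "smooth_on I \<eta>"
    unfolding \<eta>_def
    by (rule smooth_on_compose[OF I(2) fl(4) _ _ fl(7), where f = "\<lambda>t. t *\<^sub>R b"])
      (use tb in \<open>auto intro!: smooth_on_scaleR smooth_on_const smooth_on_id I(2)\<close>)
  have d\<eta>: "(\<eta> has_vector_derivative \<eta>' t) (at t)" if t: "t \<in> I" for t
  proof -
    have "((\<lambda>t. h (t *\<^sub>R b)) has_derivative (\<lambda>a. G (h (t *\<^sub>R b)) (a *\<^sub>R b))) (at t)"
      by (rule has_derivative_compose[of "\<lambda>t. t *\<^sub>R b" _ t UNIV h, OF _ fl(14)[OF tb[OF t]]])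
        (auto intro!: derivative_eq_intros)
    then show ?thesis
      by (simp add: has_vector_derivative_def \<eta>_def[abs_def] \<eta>'_def linear_scale[OF fl(9)])
  qed
  have dd\<eta>: "(\<eta>' has_vector_derivative - \<Gamma> c (\<eta> t) (\<eta>' t) (\<eta>' t)) (at t)" if t: "t \<in> I" for t
  proof -
    have "((\<lambda>t. G (\<eta> t) b) has_derivative (\<lambda>a. - \<Gamma> c (\<eta> t) (a *\<^sub>R \<eta>' t) (G (\<eta> t) b))) (at t)"
      by (rule has_derivative_compose[of \<eta> "\<lambda>a. a *\<^sub>R \<eta>' t" t UNIV "\<lambda>z. G z b", OF _ fl(15)[OF \<eta>B[OF t]]])
        (use d\<eta>[OF t] in \<open>simp add: has_vector_derivative_def\<close>)
    moreover have "bilinear (\<Gamma> c (\<eta> t))"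
      by (rule connection_bilinear[OF conn c]) (use \<eta>B[OF t] fl(2) in blast)
    ultimately show ?thesis
      by (simp add: has_vector_derivative_def \<eta>'_def[abs_def] bilinear_lmul)
  qed
  have nz: "\<eta>' t \<noteq> 0" if "t \<in> I" for t
    using fl(11)[OF \<eta>B[OF that], of b] b linear_0[OF fl(8)] by (metis \<eta>'_def)
  have \<eta>c: "\<eta> ` I \<subseteq> cimg c" using \<eta>B fl(2) by blast
  have "\<eta> 0 = y" using fl(1,3,5) by (metis \<eta>_def centre_in_ball homeomorphism_apply1 scale_zero_left)
  moreover have "\<eta>' 0 = b" by (simp add: \<eta>'_def \<open>\<eta> 0 = y\<close> fl(10))
  ultimately show thesis
    using that[OF I(3) _ _ \<eta>c I(1) d\<eta> dd\<eta> riemannian_geodesicI[OF g \<Gamma> c I(1) \<eta>s \<eta>c d\<eta> dd\<eta> nz]] by blast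
qed

end

lemma std_simps:
  "cdom std_chart = UNIV" "cmap std_chart = id" "cinv std_chart = id" "c \<in> std_atlas \<longleftrightarrow> c = std_chart"
  "points std_atlas = UNIV" "charts_at std_atlas x = {std_chart}"
  by (auto simp: std_chart_def std_atlas_def cinv_def points_def charts_at_def)

context berwald_atlas
begin

text \<open>The reparametrized geodesic \<open>\<eta> \<circ> \<theta>\<close> reaches
  \<open>y\<close> with velocity \<open>k b\<close> and acceleration
  \<open>a b - k\<^sup>2 \<Gamma>' b b\<close>. The chain rule turns the Euler--Lagrange equation at
  that one instant into a pointwise identity.\<close>

lemma euler_lagrange_of_flat_geodesic:
  assumes g: "riemannian_metric A g" and \<Gamma>': "levi_civita A g \<Gamma>'"
    and flat: "\<And>y u v w. y \<in> cimg c \<Longrightarrow> curv (\<Gamma>' c) y u v w = 0"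
    and equiv: "geodesically_equivalent A g F"
    and c: "c \<in> A" and y: "y \<in> cimg c" and b: "b \<noteq> 0"
  shows "\<exists>k>0. \<exists>a. \<forall>w. fd (\<lambda>q. fd (\<lambda>q. (\<Phi> c q)\<^sup>2 / 2) q (0, w)) (y, k *\<^sub>R b)
      (k *\<^sub>R b, a *\<^sub>R b - k\<^sup>2 *\<^sub>R \<Gamma>' c y b b) = fd (\<lambda>q. (\<Phi> c q)\<^sup>2 / 2) (y, k *\<^sub>R b) (w, 0)"
proof -
  interpret C: berwald_chart "cimg c" "\<Gamma> c" "\<Phi> c" by (rule berwald_chart[OF c])
  have Lag: "lagrangian A F c = C.Lag" by (auto simp: lagrangian_def)
  obtain I \<eta> \<eta>' where \<eta>: "0 \<in> I" "\<eta> 0 = y" "\<eta>' 0 = b" "\<eta> ` I \<subseteq> cimg c" "open_interval I"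
    "\<And>t. t \<in> I \<Longrightarrow> (\<eta> has_vector_derivative \<eta>' t) (at t)"
    "\<And>t. t \<in> I \<Longrightarrow> (\<eta>' has_vector_derivative - \<Gamma>' c (\<eta> t) (\<eta>' t) (\<eta>' t)) (at t)"
    "geodesic A (riem_norm g) I (cinv c \<circ> \<eta>)"
    by (rule flat_geodesic[OF g \<Gamma>' flat c y b], assumption) (rule that)
  have "unparametrized_geodesic A F I (cinv c \<circ> \<eta>)"
    using equiv \<eta>(8) unfolding geodesically_equivalent_def by blast
  then obtain J \<theta> where J: "open_interval J" "smooth_on J \<theta>" "\<theta> ` J = I" "\<forall>t\<in>J. 0 < deriv \<theta> t"
    "geodesic A F J ((cinv c \<circ> \<eta>) \<circ> \<theta>)" unfolding unparametrized_geodesic_def by blast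
  \<comment> \<open>The parameter at which the reparametrized curve passes through
    \<open>y\<close>.\<close>
  obtain t0 where t0: "t0 \<in> J" "\<theta> t0 = 0" using \<eta>(1) J(3) by (metis imageE)
  have oJ: "open J" using J(1) by (simp add: open_interval_def)
  have d\<theta>: "(\<theta> has_real_derivative fd \<theta> t 1) (at t)" if "t \<in> J" for t
  proof -
    have D: "(\<theta> has_derivative fd \<theta> t) (at t)" by (rule smooth_on_has_derivative[OF J(2) that])
    have eq: "fd \<theta> t = (*) (fd \<theta> t 1)"
    proof
      fix h
      have "fd \<theta> t (h *\<^sub>R 1) = h *\<^sub>R fd \<theta> t 1" by (rule linear_scale[OF has_derivative_linear[OF D]])
      then show "fd \<theta> t h = fd \<theta> t 1 * h" by (simp only: real_scaleR_def mult_1_right mult_1_left mult.commute)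
    qed
    show ?thesis unfolding has_field_derivative_def by (rule subst[where P = "\<lambda>D. (\<theta> has_derivative D) (at t)", OF eq D])
  qed
  define \<theta>' where "\<theta>' t = fd \<theta> t 1" for t
  have \<theta>'_pos: "\<theta>' t > 0" if "t \<in> J" for t
    using bspec[OF J(4) that] DERIV_imp_deriv[OF d\<theta>[OF that]] by (simp add: \<theta>'_def)
  have d\<theta>': "\<exists>a. (\<theta>' has_real_derivative a) (at t0)"
  proof -
    have "(\<theta>' has_derivative fd \<theta>' t0) (at t0)"
      unfolding \<theta>'_def[abs_def] by (rule smooth_on_has_derivative[OF smooth_on_fd[OF J(2)] t0(1)])
    then have "\<theta>' differentiable (at t0)" by (auto simp: differentiable_def)
    then show ?thesis by (simp add: real_differentiable_def)
  qed
  \<comment> \<open>\<open>a\<close> is the second derivative of \<open>\<theta>\<close> at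
    \<open>t0\<close>; it produces the tangential part of the acceleration.\<close>
  then obtain a where a: "(\<theta>' has_real_derivative a) (at t0)" by blast
  let ?\<beta> = "cinv c \<circ> (\<lambda>t. \<eta> (\<theta> t))"
  have \<theta>I: "\<theta> t \<in> I" if "t \<in> J" for t using J(3) that by blast
  have \<eta>c: "\<eta> (\<theta> t) \<in> cimg c" if "t \<in> J" for t using \<eta>(4) \<theta>I[OF that] by blast
  define \<zeta> where "\<zeta> t = \<theta>' t *\<^sub>R \<eta>' (\<theta> t)" for t
  have d\<beta>: "((\<lambda>t. \<eta> (\<theta> t)) has_vector_derivative \<zeta> t) (at t)" if t: "t \<in> J" for t
    using vector_diff_chain_at[of \<theta> "\<theta>' t" t \<eta> "\<eta>' (\<theta> t)"] d\<theta>[OF t] \<eta>(6)[OF \<theta>I[OF t]]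
    by (simp add: has_real_derivative_iff_has_vector_derivative \<theta>'_def \<zeta>_def o_def)
  have d\<eta>'\<theta>: "((\<lambda>t. \<eta>' (\<theta> t)) has_vector_derivative \<theta>' t0 *\<^sub>R (- \<Gamma>' c y b b)) (at t0)"
    using vector_diff_chain_at[of \<theta> "\<theta>' t0" t0 \<eta>' "- \<Gamma>' c y b b"] d\<theta>[OF t0(1)] \<eta>(7)[OF \<eta>(1)]
    by (simp add: has_real_derivative_iff_has_vector_derivative \<theta>'_def o_def t0(2) \<eta>(2,3))
  define k where "k = \<theta>' t0"
  have \<zeta>0: "\<zeta> t0 = k *\<^sub>R b" by (simp add: \<zeta>_def k_def t0(2) \<eta>(3))
  have d\<zeta>: "(\<zeta> has_vector_derivative a *\<^sub>R b - k\<^sup>2 *\<^sub>R \<Gamma>' c y b b) (at t0)"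
  proof -
    have "(\<zeta> has_vector_derivative \<theta>' t0 *\<^sub>R (\<theta>' t0 *\<^sub>R (- \<Gamma>' c y b b)) + a *\<^sub>R \<eta>' (\<theta> t0)) (at t0)"
      unfolding \<zeta>_def by (rule has_vector_derivative_scaleR[OF a d\<eta>'\<theta>])
    then show ?thesis by (simp add: k_def t0(2) \<eta>(3) power2_eq_square)
  qed
  have k: "k > 0" using \<theta>'_pos[OF t0(1)] by (simp add: k_def)
  have kb: "k *\<^sub>R b \<noteq> 0" using k b by simp
  have "fd (\<lambda>q. fd C.Lag q (0, w)) (y, k *\<^sub>R b) (k *\<^sub>R b, a *\<^sub>R b - k\<^sup>2 *\<^sub>R \<Gamma>' c y b b)
      = fd C.Lag (y, k *\<^sub>R b) (w, 0)" for w
  proof -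
    have pos: "cmap c (?\<beta> t) = \<eta> (\<theta> t)" if "t \<in> J" for t
      using cmap_cinv[OF c \<eta>c[OF that]] by simp
    have vel: "velocity A ?\<beta> t c = \<zeta> t" if t: "t \<in> J" for t
      using velocity_chart_curve[where y = "\<lambda>t. \<eta> (\<theta> t)" and t = t, OF c \<eta>c[OF t] d\<beta>[OF t]]
        tvec_of_self[OF chart_at_cinv[OF c \<eta>c[OF t]]] by simp
    have "c \<in> charts_at A (?\<beta> t0)" using chart_at_cinv[OF c \<eta>c[OF t0(1)]] by simp
    moreover have "geodesic A F J ?\<beta>" using J(5) by (simp add: comp_def)
    ultimately have "((\<lambda>s. fd C.Lag (cmap c (?\<beta> s), velocity A ?\<beta> s c) (0, w)) has_real_derivative
        fd C.Lag (cmap c (?\<beta> t0), velocity A ?\<beta> t0 c) (w, 0)) (at t0)"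
      using t0(1) unfolding geodesic_def Let_def Lag[symmetric] by blast
    then have "((\<lambda>s. fd C.Lag (cmap c (?\<beta> s), velocity A ?\<beta> s c) (0, w)) has_real_derivative
        fd C.Lag (y, k *\<^sub>R b) (w, 0)) (at t0)"
      unfolding pos[OF t0(1)] vel[OF t0(1)] \<zeta>0 t0(2) \<eta>(2) .
    then have EL: "((\<lambda>s. fd C.Lag (\<eta> (\<theta> s), \<zeta> s) (0, w)) has_real_derivative
        fd C.Lag (y, k *\<^sub>R b) (w, 0)) (at t0)"
      by (rule has_field_derivative_transform_within_open[OF _ oJ t0(1)]) (simp only: pos vel)
    let ?N = "\<lambda>q. fd C.Lag q (0, w)"
    have "(?N has_derivative fd ?N (y, k *\<^sub>R b)) (at (y, k *\<^sub>R b))"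
      by (rule smooth_on_has_derivative[OF smooth_on_fd[OF C.smooth_Lag]]) (use y kb in simp)
    then have N: "(?N has_derivative fd ?N (y, k *\<^sub>R b)) (at (\<eta> (\<theta> t0), \<zeta> t0))"
      by (simp only: \<zeta>0 t0(2) \<eta>(2))
    have P: "((\<lambda>s. (\<eta> (\<theta> s), \<zeta> s)) has_derivative
       (\<lambda>r. (r *\<^sub>R k *\<^sub>R b, r *\<^sub>R (a *\<^sub>R b - k\<^sup>2 *\<^sub>R \<Gamma>' c y b b)))) (at t0)"
      using d\<beta>[OF t0(1)] d\<zeta> unfolding \<zeta>0 has_vector_derivative_def by (intro has_derivative_Pair)
    from has_derivative_compose[OF P N] EL
    have "(\<lambda>r. fd ?N (y, k *\<^sub>R b) (r *\<^sub>R k *\<^sub>R b, r *\<^sub>R (a *\<^sub>R b - k\<^sup>2 *\<^sub>R \<Gamma>' c y b b)))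
        = (*) (fd C.Lag (y, k *\<^sub>R b) (w, 0))"
      unfolding has_field_derivative_def by (rule has_derivative_unique)
    from fun_cong[OF this, of 1] show ?thesis by simp
  qed
  then show ?thesis using k by blast
qed

section \<open>Flat Berwald metrics are locally Minkowski\<close>

lemma smooth_norm_local_rep:
  assumes "c \<in> charts_at A x" shows "smooth_norm (\<lambda>u. \<Phi> c (cmap c x, u))"
proof -
  interpret p: smooth_gauge "\<lambda>u. \<Phi> c (cmap c x, u)"
    by (rule smooth_gauge_local_rep[OF finsler]) (use assms in \<open>simp_all add: charts_at_iff cmap_in\<close>)
  have "0 \<le> \<Phi> c (cmap c x, u)" for u using p.pos[of u] p.zero by (cases "u = 0") auto
  then show ?thesis
    unfolding smooth_norm_def using p.smooth p.hom p.tri p.pos by (metis less_irrefl)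
qed

text \<open>Affine coordinates centred at \<open>x\<close> make the norm independent of the point;
  composing them with \<open>L\<close> replaces the norm at \<open>x\<close> by the given norm
  \<open>p\<close>, so one target serves all points.\<close>

lemma flat_local_isometry:
  fixes L :: "real ^ 'n \<Rightarrow> real ^ 'n"
  assumes c: "c \<in> charts_at A x"
    and flat: "\<And>y u v w. y \<in> cimg c \<Longrightarrow> curv (\<Gamma> c) y u v w = 0"
    and L: "linear L" "bij L" "\<And>u. p (L u) = \<Phi> c (cmap c x, u)"
  shows "\<exists>U f. x \<in> U \<and> diffeo_onto_image A std_atlas U f \<and>
    (\<forall>y\<in>U. \<forall>\<xi>\<in>tangent_space A y. minkowski p (f y) (differential A std_atlas f y \<xi>) = F y \<xi>)"
proof -
  have cA: "c \<in> A" and xc: "x \<in> cdom c" using c by (auto simp: charts_at_iff)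
  interpret C: berwald_chart "cimg c" "\<Gamma> c" "\<Phi> c" by (rule berwald_chart[OF cA])
  let ?y0 = "cmap c x"
  have y0: "?y0 \<in> cimg c" by (rule cmap_in[OF xc])
  obtain r f h E G where fl: "0 < r" "ball ?y0 r \<subseteq> cimg c" "f ?y0 = 0" "open (f ` ball ?y0 r)"
    "homeomorphism (ball ?y0 r) (f ` ball ?y0 r) f h"
    "smooth_on (ball ?y0 r) f" "smooth_on (f ` ball ?y0 r) h"
    "\<And>z. linear (E z)" "\<And>z. linear (G z)" "\<And>b. G ?y0 b = b"
    "\<And>z b. z \<in> ball ?y0 r \<Longrightarrow> E z (G z b) = b" "\<And>z b. z \<in> ball ?y0 r \<Longrightarrow> G z (E z b) = b"
    "\<And>z. z \<in> ball ?y0 r \<Longrightarrow> (f has_derivative E z) (at z)"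
    "\<And>z. z \<in> f ` ball ?y0 r \<Longrightarrow> (h has_derivative G (h z)) (at z)"
    "\<And>z b. z \<in> ball ?y0 r \<Longrightarrow> ((\<lambda>z. G z b) has_derivative (\<lambda>v. - \<Gamma> c z v (G z b))) (at z)"
  proof (rule flat_coordinates[OF C.\<Gamma> y0 C.sym flat[unfolded curv_def]], assumption, assumption)
  qed (rule that)
  define B where "B = ball ?y0 r"
  note fl = fl[folded B_def]
  have oB: "open B" "?y0 \<in> B" "convex B" using fl(1) by (auto simp: B_def)
  have hf: "h (f y) = y" if "y \<in> B" for y using fl(5) that by (simp add: homeomorphism_def)
  have fh: "f (h z) = z" and hB: "h z \<in> B" if "z \<in> f ` B" for z using fl(5) that by (auto simp: homeomorphism_def)
  \<comment> \<open>\<open>E y u\<close> gives the coefficients of \<open>u\<close> in the parallel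
    frame; the frame is the identity at the centre and \<open>\<Phi>\<close> is constant along its
    fields.\<close>
  have \<Phi>E: "\<Phi> c (y, u) = \<Phi> c (?y0, E y u)" if y: "y \<in> B" for y u
  proof (cases "u = 0")
    case True
    then show ?thesis
      using smooth_gauge.zero[OF C.gauge] y fl(2) y0 linear_0[OF fl(8)] by (simp add: subset_iff)
  next
    case False
    have b0: "E y u \<noteq> 0" using fl(12)[OF y, of u] False linear_0[OF fl(9)] by metis
    have "\<Phi> c (y, G y (E y u)) = \<Phi> c (?y0, G ?y0 (E y u))"
    proof (rule C.constant_in_parallel_frame[OF oB(3,1) fl(2) y oB(2)])
      show "G z (E y u) \<noteq> 0" if "z \<in> B" for z
        using fl(11)[OF that, of "E y u"] b0 linear_0[OF fl(8)] by metis
    qed (rule fl(15))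
    then show ?thesis by (simp add: fl(10) fl(12)[OF y])
  qed
  define M where "M = inv L"
  have LM: "M (L u) = u" "L (M u) = u" for u
    using L(2) by (simp_all add: M_def bij_is_inj bij_is_surj surj_f_inv_f)
  have M: "linear M" unfolding M_def using inj_linear_imp_inv_linear[OF L(1)] L(2) by (simp add: bij_is_inj)
  have bL: "bounded_linear L" and bM: "bounded_linear M"
    using L(1) M by (simp_all add: linear_conv_bounded_linear)
  define N where "N = cdom c \<inter> cmap c -` B"
  define ff where "ff x' = L (f (cmap c x'))" for x'
  define V where "V = M -` (f ` B)"
  have V: "open V" unfolding V_def
    by (rule open_vimage[OF fl(4)]) (rule linear_continuous_on[OF bM])
  have oN: "open N"
    unfolding N_def by (rule continuous_open_preimage[OF continuous_cmap[OF cA] open_cdom[OF cA] oB(1)])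
  have cN: "cmap c x' \<in> B" "x' \<in> cdom c" if "x' \<in> N" for x' using that by (auto simp: N_def)
  have Ninv: "cinv c y \<in> N" "cmap c (cinv c y) = y" if "y \<in> B" for y
    using that fl(2) cinv_in[OF cA, of y] cmap_cinv[OF cA, of y] by (auto simp: N_def)
  have inj: "inj_on ff N"
  proof (rule inj_onI)
    fix a b assume ab: "a \<in> N" "b \<in> N" "ff a = ff b"
    from arg_cong[OF ab(3), of "\<lambda>z. cinv c (h (M z))"]
    have "cinv c (h (f (cmap c a))) = cinv c (h (f (cmap c b)))" by (simp only: ff_def LM(1))
    then show "a = b" by (simp only: hf cinv_cmap cN ab cA)
  qed
  have ffN: "ff ` N = V"
  proof (intro equalityI subsetI)
    fix z assume "z \<in> ff ` N"
    then obtain a where "a \<in> N" "z = ff a" by blast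
    then show "z \<in> V" using cN(1) by (auto simp: V_def ff_def LM)
  next
    fix z assume "z \<in> V"
    then obtain y where y: "y \<in> B" "M z = f y" by (auto simp: V_def)
    then have "ff (cinv c y) = z" using Ninv(2)[OF y(1)] by (metis LM(2) ff_def)
    then show "z \<in> ff ` N" using Ninv(1)[OF y(1)] by blast
  qed
  have inv: "inv_into N ff z = cinv c (h (M z))" if z: "z \<in> V" for z
  proof (rule inv_into_f_eq[OF inj])
    have Mz: "M z \<in> f ` B" using z by (simp add: V_def)
    show "cinv c (h (M z)) \<in> N" by (rule Ninv(1)[OF hB[OF Mz]])
    show "ff (cinv c (h (M z))) = z"
      unfolding ff_def Ninv(2)[OF hB[OF Mz]] fh[OF Mz] by (rule LM(2))
  qed
  have hM: "smooth_on V (\<lambda>z. h (M z))"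
    by (rule smooth_on_compose[OF V fl(4) _ smooth_on_bounded_linear[OF bM V smooth_on_id] fl(7)])
      (auto simp: V_def)
  have rep: "cmap std_chart \<circ> ff \<circ> cinv c' = (\<lambda>y. L (f (transition c' c y)))" for c'
    by (auto simp: std_simps ff_def transition_def)
  have map1: "smooth_map A std_atlas N ff"
    unfolding smooth_map_def
  proof (intro conjI ballI oN)
    show "N \<subseteq> points A" using cA cN(2) by (auto simp: points_def simp del: split_paired_Ex)
    show "ff ` N \<subseteq> points std_atlas" by (simp add: std_simps)
    show "continuous_on N ff"
      unfolding ff_def
    proof (rule continuous_on_compose2[OF linear_continuous_on[OF bL, of UNIV]])
      show "continuous_on N (\<lambda>x. f (cmap c x))"
        by (rule continuous_on_compose2[OF smooth_on_continuous[OF fl(6)]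
            continuous_on_subset[OF continuous_cmap[OF cA]]]) (use cN in auto)
    qed simp
    fix c' :: "('m, 'n) chart" and d :: "(real ^ 'n, 'n) chart" assume c': "c' \<in> A" and "d \<in> std_atlas"
    then have d: "d = std_chart" by (simp add: std_simps)
    let ?S = "overlap c' c \<inter> transition c' c -` B"
    have S: "cmap c' ` {x \<in> N \<inter> cdom c'. ff x \<in> cdom d} = ?S"
    proof (intro equalityI subsetI)
      fix y assume "y \<in> cmap c' ` {x \<in> N \<inter> cdom c'. ff x \<in> cdom d}"
      then obtain a where a: "a \<in> N" "a \<in> cdom c'" "y = cmap c' a" by blast
      then show "y \<in> ?S" using cN[OF a(1)] by (simp add: overlapI transition_cmap[OF c'])
    next
      fix y assume y: "y \<in> ?S"
      then obtain a where a: "a \<in> cdom c'" "a \<in> cdom c" "y = cmap c' a" by (auto simp: overlap_def)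
      then have "a \<in> N" using y by (simp add: N_def transition_cmap[OF c'])
      then show "y \<in> cmap c' ` {x \<in> N \<inter> cdom c'. ff x \<in> cdom d}" using a by (auto simp: d std_simps)
    qed
    have oS: "open ?S"
      by (rule continuous_open_preimage[OF smooth_on_continuous[OF smooth_transition[OF c' cA]] open_overlap[OF c' cA] oB(1)])
    have "smooth_on ?S (\<lambda>y. f (transition c' c y))"
      by (rule smooth_on_compose[OF oS oB(1) _ _ fl(6)])
        (auto intro: smooth_on_subset[OF smooth_transition[OF c' cA]])
    then show "smooth_on (cmap c' ` {x \<in> N \<inter> cdom c'. ff x \<in> cdom d}) (cmap d \<circ> ff \<circ> cinv c')"
      unfolding S unfolding d rep by (rule smooth_on_bounded_linear[OF bL oS])
  qed
  have map2: "smooth_map std_atlas A V (inv_into N ff)"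
    unfolding smooth_map_def
  proof (intro conjI ballI V)
    show "V \<subseteq> points std_atlas" by (simp add: std_simps)
    show "inv_into N ff ` V \<subseteq> points A"
    proof (rule image_subsetI)
      fix z assume "z \<in> V"
      then have "inv_into N ff z \<in> N" unfolding ffN[symmetric] by (rule inv_into_into)
      then show "inv_into N ff z \<in> points A" using cN(2) cA unfolding points_def by blast
    qed
    have "continuous_on V (\<lambda>z. cinv c (h (M z)))"
      by (rule continuous_on_compose2[OF continuous_cinv[OF cA] smooth_on_continuous[OF hM]])
        (use hB fl(2) in \<open>auto simp: V_def\<close>)
    then show "continuous_on V (inv_into N ff)" by (simp add: inv cong: continuous_on_cong)
    fix c' :: "(real ^ 'n, 'n) chart" and d :: "('m, 'n) chart" assume "c' \<in> std_atlas" and d: "d \<in> A"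
    then have c': "c' = std_chart" by (simp add: std_simps)
    let ?S = "V \<inter> (\<lambda>z. h (M z)) -` overlap c d"
    have hMc: "h (M z) \<in> cimg c" if "z \<in> V" for z using hB[of "M z"] that fl(2) by (auto simp: V_def)
    have S: "cmap c' ` {z \<in> V \<inter> cdom c'. inv_into N ff z \<in> cdom d} = ?S"
      using inv hMc overlap_iff[OF cA, where d = d] by (auto simp: c' std_simps)
    have oS: "open ?S"
      by (rule continuous_open_preimage[OF smooth_on_continuous[OF hM] V open_overlap[OF cA d]])
    have "smooth_on ?S (\<lambda>z. transition c d (h (M z)))"
      by (rule smooth_on_compose[OF oS open_overlap[OF cA d] _ _ smooth_transition[OF cA d]])
        (auto intro: smooth_on_subset[OF hM])
    moreover have "transition c d (h (M z)) = (cmap d \<circ> inv_into N ff \<circ> cinv c') z" if "z \<in> ?S" for z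
      using that inv[of z] by (simp add: c' std_simps transition_def)
    ultimately show "smooth_on (cmap c' ` {z \<in> V \<inter> cdom c'. inv_into N ff z \<in> cdom d}) (cmap d \<circ> inv_into N ff \<circ> cinv c')"
      unfolding S
      using smooth_on_cong[OF oS, of "\<lambda>z. transition c d (h (M z))" "cmap d \<circ> inv_into N ff \<circ> cinv c'"] by blast
  qed
  have iso: "minkowski p (ff x') (differential A std_atlas ff x' \<xi>) = F x' \<xi>"
    if x': "x' \<in> N" and \<xi>: "\<xi> \<in> tangent_space A x'" for x' \<xi>
  proof -
    have cx': "c \<in> charts_at A x'" using cN(2)[OF x'] cA by (simp add: charts_at_iff)
    \<comment> \<open>\<open>differential\<close> is computed in a chart picked by choice, which may
      differ from \<open>c\<close>; the differential of the coordinate change converts the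
      components.\<close>
    define c' where "c' = (SOME c. c \<in> charts_at A x')"
    have c': "c' \<in> charts_at A x'" unfolding c'_def using cx' by (rule someI)
    let ?y = "cmap c x'"
    have c'A: "c' \<in> A" "x' \<in> cdom c'" using c' by (simp_all add: charts_at_iff)
    have "(f has_derivative E ?y) (at (transition c' c (cmap c' x')))"
      unfolding transition_cmap[OF c'A] by (rule fl(13)[OF cN(1)[OF x']])
    from has_derivative_compose[OF has_derivative_compose[OF transition_derivative_at[OF c' cx'] this]
        bounded_linear_imp_has_derivative[OF bL]]
    have "((cmap std_chart \<circ> ff \<circ> cinv c') has_derivative
      (\<lambda>u. L (E ?y (fd (transition c' c) (cmap c' x') u)))) (at (cmap c' x'))"
      unfolding rep .
    from fd_eq[OF this] have "differential A std_atlas ff x' \<xi> std_chart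
      = L (E ?y (fd (transition c' c) (cmap c' x') (\<xi> c')))"
      by (simp add: differential_def Let_def c'_def[symmetric] std_simps)
    also have "fd (transition c' c) (cmap c' x') (\<xi> c') = \<xi> c"
      using \<xi> c' cx' unfolding tangent_space_def by fastforce
    finally show ?thesis
      unfolding minkowski_def by (simp add: L(3) \<Phi>E[OF cN(1)[OF x'], symmetric] eq_local_rep[OF \<xi> cx'])
  qed
  have "x \<in> N" using xc oB(2) by (simp add: N_def)
  moreover have "diffeo_onto_image A std_atlas N ff"
    unfolding diffeo_onto_image_def ffN using inj map1 map2 by blast
  ultimately show ?thesis using iso by blast
qed

end

section \<open>Exclusion of the Riemannian case and choice of the Minkowski norm\<close>

theorem corollary3:
  fixes A :: "('m::{t2_space, second_countable_topology}, 'n::finite) chart set"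
    and F :: "'m \<Rightarrow> ('m, 'n) tvec \<Rightarrow> real"
  assumes "smooth_atlas A" and "connected (points A)" and "CARD('n) \<ge> 2"
    and "essentially_berwald A F"
    and "projectively_flat A F"
  shows "\<exists>p :: real ^ 'n \<Rightarrow> real. smooth_norm p \<and> locally_isometric A F std_atlas (minkowski p)"
proof -
  obtain \<Gamma> where F: "finsler_metric A F" "symmetric_connection A \<Gamma>" "parallel_transport_preserves A \<Gamma> F"
    and not_riem: "\<not> is_riemannian A F"
    using assms(4) unfolding essentially_berwald_def berwald_def by blast
  interpret berwald_atlas A F \<Gamma> using assms(1) F by unfold_locales
  obtain g \<Gamma>' where g: "riemannian_metric A g" "geodesically_equivalent A g F" "levi_civita A g \<Gamma>'"
    and flat': "\<And>c y u v w. c \<in> A \<Longrightarrow> y \<in> cimg c \<Longrightarrow> curv (\<Gamma>' c) y u v w = 0"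
    using assms(5) unfolding projectively_flat_def flat_metric_def curvature_eq_curv by blast
  have conn': "symmetric_connection A \<Gamma>'" using g(3) by (simp add: levi_civita_def)
  \<comment> \<open>The alternative is pointwise: a single point with a Euclidean norm would make
    \<open>F\<close> Riemannian on the whole connected manifold, so \<open>\<Gamma>\<close> is flat
    at every point.\<close>
  have flat: "curv (\<Gamma> c) y u v w = 0" if c: "c \<in> A" and y: "y \<in> cimg c" for c y u v w
  proof -
    interpret C: berwald_chart "cimg c" "\<Gamma> c" "\<Phi> c" by (rule berwald_chart[OF c])
    have "\<exists>a. \<Gamma> c y u u - \<Gamma>' c y u u = a *\<^sub>R u" if y: "y \<in> cimg c" for y u
      by (rule C.projective_change[OF y connection_bilinear[OF conn' c y] connection_sym[OF conn' c y]
          euler_lagrange_of_flat_geodesic[OF g(1,3) flat'[OF c] g(2) c y]])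
    then have "(\<forall>u v w. curv (\<Gamma> c) y u v w = 0) \<or> (\<exists>B. bilinear B \<and> (\<forall>\<xi>. (\<Phi> c (y, \<xi>))\<^sup>2 = B \<xi> \<xi>))"
      using assms(3) connection_sym[OF conn' c] flat'[OF c] y
      by (intro C.flat_or_euclidean[OF _ smooth_bilinear_connection[OF conn' c]]) auto
    moreover have False if "bilinear B" "\<And>\<xi>. (\<Phi> c (y, \<xi>))\<^sup>2 = B \<xi> \<xi>" for B
      using riemannian_if_euclidean_somewhere[OF assms(2) chart_at_cinv[OF c y] that(1)] that(2)
        cmap_cinv[OF c y] not_riem by simp
    ultimately show ?thesis by blast
  qed
  \<comment> \<open>A base point is needed to choose \<open>p\<close>; over the empty manifold
    \<open>F\<close> would count as Riemannian.\<close>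
  have "points A \<noteq> {}"
  proof
    assume e: "points A = {}"
    have "cimg c = {}" if "c \<in> A" for c using that e points_cinv by blast
    \<comment> \<open>On an empty chart image the local criterion for smoothness holds
      vacuously.\<close>
    then have "smooth_on (cimg c) f" if "c \<in> A" for c and f :: "real ^ 'n \<Rightarrow> real"
      using that by (intro smooth_on_local) simp
    then have "is_riemannian A F" using e by (auto simp: is_riemannian_def riemannian_metric_def)
    then show False using not_riem by simp
  qed
  then obtain x0 c0 where "c0 \<in> A" "x0 \<in> cdom c0" unfolding points_def by blast
  then have c0: "c0 \<in> charts_at A x0" by (simp add: charts_at_iff)
  define p where "p u = \<Phi> c0 (cmap c0 x0, u)" for u
  have "smooth_norm p" unfolding p_def by (rule smooth_norm_local_rep[OF c0])
  moreover have "locally_isometric A F std_atlas (minkowski p)"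
    unfolding locally_isometric_def
  proof
    fix x assume "x \<in> points A"
    then obtain c where c: "c \<in> A" "x \<in> cdom c" unfolding points_def by blast
    then have cx: "c \<in> charts_at A x" by (simp add: charts_at_iff)
    obtain L where L: "linear L" "bij L" "\<And>u. p (L u) = \<Phi> c (cmap c x, u)"
      using isometric_everywhere[OF assms(2) cx c0] unfolding isometric_at_def p_def by blast
    show "\<exists>U f. x \<in> U \<and> diffeo_onto_image A std_atlas U f \<and>
      (\<forall>y\<in>U. \<forall>\<xi>\<in>tangent_space A y. minkowski p (f y) (differential A std_atlas f y \<xi>) = F y \<xi>)"
      by (rule flat_local_isometry[OF cx flat[OF c(1)] L], assumption)
  qed
  ultimately show ?thesis by blast
qed

end
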